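(* Let $a>0$, and for a complex $2\times 2$ matrix $U$ let $\mathcal{M}_U$ be the restriction of the maximal Legendre operator $\mathcal{M}_{\max}$ determined by the boundary conditions associated with $U$ (see context). Then: (1) If $U$ is a unitary $2\times2$ matrix, then the operator $\mathcal{M}_U$ is self-adjoint in $L^2([-a,a])$, and $\mathcal{M}_{\min}\subset\mathcal{M}_U\subset\mathcal{M}_{\max}$. (2) Every operator $\mathcal{M}$ which is a self-adjoint extension of the minimal operator $\mathcal{M}_{\min}$, $\mathcal{M}_{\min}\subset\mathcal{M}\subset\mathcal{M}_{\max}$, is of the form $\mathcal{M}=\mathcal{M}_U$ for some unitary $2\times 2$ matrix $U$. (3) For unitary $2\times2$ matrices $U_1,U_2$: $U_1=U_2$ if and only if $\mathcal{M}_{U_1}=\mathcal{M}_{U_2}$.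
   Context: Fix a real number $a>0$; the Hilbert space is $L^2([-a,a])$ with $\langle u,v\rangle=\int_{-a}^a u(t)\overline{v(t)}\,dt$. Let $\mathcal{A}$ be the set of complex-valued functions $x$ on $(-a,a)$ such that $x'(t)$ exists at every $t\in(-a,a)$ and $x'$ is absolutely continuous on every compact subinterval of $(-a,a)$. For $x\in\mathcal{A}$ put $(Mx)(t)=-\frac{d}{dt}\Big(\big(1-\frac{t^2}{a^2}\big)\frac{dx(t)}{dt}\Big)$. Maximal operator: $\mathcal{D}_{\mathcal{M}_{\max}}=\{x\in L^2((-a,a))\cap\mathcal{A}: Mx\in L^2((-a,a))\}$, $\mathcal{M}_{\max}x=Mx$. Minimal operator: $\mathcal{M}_{\min}$ is the closure of the restriction of $\mathcal{M}_{\max}$ to those functions in $\mathcal{D}_{\mathcal{M}_{\max}}$ whose support is a compact subset of the open interval $(-a,a)$. For operators, $\subset$ means that the second operator extends the first. Generalized boundary values: for $x\in\mathcal{D}_{\mathcal{M}_{\max}}$ the following limits exist: $b_{-a}(x)=\lim_{t\to -a+0}(t+a)x'(t)$, $\; b_{a}(x)=\lim_{t\to a-0}(t-a)x'(t)$, $c_{-a}(x)=\lim_{t\to -a+0}\big((t+a)\ln(a+t)\,x'(t)-x(t)\big)$, $\; c_{a}(x)=\lim_{t\to a-0}\big((t-a)\ln(a-t)\,x'(t)-x(t)\big)$. For a complex $2\times2$ matrix $U=(u_{pq})$, the operator $\mathcal{M}_U$ is the restriction of $\mathcal{M}_{\max}$ to the set $\mathcal{D}_{\mathcal{M}_U}$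 of all $x\in\mathcal{D}_{\mathcal{M}_{\max}}$ satisfying $(1+u_{11})b_{-a}(x)-i(1-u_{11})c_{-a}(x)+u_{12}b_a(x)+iu_{12}c_a(x)=0$, $u_{21}b_{-a}(x)+iu_{21}c_{-a}(x)+(1+u_{22})b_a(x)-i(1-u_{22})c_a(x)=0$. *)

theory Defs
  imports "HOL-Analysis.Analysis"
begin

section \<open>Square-integrable functions and unbounded operators\<close>

text \<open>
  Elements of the Hilbert space \<open>L\<^sup>2(M)\<close> are represented by square-integrable functions, two
  functions that agree almost everywhere being representatives of the same element.  An operator
  is identified with its graph, and the graph is represented by the set of \<^emph>\<open>all\<close> pairs of
  representatives of its elements, i.e. by a set of pairs that is saturated with respect to
  almost-everywhere equality.  Hence equality and inclusion of these sets are equality and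
  extension of operators.
\<close>

definition L2 :: "'a measure \<Rightarrow> ('a \<Rightarrow> complex) set" where
  "L2 M = {f \<in> borel_measurable M. integrable M (\<lambda>t. (cmod (f t))\<^sup>2)}"

definition L2_inner :: "'a measure \<Rightarrow> ('a \<Rightarrow> complex) \<Rightarrow> ('a \<Rightarrow> complex) \<Rightarrow> complex" where
  "L2_inner M u v = (\<integral>t. u t * cnj (v t) \<partial>M)"

definition L2_norm :: "'a measure \<Rightarrow> ('a \<Rightarrow> complex) \<Rightarrow> real" where
  "L2_norm M u = sqrt (\<integral>t. (cmod (u t))\<^sup>2 \<partial>M)"

type_synonym 'a L2_graph = "(('a \<Rightarrow> complex) \<times> ('a \<Rightarrow> complex)) set"

definition linear_operator :: "'a measure \<Rightarrow> 'a L2_graph \<Rightarrow> bool" where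
  "linear_operator M G \<longleftrightarrow>
     G \<subseteq> L2 M \<times> L2 M \<and>
     \<comment> \<open>saturated with respect to almost-everywhere equality\<close>
     (\<forall>(f, g) \<in> G. \<forall>f' \<in> L2 M. \<forall>g' \<in> L2 M.
        (AE t in M. f' t = f t) \<and> (AE t in M. g' t = g t) \<longrightarrow> (f', g') \<in> G) \<and>
     \<comment> \<open>a linear subspace\<close>
     ((\<lambda>_. 0), (\<lambda>_. 0)) \<in> G \<and>
     (\<forall>(f, g) \<in> G. \<forall>(f', g') \<in> G. ((\<lambda>t. f t + f' t), (\<lambda>t. g t + g' t)) \<in> G) \<and>
     (\<forall>c. \<forall>(f, g) \<in> G. ((\<lambda>t. c * f t), (\<lambda>t. c * g t)) \<in> G) \<and>
     \<comment> \<open>single-valued on classes\<close>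
     (\<forall>f g g'. (f, g) \<in> G \<and> (f, g') \<in> G \<longrightarrow> (AE t in M. g t = g' t))"

definition densely_defined :: "'a measure \<Rightarrow> 'a L2_graph \<Rightarrow> bool" where
  "densely_defined M G \<longleftrightarrow>
     (\<forall>f \<in> L2 M. \<forall>\<epsilon>>0. \<exists>(u, v) \<in> G. L2_norm M (\<lambda>t. f t - u t) < \<epsilon>)"

definition adjoint_operator :: "'a measure \<Rightarrow> 'a L2_graph \<Rightarrow> 'a L2_graph" where
  "adjoint_operator M G =
     {(y, z). y \<in> L2 M \<and> z \<in> L2 M \<and> (\<forall>(x, w) \<in> G. L2_inner M w y = L2_inner M x z)}"

definition self_adjoint_operator :: "'a measure \<Rightarrow> 'a L2_graph \<Rightarrow> bool" where
  "self_adjoint_operator M G \<longleftrightarrow>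
     linear_operator M G \<and> densely_defined M G \<and> adjoint_operator M G = G"

definition operator_closure :: "'a measure \<Rightarrow> 'a L2_graph \<Rightarrow> 'a L2_graph" where
  "operator_closure M G =
     {(f, g). f \<in> L2 M \<and> g \<in> L2 M \<and>
        (\<forall>\<epsilon>>0. \<exists>(u, v) \<in> G.
           L2_norm M (\<lambda>t. f t - u t) < \<epsilon> \<and> L2_norm M (\<lambda>t. g t - v t) < \<epsilon>)}"


section \<open>The Legendre operators\<close>

definition absolutely_continuous_on :: "real set \<Rightarrow> (real \<Rightarrow> complex) \<Rightarrow> bool" where
  "absolutely_continuous_on S f \<longleftrightarrow>
     (\<forall>\<epsilon>>0. \<exists>\<delta>>0. \<forall>P :: (real \<times> real) set.
        finite P \<and> (\<forall>(u, v) \<in> P. u < v \<and> {u..v} \<subseteq> S) \<and>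
        pairwise (\<lambda>p q. {fst p<..<snd p} \<inter> {fst q<..<snd q} = {}) P \<and>
        (\<Sum>(u, v) \<in> P. v - u) < \<delta>
        \<longrightarrow> (\<Sum>(u, v) \<in> P. cmod (f v - f u)) < \<epsilon>)"

text \<open>
  Functions on \<open>(-a, a)\<close> are represented by total functions; their values outside
  the open interval are irrelevant throughout.
\<close>

definition legendre_class :: "real \<Rightarrow> (real \<Rightarrow> complex) set" where
  "legendre_class a =
     {x. (\<forall>t \<in> {-a<..<a}. x differentiable (at t)) \<and>
         (\<forall>c d. -a < c \<and> c \<le> d \<and> d < a \<longrightarrow>
            absolutely_continuous_on {c..d} (\<lambda>t. vector_derivative x (at t)))}"

text \<open>
  For \<open>x\<close> in \<open>legendre_class a\<close> the outer derivative exists almost everywhere on \<open>(-a, a)\<close>; the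
  arbitrary value of \<^const>\<open>vector_derivative\<close> on the exceptional null set does not matter.
\<close>

definition legendre_expr :: "real \<Rightarrow> (real \<Rightarrow> complex) \<Rightarrow> real \<Rightarrow> complex" where
  "legendre_expr a x t =
     - vector_derivative
         (\<lambda>s. complex_of_real (1 - s\<^sup>2 / a\<^sup>2) * vector_derivative x (at s)) (at t)"

abbreviation lebesgue_interval :: "real \<Rightarrow> real measure" where
  "lebesgue_interval a \<equiv> lebesgue_on {-a..a}"

definition D_max :: "real \<Rightarrow> (real \<Rightarrow> complex) set" where
  "D_max a = {x \<in> L2 (lebesgue_interval a) \<inter> legendre_class a.
                legendre_expr a x \<in> L2 (lebesgue_interval a)}"

text \<open>The operator \<open>x \<mapsto> Mx\<close> with domain (the set of classes of elements of) \<open>D\<close>.\<close>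

definition legendre_restrict :: "real \<Rightarrow> (real \<Rightarrow> complex) set \<Rightarrow> real L2_graph" where
  "legendre_restrict a D =
     {(f, g). f \<in> L2 (lebesgue_interval a) \<and> g \<in> L2 (lebesgue_interval a) \<and>
        (\<exists>x \<in> D. (AE t in lebesgue_interval a. f t = x t) \<and>
                 (AE t in lebesgue_interval a. g t = legendre_expr a x t))}"

definition M_max :: "real \<Rightarrow> real L2_graph" where
  "M_max a = legendre_restrict a (D_max a)"

definition interval_support :: "real \<Rightarrow> (real \<Rightarrow> complex) \<Rightarrow> real set" where
  "interval_support a x = {-a<..<a} \<inter> closure {t \<in> {-a<..<a}. x t \<noteq> 0}"

definition M_min :: "real \<Rightarrow> real L2_graph" where
  "M_min a = operator_closure (lebesgue_interval a)
     (legendre_restrict a {x \<in> D_max a. compact (interval_support a x)})"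


section \<open>Generalized boundary values and boundary conditions\<close>

text \<open>For \<open>x \<in> D_max a\<close> all four limits exist.\<close>

definition b_left :: "real \<Rightarrow> (real \<Rightarrow> complex) \<Rightarrow> complex" where
  "b_left a x = Lim (at_right (-a))
     (\<lambda>t. complex_of_real (t + a) * vector_derivative x (at t))"

definition b_right :: "real \<Rightarrow> (real \<Rightarrow> complex) \<Rightarrow> complex" where
  "b_right a x = Lim (at_left a)
     (\<lambda>t. complex_of_real (t - a) * vector_derivative x (at t))"

definition c_left :: "real \<Rightarrow> (real \<Rightarrow> complex) \<Rightarrow> complex" where
  "c_left a x = Lim (at_right (-a))
     (\<lambda>t. complex_of_real ((t + a) * ln (a + t)) * vector_derivative x (at t) - x t)"

definition c_right :: "real \<Rightarrow> (real \<Rightarrow> complex) \<Rightarrow> complex" where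
  "c_right a x = Lim (at_left a)
     (\<lambda>t. complex_of_real ((t - a) * ln (a - t)) * vector_derivative x (at t) - x t)"

definition D_U :: "real \<Rightarrow> complex^2^2 \<Rightarrow> (real \<Rightarrow> complex) set" where
  "D_U a U = {x \<in> D_max a.
     (1 + U$1$1) * b_left a x - \<i> * (1 - U$1$1) * c_left a x
       + U$1$2 * b_right a x + \<i> * U$1$2 * c_right a x = 0 \<and>
     U$2$1 * b_left a x + \<i> * U$2$1 * c_left a x
       + (1 + U$2$2) * b_right a x - \<i> * (1 - U$2$2) * c_right a x = 0}"

definition M_U :: "real \<Rightarrow> complex^2^2 \<Rightarrow> real L2_graph" where
  "M_U a U = legendre_restrict a (D_U a U)"

definition conj_transpose :: "complex^'n^'m \<Rightarrow> complex^'m^'n" where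
  "conj_transpose U = (\<chi> i j. cnj (U$j$i))"

definition unitary_matrix :: "complex^'n^'n \<Rightarrow> bool" where
  "unitary_matrix U \<longleftrightarrow>
     conj_transpose U ** U = mat 1 \<and> U ** conj_transpose U = mat 1"

end

theory Submission
  imports Defs "HOL-Real_Asymp.Real_Asymp"
begin

text \<open>
  Put \<open>p t = 1 - t\<^sup>2 / a\<^sup>2\<close> and \<open>\<psi> = p x'\<close>.  An element of the maximal domain is the same as a
  solution of the system \<open>x' = \<psi> / p\<close>, \<open>\<psi>' = - g\<close> with \<open>g\<close> square integrable; by Cauchy-Schwarz
  \<open>\<psi>\<close> is Hoelder continuous of order \<open>1/2\<close> up to the end points, which gives the generalized
  boundary values.  In the coordinates \<open>v = b + \<i> c\<close>, \<open>w = b - \<i> c\<close> Green's formula reads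
  \<open>\<langle>Mx, y\<rangle> - \<langle>x, My\<rangle> = - (\<i>/a) (\<langle>v x, v y\<rangle> - \<langle>w x, w y\<rangle>)\<close>, and the boundary condition
  of \<open>U\<close> is \<open>w = - U v\<close>.

  The adjoint of the compactly supported operator is contained in the maximal one: after
  subtracting a solution of \<open>My = z\<close>, what remains is orthogonal to every compactly supported \<open>g\<close> that is
  orthogonal to the kernel of the maximal operator, hence lies in that two-dimensional kernel.
  Therefore self-adjoint extensions correspond to Lagrangian subspaces of the boundary
  data, and these are exactly the graphs of the maps \<open>- U\<close> with \<open>U\<close> unitary.
\<close>

section \<open>Absolutely continuous functions\<close>

text \<open>The maximal domain is defined by the epsilon-delta notion of absolute continuity, so
  passing to the integrated system needs Lebesgue's fundamental theorem; it is derived from monotone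
  majorants and the Radon-Nikodym theorem for their Stieltjes measures. Conversely only square
  integrable densities occur, where Young's inequality suffices. Both end points are of limit-circle
  type: solutions are square integrable automatically, and all four boundary values can be
  prescribed independently. \<open>M_min a\<close> is never computed: it is reached from below
  through compactly supported functions and from above through the closedness of adjoints. Graphs
  contain arbitrary representatives, while boundary values need the differentiable one; two elements
  of \<open>D_max a\<close> in the same class agree on the open interval, so boundary values are
  functions of the class. Density is proved with polynomials vanishing at both end points, whose
  boundary values are all zero, so that they satisfy the conditions of every \<open>U\<close>
  simultaneously.\<close>

definition nonoverlapping :: "(real \<times> real) set \<Rightarrow> bool" where
  "nonoverlapping P \<longleftrightarrow> finite P \<and> (\<forall>(u, v) \<in> P. u < v) \<and>
     (\<forall>p \<in> P. \<forall>q \<in> P. p \<noteq> q \<longrightarrow> snd p \<le> fst q \<or> snd q \<le> fst p)"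

text \<open>Disjointness becomes an order relation between end points, which monotone maps preserve
  and linear arithmetic can use. Both intervals have to be nonempty, since an empty one is disjoint
  from everything.\<close>

lemma greaterThanLessThan_disjoint_iff:
  fixes u v u' v' :: real
  assumes "u < v" "u' < v'"
  shows "{u<..<v} \<inter> {u'<..<v'} = {} \<longleftrightarrow> v \<le> u' \<or> v' \<le> u"
proof
  assume *: "{u<..<v} \<inter> {u'<..<v'} = {}"
  show "v \<le> u' \<or> v' \<le> u"
  proof (rule ccontr)
    assume "\<not> (v \<le> u' \<or> v' \<le> u)"
    then obtain w where "max u u' < w" "w < min v v'"
      using dense[of "max u u'" "min v v'"] assms by auto
    then show False using * by auto
  qed
qed auto

lemma nonoverlapping_iff_pairwise:
  "finite P \<and> (\<forall>(u, v) \<in> P. u < v \<and> {u..v} \<subseteq> S) \<and>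
     pairwise (\<lambda>p q. {fst p<..<snd p} \<inter> {fst q<..<snd q} = {}) P \<longleftrightarrow>
   nonoverlapping P \<and> (\<forall>(u, v) \<in> P. {u..v} \<subseteq> S)"
proof -
  have *: "pairwise (\<lambda>p q. {fst p<..<snd p} \<inter> {fst q<..<snd q} = {}) P \<longleftrightarrow>
      (\<forall>p \<in> P. \<forall>q \<in> P. p \<noteq> q \<longrightarrow> snd p \<le> fst q \<or> snd q \<le> fst p)"
    if P: "\<forall>p \<in> P. fst p < snd p"
    unfolding pairwise_def
  proof (intro ball_cong imp_cong refl)
    show "{fst p<..<snd p} \<inter> {fst q<..<snd q} = {} \<longleftrightarrow> snd p \<le> fst q \<or> snd q \<le> fst p"
      if "p \<in> P" "q \<in> P" for p q
      by (rule greaterThanLessThan_disjoint_iff) (use P that in blast)+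
  qed
  show ?thesis
    unfolding nonoverlapping_def case_prod_unfold ball_conj_distrib using * by argo
qed

lemma absolutely_continuous_on_iff:
  "absolutely_continuous_on S f \<longleftrightarrow>
     (\<forall>\<epsilon>>0. \<exists>\<delta>>0. \<forall>P. nonoverlapping P \<and> (\<forall>(u, v) \<in> P. {u..v} \<subseteq> S) \<and>
        (\<Sum>(u, v) \<in> P. v - u) < \<delta> \<longrightarrow> (\<Sum>(u, v) \<in> P. cmod (f v - f u)) < \<epsilon>)"
proof -
  have "(A \<and> B \<and> C \<longleftrightarrow> N \<and> D) \<Longrightarrow> (A \<and> B \<and> C \<and> R \<longleftrightarrow> N \<and> D \<and> R)" for A B C N D R
    by blast
  from this[OF nonoverlapping_iff_pairwise] show ?thesis
    unfolding absolutely_continuous_on_def by (simp only:)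
qed

lemma nonoverlapping_subset: "nonoverlapping P \<Longrightarrow> Q \<subseteq> P \<Longrightarrow> nonoverlapping Q"
  unfolding nonoverlapping_def by (meson finite_subset subsetD)

text \<open>By induction on the number of intervals: the one reaching furthest to the right is split
  off, and the others fit into \<open>{c..u}\<close>, where \<open>u\<close> is its left end. With
  \<open>H\<close> the identity this bounds total length, with \<open>H\<close> a primitive it
  bounds sums of integrals.\<close>

lemma nonoverlapping_sum_le:
  fixes H :: "real \<Rightarrow> real"
  assumes "nonoverlapping P" "\<And>u v. (u, v) \<in> P \<Longrightarrow> c \<le> u \<and> v \<le> d" "mono_on {c..d} H" "c \<le> d"
  shows "(\<Sum>(u, v) \<in> P. H v - H u) \<le> H d - H c"
  using assms
proof (induction "card P" arbitrary: P d)
  case 0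
  then have "P = {}" by (auto simp: nonoverlapping_def)
  moreover have "H c \<le> H d" using 0 by (intro mono_onD[of "{c..d}" H]) auto
  ultimately show ?case by simp
next
  case (Suc n)
  have fin: "finite P" and ne: "P \<noteq> {}"
    using Suc.hyps Suc.prems(1) by (auto simp: nonoverlapping_def)
  define m where "m = Max (snd ` P)"
  have "m \<in> snd ` P" unfolding m_def using fin ne by auto
  then obtain u v where uv: "(u, v) \<in> P" "m = v" by auto
  have v_max: "v' \<le> v" if "(u', v') \<in> P" for u' v'
  proof -
    have "v' \<in> snd ` P" using that by force
    then show ?thesis using fin uv(2) unfolding m_def by (metis Max_ge finite_imageI)
  qed
  have u_less: "u < v" "c \<le> u" "v \<le> d"
    using Suc.prems(1) Suc.prems(2)[OF uv(1)] uv(1) unfolding nonoverlapping_def by blast+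
  \<comment> \<open>By the maximality of \<open>v\<close>, an interval to the right of
    \<open>(u, v)\<close> would be empty, so all the others lie to its left.\<close>
  have rest: "v' \<le> u" if "(u', v') \<in> P - {(u, v)}" for u' v'
  proof -
    have "u' < v'" "v' \<le> u \<or> v \<le> u'"
      using that Suc.prems(1) uv(1) unfolding nonoverlapping_def
      by (blast, metis Diff_iff fst_conv insertI1 snd_conv)
    with v_max[of u' v'] that show ?thesis by auto
  qed
  have "(\<Sum>(u, v) \<in> P - {(u, v)}. H v - H u) \<le> H u - H c"
  proof (rule Suc.hyps(1))
    show "n = card (P - {(u, v)})" using Suc.hyps(2) fin uv by simp
    show "nonoverlapping (P - {(u, v)})" using Suc.prems(1) by (rule nonoverlapping_subset) auto
    show "mono_on {c..u} H" using Suc.prems(3) by (rule mono_on_subset) (use u_less(1,3) in auto)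
    show "c \<le> u' \<and> v' \<le> u" if "(u', v') \<in> P - {(u, v)}" for u' v'
      using rest[OF that] Suc.prems(2)[of u' v'] that by blast
  qed (use u_less in blast)
  moreover have "(\<Sum>(u, v) \<in> P. H v - H u) = H v - H u + (\<Sum>(u, v) \<in> P - {(u, v)}. H v - H u)"
    by (subst sum.remove[OF fin uv(1)]) simp
  moreover have "H v \<le> H d" using Suc.prems(3) u_less by (intro mono_onD[of "{c..d}" H]) auto
  ultimately show ?case by simp
qed

text \<open>A monotone map may collapse intervals to points. These are dropped from
  \<open>Q\<close>, at no cost in a sum whose summand vanishes on the diagonal. It is applied to
  \<open>min\<close> and \<open>max\<close> with a cut point and to clamping.\<close>

lemma nonoverlapping_image:
  fixes \<phi> :: "real \<Rightarrow> real" and h :: "real \<Rightarrow> real \<Rightarrow> real"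
  assumes P: "nonoverlapping P" and "mono \<phi>"
  defines "Q \<equiv> (\<lambda>(u, v). (\<phi> u, \<phi> v)) ` {(u, v) \<in> P. \<phi> u < \<phi> v}"
  shows "nonoverlapping Q"
    and "(\<And>x. h x x = 0) \<Longrightarrow> (\<Sum>(u, v) \<in> Q. h u v) = (\<Sum>(u, v) \<in> P. h (\<phi> u) (\<phi> v))"
proof -
  let ?R = "{(u, v) \<in> P. \<phi> u < \<phi> v}"
  let ?f = "\<lambda>(u, v). (\<phi> u, \<phi> v)"
  have fin: "finite P" using P by (auto simp: nonoverlapping_def)
  have sep: "\<phi> (snd p) \<le> \<phi> (fst q) \<or> \<phi> (snd q) \<le> \<phi> (fst p)" if "p \<in> P" "q \<in> P" "p \<noteq> q" for p q
    using that P \<open>mono \<phi>\<close> unfolding nonoverlapping_def by (meson monoD)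
  show "nonoverlapping Q"
    unfolding nonoverlapping_def
  proof (intro conjI ballI impI)
    show "finite Q" unfolding Q_def using fin by (auto intro: finite_subset[of _ P])
    show "case p of (u, v) \<Rightarrow> u < v" if "p \<in> Q" for p using that by (auto simp: Q_def)
    show "snd p \<le> fst q \<or> snd q \<le> fst p" if "p \<in> Q" "q \<in> Q" "p \<noteq> q" for p q
    proof -
      have "Q \<subseteq> ?f ` P" unfolding Q_def by (intro image_mono) auto
      then have "p \<in> ?f ` P" "q \<in> ?f ` P" using that by auto
      then obtain p' q' where "p' \<in> P" "q' \<in> P" "p = ?f p'" "q = ?f q'"
        by (elim imageE)
      then show ?thesis using sep[of p' q'] that by (cases p'; cases q') auto
    qed
  qed
  assume h: "\<And>x. h x x = 0"
  \<comment> \<open>Different intervals remain separated after mapping, by \<open>sep\<close>, so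
    they cannot share a nondegenerate image.\<close>
  have "inj_on ?f ?R"
  proof (rule inj_onI, rule ccontr)
    fix p q assume "p \<in> ?R" "q \<in> ?R" "?f p = ?f q" "p \<noteq> q"
    then show False using sep[of p q] by (cases p; cases q) auto
  qed
  then have "(\<Sum>(u, v) \<in> Q. h u v) = (\<Sum>(u, v) \<in> ?R. h (\<phi> u) (\<phi> v))"
    unfolding Q_def by (subst sum.reindex) (auto simp: case_prod_unfold)
  also have "\<dots> = (\<Sum>(u, v) \<in> P. h (\<phi> u) (\<phi> v))"
  proof (rule sum.mono_neutral_left)
    show "\<forall>i\<in>P - ?R. (case i of (u, v) \<Rightarrow> h (\<phi> u) (\<phi> v)) = 0"
    proof (safe, goal_cases)
      case (1 u v)
      then have "u < v" using P by (auto simp: nonoverlapping_def)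
      then have "\<phi> u \<le> \<phi> v" using \<open>mono \<phi>\<close> by (auto intro: monoD)
      moreover have "\<phi> u \<noteq> \<phi> v" using 1 h by auto
      ultimately show ?case by simp
    qed
  qed (use fin in auto)
  finally show "(\<Sum>(u, v) \<in> Q. h u v) = (\<Sum>(u, v) \<in> P. h (\<phi> u) (\<phi> v))" .
qed

section \<open>Comparison and closure properties of absolute continuity\<close>

lemma absolutely_continuous_onD:
  assumes "absolutely_continuous_on S f" "\<epsilon> > 0"
  obtains \<delta> where "\<delta> > 0" "\<And>P. nonoverlapping P \<Longrightarrow> (\<And>u v. (u, v) \<in> P \<Longrightarrow> {u..v} \<subseteq> S) \<Longrightarrow>
     (\<Sum>(u, v) \<in> P. v - u) < \<delta> \<Longrightarrow> (\<Sum>(u, v) \<in> P. cmod (f v - f u)) < \<epsilon>"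
proof -
  have "\<exists>\<delta>>0. \<forall>P. nonoverlapping P \<and> (\<forall>(u, v) \<in> P. {u..v} \<subseteq> S) \<and>
        (\<Sum>(u, v) \<in> P. v - u) < \<delta> \<longrightarrow> (\<Sum>(u, v) \<in> P. cmod (f v - f u)) < \<epsilon>"
    using assms unfolding absolutely_continuous_on_iff by blast
  then show ?thesis using that by blast
qed

text \<open>The comparison principle behind sums, products, conjugates, Lipschitz functions and
  reciprocals: only a bound for single increments has to be checked in each case.\<close>

lemma absolutely_continuous_on_dominated:
  assumes f: "absolutely_continuous_on S f" and g: "absolutely_continuous_on S g"
    and le: "\<And>u v. u < v \<Longrightarrow> {u..v} \<subseteq> S \<Longrightarrow>
      cmod (h v - h u) \<le> A * cmod (f v - f u) + B * cmod (g v - g u)"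
  shows "absolutely_continuous_on S h"
  unfolding absolutely_continuous_on_iff
proof (intro allI impI)
  fix \<epsilon> :: real assume "\<epsilon> > 0"
  \<comment> \<open>The summand 1 keeps \<open>K\<close> positive and makes the final estimate
    strict, even for \<open>A = B = 0\<close>.\<close>
  define K where "K = 2 * (\<bar>A\<bar> + \<bar>B\<bar> + 1)"
  have K: "K > 0" by (simp add: K_def add_nonneg_pos)
  then have "\<epsilon> / K > 0" using \<open>\<epsilon> > 0\<close> by simp
  obtain d1 where d1: "d1 > 0" "\<And>P. nonoverlapping P \<Longrightarrow> (\<And>u v. (u, v) \<in> P \<Longrightarrow> {u..v} \<subseteq> S) \<Longrightarrow>
     (\<Sum>(u, v) \<in> P. v - u) < d1 \<Longrightarrow> (\<Sum>(u, v) \<in> P. cmod (f v - f u)) < \<epsilon> / K"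
    using absolutely_continuous_onD[OF f \<open>\<epsilon> / K > 0\<close>] by blast
  obtain d2 where d2: "d2 > 0" "\<And>P. nonoverlapping P \<Longrightarrow> (\<And>u v. (u, v) \<in> P \<Longrightarrow> {u..v} \<subseteq> S) \<Longrightarrow>
     (\<Sum>(u, v) \<in> P. v - u) < d2 \<Longrightarrow> (\<Sum>(u, v) \<in> P. cmod (g v - g u)) < \<epsilon> / K"
    using absolutely_continuous_onD[OF g \<open>\<epsilon> / K > 0\<close>] by blast
  show "\<exists>\<delta>>0. \<forall>P. nonoverlapping P \<and> (\<forall>(u, v) \<in> P. {u..v} \<subseteq> S) \<and>
        (\<Sum>(u, v) \<in> P. v - u) < \<delta> \<longrightarrow> (\<Sum>(u, v) \<in> P. cmod (h v - h u)) < \<epsilon>"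
  proof (intro exI[of _ "min d1 d2"] conjI allI impI)
    fix P assume P: "nonoverlapping P \<and> (\<forall>(u, v) \<in> P. {u..v} \<subseteq> S) \<and> (\<Sum>(u, v) \<in> P. v - u) < min d1 d2"
    let ?F = "\<Sum>(u, v) \<in> P. cmod (f v - f u)" and ?G = "\<Sum>(u, v) \<in> P. cmod (g v - g u)"
    have "?F < \<epsilon> / K" by (rule d1(2)) (use P in auto)
    have "?G < \<epsilon> / K" by (rule d2(2)) (use P in auto)
    have nn: "?F \<ge> 0" "?G \<ge> 0" by (auto intro!: sum_nonneg)
    have "(\<Sum>(u, v) \<in> P. cmod (h v - h u)) \<le> (\<Sum>(u, v) \<in> P. A * cmod (f v - f u) + B * cmod (g v - g u))"
      using P by (intro sum_mono) (auto simp: nonoverlapping_def intro!: le)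
    also have "\<dots> = A * ?F + B * ?G"
      by (simp add: sum.distrib sum_distrib_left case_prod_unfold)
    also have "\<dots> \<le> \<bar>A\<bar> * (\<epsilon> / K) + \<bar>B\<bar> * (\<epsilon> / K)"
      using nn \<open>?F < \<epsilon> / K\<close> \<open>?G < \<epsilon> / K\<close>
      by (intro add_mono mult_mono) auto
    also have "\<dots> < K * (\<epsilon> / K)"
      unfolding distrib_right[symmetric] using \<open>\<epsilon> / K > 0\<close>
      by (intro mult_strict_right_mono) (auto simp: K_def)
    finally show "(\<Sum>(u, v) \<in> P. cmod (h v - h u)) < \<epsilon>" using K by simp
  qed (use d1(1) d2(1) in auto)
qed

lemma absolutely_continuous_on_id: "absolutely_continuous_on S complex_of_real"
  unfolding absolutely_continuous_on_iff
proof (intro allI impI)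
  fix \<epsilon> :: real assume "\<epsilon> > 0"
  have "(\<Sum>(u, v) \<in> P. cmod (complex_of_real v - complex_of_real u)) = (\<Sum>(u, v) \<in> P. v - u)"
    if "nonoverlapping P" for P
    using that
    by (intro sum.cong refl) (auto simp: nonoverlapping_def simp flip: of_real_diff)
  with \<open>\<epsilon> > 0\<close> show "\<exists>\<delta>>0. \<forall>P. nonoverlapping P \<and> (\<forall>(u, v) \<in> P. {u..v} \<subseteq> S) \<and>
        (\<Sum>(u, v) \<in> P. v - u) < \<delta> \<longrightarrow>
        (\<Sum>(u, v) \<in> P. cmod (complex_of_real v - complex_of_real u)) < \<epsilon>"
    by (intro exI[of _ \<epsilon>]) auto
qed

lemma absolutely_continuous_on_Lipschitz:
  assumes "\<And>u v. u < v \<Longrightarrow> {u..v} \<subseteq> S \<Longrightarrow> cmod (h v - h u) \<le> L * (v - u)"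
  shows "absolutely_continuous_on S h"
  by (rule absolutely_continuous_on_dominated[OF absolutely_continuous_on_id
        absolutely_continuous_on_id, of _ _ L 0])
     (use assms in \<open>auto simp flip: of_real_diff\<close>)

lemma absolutely_continuous_on_subset:
  "absolutely_continuous_on S f \<Longrightarrow> T \<subseteq> S \<Longrightarrow> absolutely_continuous_on T f"
  unfolding absolutely_continuous_on_iff[of T]
proof (intro allI impI)
  fix \<epsilon> :: real assume f: "absolutely_continuous_on S f" and "T \<subseteq> S" "\<epsilon> > 0"
  obtain \<delta> where \<delta>: "\<delta> > 0" "\<And>P. nonoverlapping P \<Longrightarrow> (\<And>u v. (u, v) \<in> P \<Longrightarrow> {u..v} \<subseteq> S) \<Longrightarrow>
     (\<Sum>(u, v) \<in> P. v - u) < \<delta> \<Longrightarrow> (\<Sum>(u, v) \<in> P. cmod (f v - f u)) < \<epsilon>"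
    using absolutely_continuous_onD[OF f \<open>\<epsilon> > 0\<close>] by blast
  show "\<exists>\<delta>>0. \<forall>P. nonoverlapping P \<and> (\<forall>(u, v) \<in> P. {u..v} \<subseteq> T) \<and> (\<Sum>(u, v) \<in> P. v - u) < \<delta> \<longrightarrow>
      (\<Sum>(u, v) \<in> P. cmod (f v - f u)) < \<epsilon>"
  proof (intro exI[of _ \<delta>] conjI allI impI \<delta>)
    fix P u v assume "nonoverlapping P \<and> (\<forall>(u, v) \<in> P. {u..v} \<subseteq> T) \<and> (\<Sum>(u, v) \<in> P. v - u) < \<delta>"
      and "(u, v) \<in> P"
    then have "{u..v} \<subseteq> T" by blast
    then show "{u..v} \<subseteq> S" using \<open>T \<subseteq> S\<close> by (rule subset_trans)
  qed auto
qed

lemma absolutely_continuous_on_cong: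
  assumes "absolutely_continuous_on S f" "\<And>t. t \<in> S \<Longrightarrow> f t = g t"
  shows "absolutely_continuous_on S g"
  by (rule absolutely_continuous_on_dominated[OF assms(1) assms(1), of _ 1 0])
     (auto simp: subset_iff assms(2)[symmetric])

lemma absolutely_continuous_on_add:
  assumes "absolutely_continuous_on S f" "absolutely_continuous_on S g"
  shows "absolutely_continuous_on S (\<lambda>t. f t + g t)"
  by (rule absolutely_continuous_on_dominated[OF assms, of _ 1 1])
     (simp add: add_diff_add norm_triangle_ineq)

lemma absolutely_continuous_on_small_dist:
  assumes "absolutely_continuous_on {c..d} f" "e > 0"
  obtains \<delta> where "\<delta> > 0" "\<And>u v. u \<in> {c..d} \<Longrightarrow> v \<in> {c..d} \<Longrightarrow> \<bar>v - u\<bar> < \<delta> \<Longrightarrow> cmod (f v - f u) < e"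
proof -
  obtain \<delta> where \<delta>: "\<delta> > 0" "\<And>P. nonoverlapping P \<Longrightarrow> (\<And>u v. (u, v) \<in> P \<Longrightarrow> {u..v} \<subseteq> {c..d}) \<Longrightarrow>
     (\<Sum>(u, v) \<in> P. v - u) < \<delta> \<Longrightarrow> (\<Sum>(u, v) \<in> P. cmod (f v - f u)) < e"
    using absolutely_continuous_onD[OF assms] by blast
  have *: "cmod (f v - f u) < e" if "u \<in> {c..d}" "v \<in> {c..d}" "u < v" "v - u < \<delta>" for u v
    using \<delta>(2)[of "{(u, v)}"] that by (auto simp: nonoverlapping_def)
  show ?thesis
  proof
    show "cmod (f v - f u) < e" if "u \<in> {c..d}" "v \<in> {c..d}" "\<bar>v - u\<bar> < \<delta>" for u v
      using *[of u v] *[of v u] that \<open>e > 0\<close>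
      by (cases u v rule: linorder_cases) (auto simp: norm_minus_commute)
  qed (rule \<delta>)
qed

lemma absolutely_continuous_on_imp_continuous_on:
  assumes "absolutely_continuous_on {c..d} f"
  shows "continuous_on {c..d} f"
  unfolding continuous_on_iff
proof (intro ballI allI impI)
  fix x and e :: real assume "x \<in> {c..d}" "e > 0"
  then show "\<exists>\<delta>>0. \<forall>x'\<in>{c..d}. dist x' x < \<delta> \<longrightarrow> dist (f x') (f x) < e"
    by (metis absolutely_continuous_on_small_dist[OF assms \<open>e > 0\<close>] dist_norm dist_real_def)
qed

lemma absolutely_continuous_on_mult:
  assumes f: "absolutely_continuous_on {c..d} f" and g: "absolutely_continuous_on {c..d} g"
  shows "absolutely_continuous_on {c..d} (\<lambda>t. f t * g t)"
proof -
  have "bounded (f ` {c..d})" "bounded (g ` {c..d})"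
    using f g by (auto intro!: compact_imp_bounded compact_continuous_image
        absolutely_continuous_on_imp_continuous_on)
  then obtain A B where A: "\<And>t. t \<in> {c..d} \<Longrightarrow> cmod (f t) \<le> A" and B: "\<And>t. t \<in> {c..d} \<Longrightarrow> cmod (g t) \<le> B"
    unfolding bounded_iff by blast
  show ?thesis
  proof (rule absolutely_continuous_on_dominated[OF f g, of _ B A])
    fix u v :: real assume "u < v" "{u..v} \<subseteq> {c..d}"
    then have uv: "u \<in> {c..d}" "v \<in> {c..d}" by auto
    have "f v * g v - f u * g u = (f v - f u) * g v + f u * (g v - g u)"
      by (simp add: algebra_simps)
    also have "cmod \<dots> \<le> cmod (f v - f u) * cmod (g v) + cmod (f u) * cmod (g v - g u)"
      by (metis norm_mult norm_triangle_ineq)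
    also have "\<dots> \<le> B * cmod (f v - f u) + A * cmod (g v - g u)"
      using A[OF uv(1)] B[OF uv(2)]
      by (intro add_mono) (auto simp: mult.commute intro!: mult_right_mono mult_left_mono)
    finally show "cmod (f v * g v - f u * g u) \<le> B * cmod (f v - f u) + A * cmod (g v - g u)" .
  qed
qed

lemma absolutely_continuous_on_cnj:
  "absolutely_continuous_on S f \<Longrightarrow> absolutely_continuous_on S (\<lambda>t. cnj (f t))"
  by (rule absolutely_continuous_on_dominated[of S f f _ 1 0]) (auto simp flip: complex_cnj_diff)

lemma absolutely_continuous_on_minus:
  "absolutely_continuous_on S f \<Longrightarrow> absolutely_continuous_on S (\<lambda>t. - f t)"
  by (rule absolutely_continuous_on_dominated[of S f f _ 1 0]) (auto simp: norm_minus_commute)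

section \<open>Cutting families of intervals and the total variation\<close>

lemma nonoverlapping_split:
  assumes P: "nonoverlapping P"
  obtains P1 P2 where "nonoverlapping P1" "nonoverlapping P2"
    "\<And>u v. (u, v) \<in> P1 \<Longrightarrow> \<exists>u' v'. (u', v') \<in> P \<and> u = min u' s \<and> v = min v' s"
    "\<And>u v. (u, v) \<in> P2 \<Longrightarrow> \<exists>u' v'. (u', v') \<in> P \<and> u = max u' s \<and> v = max v' s"
    "(\<Sum>(u, v) \<in> P. cmod (F v - F u)) \<le> (\<Sum>(u, v) \<in> P1. cmod (F v - F u)) + (\<Sum>(u, v) \<in> P2. cmod (F v - F u))"
proof -
  define P1 where "P1 = (\<lambda>(u, v). (min u s, min v s)) ` {(u, v) \<in> P. min u s < min v s}"
  define P2 where "P2 = (\<lambda>(u, v). (max u s, max v s)) ` {(u, v) \<in> P. max u s < max v s}"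
  have m: "mono (\<lambda>u. min u s)" "mono (\<lambda>u. max u s)" by (auto intro!: monoI)
  have 1: "(\<Sum>(u, v) \<in> P1. cmod (F v - F u)) = (\<Sum>(u, v) \<in> P. cmod (F (min v s) - F (min u s)))"
    unfolding P1_def by (rule nonoverlapping_image(2)[OF P m(1)]) simp
  have 2: "(\<Sum>(u, v) \<in> P2. cmod (F v - F u)) = (\<Sum>(u, v) \<in> P. cmod (F (max v s) - F (max u s)))"
    unfolding P2_def by (rule nonoverlapping_image(2)[OF P m(2)]) simp
  \<comment> \<open>Only an interval containing \<open>s\<close> is really cut, and there the
    triangle inequality is used; otherwise one of the two terms on the right is zero.\<close>
  have *: "cmod (F v - F u) \<le> cmod (F (min v s) - F (min u s)) + cmod (F (max v s) - F (max u s))"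
    if "u < v" for u v
  proof -
    consider "v \<le> s" | "s \<le> u" | "u \<le> s" "s \<le> v" by linarith
    then show ?thesis
    proof cases
      case 3
      then show ?thesis
        using norm_triangle_ineq[of "F s - F u" "F v - F s"] by simp
    qed (use that in auto)
  qed
  show ?thesis
  proof (rule that)
    show "nonoverlapping P1" unfolding P1_def by (rule nonoverlapping_image(1)[OF P m(1)])
    show "nonoverlapping P2" unfolding P2_def by (rule nonoverlapping_image(1)[OF P m(2)])
    show "(\<Sum>(u, v) \<in> P. cmod (F v - F u)) \<le> (\<Sum>(u, v) \<in> P1. cmod (F v - F u)) + (\<Sum>(u, v) \<in> P2. cmod (F v - F u))"
      unfolding 1 2 unfolding case_prod_unfold sum.distrib[symmetric]
      using P by (intro sum_mono *) (auto simp: nonoverlapping_def)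
  qed (auto simp: P1_def P2_def)
qed

text \<open>The interval is exhausted in steps of length \<eta>. Each induction step cuts off the
  last piece, whose intervals are short enough in total to have variation below 1, so the number of
  steps is a bound.\<close>

lemma absolutely_continuous_bounded_variation:
  assumes F: "absolutely_continuous_on UNIV F"
  shows "\<exists>B. \<forall>P. nonoverlapping P \<and> (\<forall>(u, v) \<in> P. c \<le> u \<and> v \<le> d) \<longrightarrow> (\<Sum>(u, v) \<in> P. cmod (F v - F u)) \<le> B"
proof -
  obtain \<delta> where \<delta>: "\<delta> > 0" "\<And>P. nonoverlapping P \<Longrightarrow>
     (\<Sum>(u, v) \<in> P. v - u) < \<delta> \<Longrightarrow> (\<Sum>(u, v) \<in> P. cmod (F v - F u)) < 1"
    using absolutely_continuous_onD[OF F, of 1] by auto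
  \<comment> \<open>Strictly less than \<delta>, because the intervals in one piece may have total
    length exactly \<eta>.\<close>
  define \<eta> where "\<eta> = \<delta> / 2"
  have \<eta>: "\<eta> > 0" "\<eta> < \<delta>" using \<delta>(1) by (auto simp: \<eta>_def)
  have step: "(\<Sum>(u, v) \<in> P. cmod (F v - F u)) \<le> real n"
    if "nonoverlapping P" "\<And>u v. (u, v) \<in> P \<Longrightarrow> c \<le> u \<and> v \<le> c + real n * \<eta>" for n P
    using that
  proof (induction n arbitrary: P)
    case 0
    have "P = {}"
      using 0 unfolding nonoverlapping_def by fastforce
    then show ?case by simp
  next
    case (Suc n)
    define s where "s = c + real n * \<eta>"
    have s: "c \<le> s" using \<eta> by (simp add: s_def)
    obtain P1 P2 where P12: "nonoverlapping P1" "nonoverlapping P2"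
      "\<And>u v. (u, v) \<in> P1 \<Longrightarrow> \<exists>u' v'. (u', v') \<in> P \<and> u = min u' s \<and> v = min v' s"
      "\<And>u v. (u, v) \<in> P2 \<Longrightarrow> \<exists>u' v'. (u', v') \<in> P \<and> u = max u' s \<and> v = max v' s"
      "(\<Sum>(u, v) \<in> P. cmod (F v - F u)) \<le> (\<Sum>(u, v) \<in> P1. cmod (F v - F u)) + (\<Sum>(u, v) \<in> P2. cmod (F v - F u))"
      using nonoverlapping_split[OF Suc.prems(1)] by blast
    have "(\<Sum>(u, v) \<in> P1. cmod (F v - F u)) \<le> real n"
    proof (rule Suc.IH[OF P12(1)])
      fix u v assume "(u, v) \<in> P1"
      then obtain u' v' where "(u', v') \<in> P" "u = min u' s" "v = min v' s" using P12(3) by blast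
      then show "c \<le> u \<and> v \<le> c + real n * \<eta>" using Suc.prems(2)[of u' v'] s by (auto simp: s_def)
    qed
    moreover have "(\<Sum>(u, v) \<in> P2. v - u) \<le> (s + \<eta>) - s"
    proof (rule nonoverlapping_sum_le[of P2 s "s + \<eta>" "\<lambda>t. t", OF P12(2)])
      fix u v assume "(u, v) \<in> P2"
      then obtain u' v' where "(u', v') \<in> P" "u = max u' s" "v = max v' s" using P12(4) by blast
      then show "s \<le> u \<and> v \<le> s + \<eta>"
        using Suc.prems(2)[of u' v'] \<eta> by (auto simp: s_def algebra_simps)
    qed (use \<eta> in \<open>auto intro!: mono_onI\<close>)
    then have "(\<Sum>(u, v) \<in> P2. cmod (F v - F u)) < 1"
      by (intro \<delta>(2) P12(2)) (use \<eta> in auto)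
    ultimately show ?case using P12(5) by simp
  qed
  obtain n :: nat where n: "(d - c) / \<eta> \<le> real n" using real_arch_simple by blast
  then have n': "d \<le> c + real n * \<eta>" using \<eta> by (simp add: field_simps)
  show ?thesis
  proof (intro exI[of _ "real n"] allI impI)
    fix P assume P: "nonoverlapping P \<and> (\<forall>(u, v) \<in> P. c \<le> u \<and> v \<le> d)"
    show "(\<Sum>(u, v) \<in> P. cmod (F v - F u)) \<le> real n"
      by (rule step) (use P n' in \<open>fastforce+\<close>)
  qed
qed

text \<open>\<open>V t\<close> is the variation of \<open>F\<close> to the left of \<open>t\<close>;
  clamping makes \<open>F\<close> constant outside \<open>{c..d}\<close>, so the supremum is finite.
  Absolute continuity passes to \<open>V\<close> because the variation over each interval of a short
  family is nearly attained by a finer family inside it, and the union of these is again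
  short.\<close>

lemma absolutely_continuous_monotone_majorant:
  assumes F: "absolutely_continuous_on UNIV F"
    and clamp: "\<And>t. F t = F (max c (min t d))"
  obtains V :: "real \<Rightarrow> real" where
    "absolutely_continuous_on UNIV (\<lambda>t. complex_of_real (V t))"
    "\<And>u v. u \<le> v \<Longrightarrow> cmod (F v - F u) \<le> V v - V u"
proof -
  let ?S = "\<lambda>P. \<Sum>(u, v) \<in> P. cmod (F v - F u)"
  define A where "A t = ?S ` {P. nonoverlapping P \<and> (\<forall>(u, v) \<in> P. v \<le> t)}" for t
  define V where "V t = Sup (A t)" for t
  have "\<exists>B. \<forall>P. nonoverlapping P \<longrightarrow> ?S P \<le> B"
  proof -
    obtain B where B: "\<And>P. nonoverlapping P \<and> (\<forall>(u, v) \<in> P. c \<le> u \<and> v \<le> max c d) \<Longrightarrow> ?S P \<le> B"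
      using absolutely_continuous_bounded_variation[OF F, of c "max c d"] by metis
    let ?\<phi> = "\<lambda>t. max c (min t d)"
    have "?S P \<le> B" if P: "nonoverlapping P" for P
    proof -
      let ?Q = "(\<lambda>(u, v). (?\<phi> u, ?\<phi> v)) ` {(u, v) \<in> P. ?\<phi> u < ?\<phi> v}"
      have m: "mono ?\<phi>" by (intro monoI) auto
      have "?S ?Q = (\<Sum>(u, v) \<in> P. cmod (F (?\<phi> v) - F (?\<phi> u)))"
        by (rule nonoverlapping_image(2)[OF P m, of "\<lambda>u v. cmod (F v - F u)"]) simp
      also have "\<dots> = ?S P" by (simp only: clamp[symmetric])
      finally have "?S P = ?S ?Q" ..
      also have "\<dots> \<le> B"
        by (rule B) (use nonoverlapping_image(1)[OF P m] in auto)
      finally show ?thesis .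
    qed
    then show ?thesis by blast
  qed
  then obtain B where B: "\<And>P. nonoverlapping P \<Longrightarrow> ?S P \<le> B" by blast
  have bdd: "bdd_above (A t)" for t
    unfolding A_def by (rule bdd_aboveI[of _ B]) (use B in blast)
  have emp: "nonoverlapping {}" by (simp add: nonoverlapping_def)
  have ne: "A t \<noteq> {}" for t
    unfolding A_def using emp by blast
  have V_upper: "?S P \<le> V t" if "nonoverlapping P" "\<And>u v. (u, v) \<in> P \<Longrightarrow> v \<le> t" for P t
    unfolding V_def by (rule cSup_upper[OF _ bdd]) (use that in \<open>auto simp: A_def\<close>)
  have V_approx: "\<exists>P. nonoverlapping P \<and> (\<forall>(u, v) \<in> P. v \<le> t) \<and> V t - e < ?S P" if "e > 0" for t e
  proof -
    have "\<exists>x\<in>A t. V t - e < x"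
      using that less_cSup_iff[OF ne bdd, of "V t - e" t] by (simp add: V_def)
    then show ?thesis unfolding A_def by blast
  qed
  \<comment> \<open>A nearly optimal family to the left of \<open>u\<close> can be extended by
    \<open>(u, v)\<close> and then competes for \<open>V v\<close>.\<close>
  have mono: "cmod (F v - F u) \<le> V v - V u" if "u < v" for u v
  proof (rule field_le_epsilon)
    fix e :: real assume "e > 0"
    then obtain P where P: "nonoverlapping P" "\<forall>(u', v') \<in> P. v' \<le> u" "V u - e < ?S P"
      using V_approx by blast
    have notin: "(u, v) \<notin> P" using P(2) that by force
    have fin: "finite P" using P(1) by (simp add: nonoverlapping_def)
    have "nonoverlapping (insert (u, v) P)"
      using P(1,2) that unfolding nonoverlapping_def by fastforce
    then have "?S (insert (u, v) P) \<le> V v"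
      by (rule V_upper) (use P(2) that in fastforce)
    moreover have "?S (insert (u, v) P) = cmod (F v - F u) + ?S P"
      using fin notin by simp
    ultimately show "cmod (F v - F u) \<le> V v - V u + e" using P(3) by linarith
  qed
  \<comment> \<open>Cutting a nearly optimal family for \<open>V v\<close> at \<open>u\<close>
    leaves a left half worth at most \<open>V u\<close>; the right half serves as
    \<open>Q\<close>.\<close>
  have local: "\<exists>Q. nonoverlapping Q \<and> (\<forall>(x, y) \<in> Q. u \<le> x \<and> y \<le> v) \<and> V v - V u \<le> ?S Q + e"
    if "u < v" "e > 0" for u v e
  proof -
    obtain P where P: "nonoverlapping P" "\<forall>(u', v') \<in> P. v' \<le> v" "V v - e < ?S P"
      using V_approx \<open>e > 0\<close> by blast
    obtain P1 P2 where P12: "nonoverlapping P1" "nonoverlapping P2"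
      "\<And>x y. (x, y) \<in> P1 \<Longrightarrow> \<exists>u' v'. (u', v') \<in> P \<and> x = min u' u \<and> y = min v' u"
      "\<And>x y. (x, y) \<in> P2 \<Longrightarrow> \<exists>u' v'. (u', v') \<in> P \<and> x = max u' u \<and> y = max v' u"
      "?S P \<le> ?S P1 + ?S P2"
      using nonoverlapping_split[OF P(1)] by blast
    have "?S P1 \<le> V u" by (rule V_upper[OF P12(1)]) (use P12(3) in fastforce)
    moreover have "\<forall>(x, y) \<in> P2. u \<le> x \<and> y \<le> v"
    proof safe
      fix x y assume "(x, y) \<in> P2"
      then obtain u' v' where *: "(u', v') \<in> P" "x = max u' u" "y = max v' u" using P12(4) by blast
      then have "v' \<le> v" using P(2) by blast
      then show "u \<le> x" "y \<le> v" using * \<open>u < v\<close> by auto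
    qed
    ultimately show ?thesis using P12(2,5) P(3) by (intro exI[of _ P2]) auto
  qed
  have "absolutely_continuous_on UNIV (\<lambda>t. complex_of_real (V t))"
    unfolding absolutely_continuous_on_iff
  proof (intro allI impI)
    fix \<epsilon> :: real assume "\<epsilon> > 0"
    then have "\<epsilon> / 2 > 0" by simp
    then obtain \<delta> where \<delta>: "\<delta> > 0" "\<And>P. nonoverlapping P \<Longrightarrow>
       (\<Sum>(u, v) \<in> P. v - u) < \<delta> \<Longrightarrow> ?S P < \<epsilon> / 2"
      using absolutely_continuous_onD[OF F \<open>\<epsilon> / 2 > 0\<close>] by (metis UNIV_I subsetI)
    show "\<exists>\<delta>>0. \<forall>P. nonoverlapping P \<and> (\<forall>(u, v)\<in>P. {u..v} \<subseteq> UNIV) \<and> (\<Sum>(u, v)\<in>P. v - u) < \<delta> \<longrightarrow>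
      (\<Sum>(u, v)\<in>P. cmod (complex_of_real (V v) - complex_of_real (V u))) < \<epsilon>"
    proof (intro exI[of _ \<delta>] conjI allI impI \<open>\<delta> > 0\<close>)
      fix P assume "nonoverlapping P \<and> (\<forall>(u, v)\<in>P. {u..v} \<subseteq> UNIV) \<and> (\<Sum>(u, v)\<in>P. v - u) < \<delta>"
      then have P: "nonoverlapping P" "(\<Sum>(u, v)\<in>P. v - u) < \<delta>" by auto
      have fin: "finite P" using P(1) by (simp add: nonoverlapping_def)
      have less: "fst p < snd p" if "p \<in> P" for p
        using P(1) that unfolding nonoverlapping_def by force
      have sep: "snd p \<le> fst q \<or> snd q \<le> fst p" if "p \<in> P" "q \<in> P" "p \<noteq> q" for p q
        using P(1) that unfolding nonoverlapping_def by blast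
      \<comment> \<open>Each interval of \<open>P\<close> contributes one error \<open>e\<close>,
        together at most \<epsilon> / 2; the summand 1 keeps the denominator positive for empty
        \<open>P\<close>.\<close>
      define e where "e = \<epsilon> / (2 * (real (card P) + 1))"
      have e: "e > 0" using \<open>\<epsilon> > 0\<close> by (simp add: e_def add_nonneg_pos)
      have "\<forall>p\<in>P. \<exists>Q. nonoverlapping Q \<and> (\<forall>(x, y) \<in> Q. fst p \<le> x \<and> y \<le> snd p) \<and> V (snd p) - V (fst p) \<le> ?S Q + e"
        using local[OF less e] by blast
      then obtain Q where Q: "\<And>p. p \<in> P \<Longrightarrow> nonoverlapping (Q p)"
        "\<And>p x y. p \<in> P \<Longrightarrow> (x, y) \<in> Q p \<Longrightarrow> fst p \<le> x \<and> y \<le> snd p"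
        "\<And>p. p \<in> P \<Longrightarrow> V (snd p) - V (fst p) \<le> ?S (Q p) + e"
        by (metis (no_types, lifting) case_prodD)
      have Qless: "x < y" if "p \<in> P" "(x, y) \<in> Q p" for p x y
        using Q(1)[OF that(1)] that(2) unfolding nonoverlapping_def by blast
      have Qfin: "finite (Q p)" if "p \<in> P" for p
        using Q(1)[OF that] unfolding nonoverlapping_def by blast
      have Qsep: "y \<le> x' \<or> y' \<le> x" if "p \<in> P" "q \<in> P" "p \<noteq> q" "(x, y) \<in> Q p" "(x', y') \<in> Q q" for p q x y x' y'
        using sep[OF that(1-3)] Q(2)[OF that(1,4)] Q(2)[OF that(2,5)] by linarith
      have Qdisj: "Q p \<inter> Q q = {}" if "p \<in> P" "q \<in> P" "p \<noteq> q" for p q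
      proof (rule ccontr)
        assume "Q p \<inter> Q q \<noteq> {}"
        then obtain x y where "(x, y) \<in> Q p" "(x, y) \<in> Q q" by auto
        then show False using Qsep[OF that, of x y x y] Qless[OF that(1), of x y] by auto
      qed
      have no: "nonoverlapping (\<Union>p\<in>P. Q p)"
        unfolding nonoverlapping_def
      proof (intro conjI ballI impI)
        show "finite (\<Union>p\<in>P. Q p)" using fin Qfin by auto
        show "case r of (u, v) \<Rightarrow> u < v" if "r \<in> (\<Union>p\<in>P. Q p)" for r
          using that Qless by (cases r) auto
        show "snd r \<le> fst r' \<or> snd r' \<le> fst r"
          if r: "r \<in> (\<Union>p\<in>P. Q p)" "r' \<in> (\<Union>p\<in>P. Q p)" "r \<noteq> r'" for r r'
        proof -
          obtain p q where pq: "p \<in> P" "q \<in> P" "r \<in> Q p" "r' \<in> Q q" using r by blast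
          show ?thesis
          proof (cases "p = q")
            case True
            then show ?thesis using Q(1)[OF pq(1)] pq r(3) unfolding nonoverlapping_def by blast
          next
            case False
            then show ?thesis using Qsep[OF pq(1,2) False, of "fst r" "snd r" "fst r'" "snd r'"] pq by simp
          qed
        qed
      qed
      have sumQ: "(\<Sum>x\<in>(\<Union>p\<in>P. Q p). f x) = (\<Sum>p\<in>P. \<Sum>x\<in>Q p. f x)" for f :: "real \<times> real \<Rightarrow> real"
        using fin Qfin Qdisj by (intro sum.UNION_disjoint) auto
      have "(\<Sum>(u, v)\<in>(\<Union>p\<in>P. Q p). v - u) \<le> (\<Sum>(u, v)\<in>P. v - u)"
        unfolding sumQ unfolding case_prod_unfold
      proof (rule sum_mono)
        fix p assume "p \<in> P"
        have "(\<Sum>(u, v)\<in>Q p. v - u) \<le> snd p - fst p"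
          by (rule nonoverlapping_sum_le[of "Q p" "fst p" "snd p" "\<lambda>t. t", OF Q(1)[OF \<open>p \<in> P\<close>]])
             (use Q(2)[OF \<open>p \<in> P\<close>] less[OF \<open>p \<in> P\<close>] in \<open>auto intro!: mono_onI\<close>)
        then show "(\<Sum>p\<in>Q p. snd p - fst p) \<le> snd p - fst p" by (simp add: case_prod_unfold)
      qed
      then have "?S (\<Union>p\<in>P. Q p) < \<epsilon> / 2" using P(2) by (intro \<delta>(2) no) auto
      then have *: "(\<Sum>p\<in>P. ?S (Q p)) < \<epsilon> / 2" by (simp only: sumQ)
      have "(\<Sum>(u, v)\<in>P. cmod (complex_of_real (V v) - complex_of_real (V u))) = (\<Sum>p\<in>P. V (snd p) - V (fst p))"
      proof (rule sum.cong[OF refl])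
        fix p assume "p \<in> P"
        have "0 \<le> V (snd p) - V (fst p)"
          using mono[OF less[OF \<open>p \<in> P\<close>]] norm_ge_zero[of "F (snd p) - F (fst p)"] by linarith
        then show "(case p of (u, v) \<Rightarrow> cmod (complex_of_real (V v) - complex_of_real (V u))) = V (snd p) - V (fst p)"
          by (simp add: case_prod_unfold flip: of_real_diff)
      qed
      also have "\<dots> \<le> (\<Sum>p\<in>P. ?S (Q p) + e)" by (intro sum_mono Q(3))
      also have "\<dots> = (\<Sum>p\<in>P. ?S (Q p)) + real (card P) * e" by (simp add: sum.distrib)
      also have "real (card P) * e \<le> (real (card P) + 1) * e" using e by simp
      also have "\<dots> = \<epsilon> / 2" unfolding e_def by (simp add: field_simps add_nonneg_eq_0_iff)
      finally show "(\<Sum>(u, v)\<in>P. cmod (complex_of_real (V v) - complex_of_real (V u))) < \<epsilon>"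
        using * by simp
    qed
  qed
  moreover have "cmod (F v - F u) \<le> V v - V u" if "u \<le> v" for u v
    using mono[of u v] that by (cases "u = v") auto
  ultimately show ?thesis using that by blast
qed

section \<open>The fundamental theorem for absolutely continuous functions\<close>

text \<open>Inside a bounded window, a null set is covered by countably many nonoverlapping
  intervals lying in an open set of small Lebesgue measure. Absolute continuity bounds the Stieltjes
  measure of every finite subfamily by \<open>e\<close>, and continuity from below carries the bound
  over to the whole cover.\<close>

lemma absolutely_continuous_monotone_null_sets:
  fixes G :: "real \<Rightarrow> real"
  assumes G: "absolutely_continuous_on UNIV (\<lambda>t. complex_of_real (G t))" and "mono G"
    and cont: "continuous_on UNIV G"
  shows "absolutely_continuous lborel (interval_measure G)"
  unfolding absolutely_continuous_def
proof
  fix N assume N: "N \<in> null_sets (lborel :: real measure)"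
  let ?\<mu> = "interval_measure G"
  have Icc: "emeasure ?\<mu> {u..v} = ennreal (G v - G u)" if "u \<le> v" for u v
    by (rule emeasure_interval_measure_Icc) (use that \<open>mono G\<close> cont in \<open>auto dest: monoD\<close>)
  have N_sets: "N \<in> sets borel" using N by (simp add: null_sets_def)
  have small: "emeasure ?\<mu> (N \<inter> {- real n..real n}) \<le> ennreal e" if "e > 0" for e and n :: nat
  proof (cases "n = 0")
    \<comment> \<open>The covering lemma asks for a box with nonempty interior, so the one-point
      window is treated separately.\<close>
    case True
    have "emeasure ?\<mu> (N \<inter> {0..0}) \<le> emeasure ?\<mu> {0..0}" by (intro emeasure_mono) auto
    also have "\<dots> = 0" by (subst Icc) auto
    finally show ?thesis using True by simp
  next
    case False
    obtain \<delta> where \<delta>: "\<delta> > 0" "\<And>P. nonoverlapping P \<Longrightarrow>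
       (\<Sum>(u, v) \<in> P. v - u) < \<delta> \<Longrightarrow> (\<Sum>(u, v) \<in> P. cmod (complex_of_real (G v) - complex_of_real (G u))) < e"
      using absolutely_continuous_onD[OF G \<open>e > 0\<close>] by (metis UNIV_I subsetI)
    obtain U where U: "open U" "N \<subseteq> U" "emeasure lborel (U - N) < ennreal \<delta>"
      using outer_regular_lborel[of N "\<delta>"] N_sets \<delta>(1) by auto
    have U_sets: "U \<in> sets borel" using U(1) by simp
    have "emeasure lborel U \<le> emeasure lborel (U - N) + emeasure lborel N"
      using U_sets N_sets by (intro order_trans[OF emeasure_mono emeasure_subadditive]) auto
    then have U_less: "emeasure lborel U < ennreal \<delta>" using U(3) N by (auto simp: null_sets_def)
    \<comment> \<open>Each interval of the cover is contained in \<open>g x\<close> for some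
      \<open>x\<close> in the null set; since \<open>N \<subseteq> U\<close>, this forces it into
      \<open>U\<close>.\<close>
    define g where "g x = (if x \<in> U then U else UNIV)" for x
    have "gauge g" using U(1) by (auto simp: gauge_def g_def)
    obtain \<D> where D: "countable \<D>" "\<And>K. K \<in> \<D> \<Longrightarrow> interior K \<noteq> {} \<and> (\<exists>c d. K = cbox c d)"
      "pairwise (\<lambda>A B. interior A \<inter> interior B = {}) \<D>"
      "\<And>K. K \<in> \<D> \<Longrightarrow> \<exists>x \<in> (N \<inter> {- real n..real n}) \<inter> K. K \<subseteq> g x"
      "N \<inter> {- real n..real n} \<subseteq> \<Union>\<D>"
      by (rule covering_lemma[of "N \<inter> {- real n..real n}" "- real n" "real n" g, OF _ _ \<open>gauge g\<close>])
         (use False in auto)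
    have DU: "K \<subseteq> U" if K: "K \<in> \<D>" for K
    proof -
      obtain x where "x \<in> N" "K \<subseteq> g x" using D(4)[OF K] by blast
      moreover have "x \<in> U" using U(2) \<open>x \<in> N\<close> by blast
      ultimately show ?thesis by (simp add: g_def)
    qed
    have DI: "\<exists>u v. K = {u..v} \<and> u < v" if K: "K \<in> \<D>" for K
    proof -
      obtain c d where "K = cbox c d" "interior K \<noteq> {}" using D(2)[OF K] by blast
      then show ?thesis by (auto simp: box_real(1) box_real(2))
    qed
    define l r where "l = (Inf :: real set \<Rightarrow> real)" and "r = (Sup :: real set \<Rightarrow> real)"
    have lr: "K = {l K..r K}" "l K < r K" if "K \<in> \<D>" for K
      using DI[OF that] by (auto simp: l_def r_def)
    have fin_le: "emeasure ?\<mu> (\<Union>F) \<le> ennreal e" if F: "finite F" "F \<subseteq> \<D>" for F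
    proof -
      have inj: "inj_on (\<lambda>K. (l K, r K)) F"
        using lr F(2) by (intro inj_onI) (metis Pair_inject subsetD)
      have disj: "r K \<le> l L \<or> r L \<le> l K" if "K \<in> F" "L \<in> F" "K \<noteq> L" for K L
      proof -
        have "K \<in> \<D>" "L \<in> \<D>" using that F by auto
        then have "interior K \<inter> interior L = {}" using D(3) that(3) by (auto simp: pairwise_def)
        then have "{l K<..<r K} \<inter> {l L<..<r L} = {}"
          using lr(1)[OF \<open>K \<in> \<D>\<close>] lr(1)[OF \<open>L \<in> \<D>\<close>] by (metis interior_atLeastAtMost_real)
        then show ?thesis
          using greaterThanLessThan_disjoint_iff[OF lr(2)[OF \<open>K \<in> \<D>\<close>] lr(2)[OF \<open>L \<in> \<D>\<close>]] by simp
      qed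
      define P where "P = (\<lambda>K. (l K, r K)) ` F"
      have "nonoverlapping P"
        unfolding nonoverlapping_def
      proof (intro conjI ballI impI)
        show "finite P" using F by (simp add: P_def)
        show "case p of (u, v) \<Rightarrow> u < v" if "p \<in> P" for p
          using that lr F by (auto simp: P_def)
        show "snd p \<le> fst q \<or> snd q \<le> fst p" if "p \<in> P" "q \<in> P" "p \<noteq> q" for p q
          using that disj unfolding P_def by force
      qed
      have sumP: "(\<Sum>(u, v)\<in>P. h u v) = (\<Sum>K\<in>F. h (l K) (r K))" for h :: "real \<Rightarrow> real \<Rightarrow> real"
        unfolding P_def by (subst sum.reindex[OF inj]) simp
      have lrF: "l K < r K" if "K \<in> F" for K using lr that F by blast
      have "ennreal (\<Sum>K\<in>F. r K - l K) = (\<Sum>K\<in>F. emeasure lborel {l K<..<r K})"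
        using lrF by (subst sum_ennreal[symmetric]) (auto intro!: sum.cong simp: less_imp_le)
      also have "\<dots> = emeasure lborel (\<Union>K\<in>F. {l K<..<r K})"
      proof (rule sum_emeasure)
        show "disjoint_family_on (\<lambda>K. {l K<..<r K}) F"
          unfolding disjoint_family_on_def
        proof (intro ballI impI)
          fix K L assume KL: "K \<in> F" "L \<in> F" "K \<noteq> L"
          show "{l K<..<r K} \<inter> {l L<..<r L} = {}"
            using disj[OF KL] greaterThanLessThan_disjoint_iff[OF lrF[OF KL(1)] lrF[OF KL(2)]] by blast
        qed
      qed (use F in auto)
      also have "\<dots> \<le> emeasure lborel U"
      proof (rule emeasure_mono)
        have "{l K<..<r K} \<subseteq> U" if "K \<in> F" for K
        proof -
          have "K \<in> \<D>" using that F by blast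
          have "{l K<..<r K} \<subseteq> {l K..r K}" by auto
          also have "{l K..r K} = K" using lr(1)[OF \<open>K \<in> \<D>\<close>] ..
          also have "K \<subseteq> U" using DU \<open>K \<in> \<D>\<close> by blast
          finally show ?thesis .
        qed
        then show "(\<Union>K\<in>F. {l K<..<r K}) \<subseteq> U" by blast
      qed (use U_sets in simp)
      also note U_less
      finally have "(\<Sum>K\<in>F. r K - l K) < \<delta>" using \<delta>(1) by (simp add: ennreal_less_iff sum_nonneg lrF less_imp_le)
      then have "(\<Sum>K\<in>F. cmod (complex_of_real (G (r K)) - complex_of_real (G (l K)))) < e"
        using \<delta>(2)[OF \<open>nonoverlapping P\<close>] by (simp only: sumP)
      moreover have "(\<Sum>K\<in>F. cmod (complex_of_real (G (r K)) - complex_of_real (G (l K)))) = (\<Sum>K\<in>F. G (r K) - G (l K))"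
        using lrF monoD[OF \<open>mono G\<close>] by (intro sum.cong refl) (auto simp: less_imp_le simp flip: of_real_diff)
      ultimately have "(\<Sum>K\<in>F. G (r K) - G (l K)) \<le> e" by simp
      moreover have "(\<Sum>K\<in>F. emeasure ?\<mu> K) = ennreal (\<Sum>K\<in>F. G (r K) - G (l K))"
      proof -
        have "emeasure ?\<mu> K = ennreal (G (r K) - G (l K))" if "K \<in> F" for K
        proof -
          have "emeasure ?\<mu> {l K..r K} = ennreal (G (r K) - G (l K))" using lrF[OF that] by (intro Icc) simp
          then show ?thesis using lr(1)[of K] that F by (metis subsetD)
        qed
        then show ?thesis
          using lrF monoD[OF \<open>mono G\<close>]
          by (subst sum_ennreal[symmetric]) (auto intro!: sum.cong simp: less_imp_le)
      qed
      moreover have "emeasure ?\<mu> (\<Union>F) \<le> (\<Sum>K\<in>F. emeasure ?\<mu> K)"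
      proof -
        have "K \<in> sets borel" if "K \<in> F" for K
        proof -
          have "{l K..r K} \<in> sets borel" by simp
          then show ?thesis using lr(1)[of K] that F by (metis subsetD)
        qed
        then show ?thesis
          using emeasure_subadditive_finite[OF F(1), of "\<lambda>K. K" ?\<mu>] by auto
      qed
      ultimately show ?thesis by (metis ennreal_leI order_trans)
    qed
    have Un_le: "emeasure ?\<mu> (\<Union>\<D>) \<le> ennreal e"
    proof (cases "\<D> = {}")
      case False
      define K where "K = from_nat_into \<D>"
      have rK: "range K = \<D>" unfolding K_def using False D(1) by (rule range_from_nat_into)
      have Ksets: "K i \<in> sets borel" for i
      proof -
        have "{l (K i)..r (K i)} \<in> sets borel" by simp
        then show ?thesis using lr(1)[of "K i"] rK by (metis rangeI)
      qed
      have "(SUP j. emeasure ?\<mu> (\<Union>i\<in>{..<j}. K i)) = emeasure ?\<mu> (\<Union>j. \<Union>i\<in>{..<j}. K i)"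
        by (rule SUP_emeasure_incseq)
           (auto simp: incseq_def Ksets intro!: sets.finite_UN, use less_le_trans in blast)
      moreover have "(\<Union>j. \<Union>i\<in>{..<j}. K i) = \<Union>\<D>" unfolding rK[symmetric] by auto
      moreover have "(SUP j. emeasure ?\<mu> (\<Union>i\<in>{..<j}. K i)) \<le> ennreal e"
        by (rule SUP_least, rule fin_le) (use rK in auto)
      ultimately show ?thesis by simp
    qed auto
    have "\<Union>\<D> \<in> sets borel"
    proof (rule sets.countable_Union[OF D(1)], rule subsetI)
      fix K assume K: "K \<in> \<D>"
      have "{l K..r K} \<in> sets borel" by simp
      then show "K \<in> sets borel" using lr(1)[OF K] by metis
    qed
    then show ?thesis
      using emeasure_mono[OF D(5), of ?\<mu>] Un_le by simp
  qed
  have "emeasure ?\<mu> (N \<inter> {- real n..real n}) = 0" for n :: nat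
  proof -
    have "emeasure ?\<mu> (N \<inter> {- real n..real n}) \<le> 0"
      by (rule ennreal_le_epsilon) (use small in simp)
    then show ?thesis by simp
  qed
  then have "(\<Union>n::nat. N \<inter> {- real n..real n}) \<in> null_sets ?\<mu>"
    using N_sets by (intro null_sets_UN) (auto simp: null_sets_def)
  moreover have "(\<Union>n::nat. N \<inter> {- real n..real n}) = N"
  proof -
    have "\<exists>n::nat. - real n \<le> x \<and> x \<le> real n" for x :: real
    proof -
      obtain n :: nat where "\<bar>x\<bar> \<le> real n" using real_arch_simple by blast
      then show ?thesis by (intro exI[of _ n]) auto
    qed
    then show ?thesis by auto
  qed
  ultimately show "N \<in> null_sets ?\<mu>" by simp
qed

text \<open>The density is the Radon-Nikodym derivative of the Stieltjes measure of
  \<open>G\<close>. It is extended-real valued, but its integral over each bounded interval is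
  finite, so \<open>enn2real\<close> alters it only on a null set.\<close>

lemma absolutely_continuous_monotone_density:
  fixes G :: "real \<Rightarrow> real"
  assumes G: "absolutely_continuous_on UNIV (\<lambda>t. complex_of_real (G t))" and "mono G"
  obtains f :: "real \<Rightarrow> real" where "\<And>x. 0 \<le> f x"
    "\<And>u v. u \<le> v \<Longrightarrow> (f has_integral (G v - G u)) {u..v}"
proof -
  let ?\<mu> = "interval_measure G"
  have "continuous_on UNIV (\<lambda>t. complex_of_real (G t))"
  proof (subst continuous_on_eq_continuous_at[OF open_UNIV], intro ballI)
    fix x :: real
    have "continuous_on {x - 1..x + 1} (\<lambda>t. complex_of_real (G t))"
      by (intro absolutely_continuous_on_imp_continuous_on absolutely_continuous_on_subset[OF G]) auto
    then show "isCont (\<lambda>t. complex_of_real (G t)) x"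
      by (rule continuous_on_interior) (simp add: interior_atLeastAtMost_real)
  qed
  then have cont: "continuous_on UNIV G"
    using continuous_on_Re by fastforce
  have "sets ?\<mu> = sets lborel" by simp
  with absolutely_continuous_monotone_null_sets[OF G \<open>mono G\<close> cont]
  obtain h where h: "h \<in> borel_measurable lborel" "density lborel h = ?\<mu>"
    using sigma_finite_measure.Radon_Nikodym[OF sigma_finite_lborel] by blast
  have h_int: "(\<integral>\<^sup>+x. h x * indicator {u..v} x \<partial>lborel) = ennreal (G v - G u)" if "u \<le> v" for u v
  proof -
    have "emeasure (density lborel h) {u..v} = ennreal (G v - G u)"
      unfolding h(2)
      by (rule emeasure_interval_measure_Icc) (use that \<open>mono G\<close> cont in \<open>auto dest: monoD\<close>)
    then show ?thesis using h(1) by (subst (asm) emeasure_density) auto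
  qed
  define f where "f x = enn2real (h x)" for x
  show ?thesis
  proof (rule that)
    show "0 \<le> f x" for x by (simp add: f_def)
    fix u v :: real assume "u \<le> v"
    have "(\<integral>\<^sup>+x. h x * indicator {u..v} x \<partial>lborel) \<noteq> \<infinity>" using h_int[OF \<open>u \<le> v\<close>] by simp
    then have "AE x in lborel. h x * indicator {u..v} x \<noteq> \<infinity>"
      using h(1) by (intro nn_integral_PInf_AE) auto
    then have "AE x in lborel. ennreal (indicator {u..v} x * f x) = h x * indicator {u..v} x"
    proof eventually_elim
      case (elim x)
      then show ?case by (auto simp: f_def indicator_def less_top)
    qed
    then have "(\<integral>\<^sup>+x. ennreal (indicator {u..v} x * f x) \<partial>lborel) = ennreal (G v - G u)"
      using h_int[OF \<open>u \<le> v\<close>] by (subst nn_integral_cong_AE) auto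
    then have "((\<lambda>x. indicator {u..v} x * f x) has_integral (G v - G u)) UNIV"
      using h(1) monoD[OF \<open>mono G\<close> \<open>u \<le> v\<close>]
      by (intro nn_integral_has_integral) (auto simp: f_def)
    then have "((\<lambda>x. if x \<in> {u..v} then f x else 0) has_integral (G v - G u)) UNIV"
      by (rule has_integral_eq[rotated]) (auto simp: indicator_def)
    then show "(f has_integral (G v - G u)) {u..v}" by (simp only: has_integral_restrict_UNIV)
  qed
qed

text \<open>\<open>integrable_ccontinuous_explicit\<close> controls only averages over intervals to
  the right of the point. Left difference quotients come from the same result for the reflected
  integrand, which is why the exceptional set contains the mirror image of
  \<open>N2\<close>.\<close>

lemma indefinite_integral_derivative_AE:
  fixes f :: "real \<Rightarrow> 'a::euclidean_space"
  assumes f: "\<And>u v. f integrable_on {u..v}"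
    and F: "\<And>u v. u \<le> v \<Longrightarrow> F v - F u = integral {u..v} f"
  obtains N where "negligible N" "\<And>x. x \<notin> N \<Longrightarrow> (F has_vector_derivative f x) (at x)"
proof -
  obtain N1 where N1: "negligible N1" "\<And>x e. x \<notin> N1 \<Longrightarrow> 0 < e \<Longrightarrow>
      \<exists>d>0. \<forall>h. 0 < h \<and> h < d \<longrightarrow> norm (integral (cbox x (x + h *\<^sub>R One)) f /\<^sub>R h ^ DIM(real) - f x) < e"
    using integrable_ccontinuous_explicit[of f] f by auto
  have g: "(\<lambda>x. f (- x)) integrable_on {u..v}" for u v
    using f[of "- v" "- u"] Henstock_Kurzweil_Integration.integrable_reflect_real[where a = "- v" and b = "- u" and f = f] by simp
  obtain N2 where N2: "negligible N2" "\<And>x e. x \<notin> N2 \<Longrightarrow> 0 < e \<Longrightarrow>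
      \<exists>d>0. \<forall>h. 0 < h \<and> h < d \<longrightarrow>
        norm (integral (cbox x (x + h *\<^sub>R One)) (\<lambda>x. f (- x)) /\<^sub>R h ^ DIM(real) - f (- x)) < e"
    using integrable_ccontinuous_explicit[of "\<lambda>x. f (- x)"] g by auto
  show ?thesis
  proof (rule that)
    have "negligible (uminus ` N2)"
      by (rule negligible_differentiable_image_negligible[OF _ N2(1)]) (auto intro!: derivative_intros simp: differentiable_on_def)
    then show "negligible (N1 \<union> uminus ` N2)" using N1(1) by auto
    fix x assume x: "x \<notin> N1 \<union> uminus ` N2"
    then have "x \<notin> N1" "- x \<notin> N2" by (auto simp: image_iff)
    show "(F has_vector_derivative f x) (at x)"
      unfolding has_vector_derivative_def has_derivative_within_alt
    proof (intro conjI allI impI)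
      fix e :: real assume "e > 0"
      obtain d1 where d1: "d1 > 0" "\<And>h. 0 < h \<Longrightarrow> h < d1 \<Longrightarrow> norm (integral {x..x + h} f /\<^sub>R h - f x) < e"
        using N1(2)[OF \<open>x \<notin> N1\<close> \<open>e > 0\<close>] by auto
      obtain d2 where d2: "d2 > 0"
        "\<And>h. 0 < h \<Longrightarrow> h < d2 \<Longrightarrow> norm (integral {- x..- x + h} (\<lambda>x. f (- x)) /\<^sub>R h - f x) < e"
        using N2(2)[OF \<open>- x \<notin> N2\<close> \<open>e > 0\<close>] by auto
      have scale: "norm (J - h *\<^sub>R f x) \<le> e * h" if "norm (J /\<^sub>R h - f x) < e" "h > 0" for J h
      proof -
        have "J - h *\<^sub>R f x = h *\<^sub>R (J /\<^sub>R h - f x)" using that(2) by (simp add: scaleR_diff_right)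
        then have "norm (J - h *\<^sub>R f x) = h * norm (J /\<^sub>R h - f x)" using that(2) by simp
        then show ?thesis using that by (simp add: mult.commute)
      qed
      show "\<exists>d>0. \<forall>y\<in>UNIV. norm (y - x) < d \<longrightarrow> norm (F y - F x - (y - x) *\<^sub>R f x) \<le> e * norm (y - x)"
      proof (intro exI[of _ "min d1 d2"] conjI ballI impI)
        fix y assume y: "norm (y - x) < min d1 d2"
        consider "y = x" | "y > x" | "y < x" by linarith
        then show "norm (F y - F x - (y - x) *\<^sub>R f x) \<le> e * norm (y - x)"
        proof cases
          case 2
          then show ?thesis using scale[OF d1(2), of "y - x"] y F[of x y] by simp
        next
          case 3
          have "F x - F y = integral {- x..- y} (\<lambda>x. f (- x))"
            using F[of y x] 3 integral_reflect_real[of x y f] by simp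
          then have "norm (F x - F y - (x - y) *\<^sub>R f x) \<le> e * (x - y)"
            using scale[OF d2(2), of "x - y"] y 3 by simp
          moreover have "F y - F x - (y - x) *\<^sub>R f x = - (F x - F y - (x - y) *\<^sub>R f x)"
            by (simp add: algebra_simps)
          ultimately show ?thesis using 3 by (metis abs_of_pos diff_gt_0_iff_gt norm_minus_cancel norm_minus_commute real_norm_def)
        qed simp
      qed (use d1(1) d2(1) in auto)
    qed (rule bounded_linear_scaleR_left)
  qed
qed

text \<open>Clamping is monotone and does not increase distances, so it maps a short family to a
  short family inside \<open>{c..d}\<close>.\<close>

lemma absolutely_continuous_on_clamp:
  assumes F: "absolutely_continuous_on {c..d} F" and "c \<le> d"
  shows "absolutely_continuous_on UNIV (\<lambda>t. F (max c (min t d)))"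
  unfolding absolutely_continuous_on_iff
proof (intro allI impI)
  fix \<epsilon> :: real assume "\<epsilon> > 0"
  obtain \<delta> where \<delta>: "\<delta> > 0" "\<And>P. nonoverlapping P \<Longrightarrow> (\<And>u v. (u, v) \<in> P \<Longrightarrow> {u..v} \<subseteq> {c..d}) \<Longrightarrow>
     (\<Sum>(u, v) \<in> P. v - u) < \<delta> \<Longrightarrow> (\<Sum>(u, v) \<in> P. cmod (F v - F u)) < \<epsilon>"
    using absolutely_continuous_onD[OF F \<open>\<epsilon> > 0\<close>] by blast
  let ?\<phi> = "\<lambda>t. max c (min t d)"
  have m: "mono ?\<phi>" by (intro monoI) auto
  show "\<exists>\<delta>>0. \<forall>P. nonoverlapping P \<and> (\<forall>(u, v)\<in>P. {u..v} \<subseteq> UNIV) \<and> (\<Sum>(u, v)\<in>P. v - u) < \<delta> \<longrightarrow>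
      (\<Sum>(u, v)\<in>P. cmod (F (?\<phi> v) - F (?\<phi> u))) < \<epsilon>"
  proof (intro exI[of _ \<delta>] conjI allI impI \<open>\<delta> > 0\<close>)
    fix P assume "nonoverlapping P \<and> (\<forall>(u, v)\<in>P. {u..v} \<subseteq> UNIV) \<and> (\<Sum>(u, v)\<in>P. v - u) < \<delta>"
    then have P: "nonoverlapping P" "(\<Sum>(u, v)\<in>P. v - u) < \<delta>" by auto
    define Q where "Q = (\<lambda>(u, v). (?\<phi> u, ?\<phi> v)) ` {(u, v) \<in> P. ?\<phi> u < ?\<phi> v}"
    have Q: "nonoverlapping Q" unfolding Q_def by (rule nonoverlapping_image(1)[OF P(1) m])
    have "(\<Sum>(u, v)\<in>P. cmod (F (?\<phi> v) - F (?\<phi> u))) = (\<Sum>(u, v)\<in>Q. cmod (F v - F u))"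
      unfolding Q_def
      by (rule nonoverlapping_image(2)[OF P(1) m, of "\<lambda>u v. cmod (F v - F u)", symmetric]) simp
    also have "\<dots> < \<epsilon>"
    proof (rule \<delta>(2)[OF Q])
      show "{u..v} \<subseteq> {c..d}" if "(u, v) \<in> Q" for u v
        using that \<open>c \<le> d\<close> by (auto simp: Q_def)
      have "(\<Sum>(u, v)\<in>Q. v - u) = (\<Sum>(u, v)\<in>P. ?\<phi> v - ?\<phi> u)"
        unfolding Q_def by (rule nonoverlapping_image(2)[OF P(1) m, of "\<lambda>u v. v - u"]) simp
      also have "\<dots> \<le> (\<Sum>(u, v)\<in>P. v - u)"
        using P(1) by (intro sum_mono) (force simp: nonoverlapping_def)
      finally show "(\<Sum>(u, v)\<in>Q. v - u) < \<delta>" using P(2) by simp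
    qed
    finally show "(\<Sum>(u, v)\<in>P. cmod (F (?\<phi> v) - F (?\<phi> u))) < \<epsilon>" .
  qed
qed

text \<open>\<open>V\<close>, \<open>V - Re F\<close> and \<open>V - Im F\<close> are all
  nondecreasing and absolutely continuous, because increments of \<open>V\<close> dominate those of
  \<open>F\<close>. Their nonnegative densities are recombined into a complex one, and being
  differences of nonnegative integrable functions its parts are absolutely integrable.\<close>

lemma absolutely_continuous_clamped_density:
  assumes F: "absolutely_continuous_on UNIV F" and clamp: "\<And>t. F t = F (max c (min t d))"
  obtains f where "\<And>u v. f absolutely_integrable_on {u..v}"
    "\<And>u v. u \<le> v \<Longrightarrow> (f has_integral (F v - F u)) {u..v}"
proof -
  obtain V where V: "absolutely_continuous_on UNIV (\<lambda>t. complex_of_real (V t))"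
    "\<And>u v. u \<le> v \<Longrightarrow> cmod (F v - F u) \<le> V v - V u"
    by (rule absolutely_continuous_monotone_majorant[OF F clamp]) (rule that)
  have "mono V"
  proof (rule monoI)
    fix u v :: real assume "u \<le> v"
    show "V u \<le> V v" using V(2)[OF \<open>u \<le> v\<close>] norm_ge_zero[of "F v - F u"] by linarith
  qed
  obtain f0 where f0: "\<And>x. 0 \<le> f0 x" "\<And>u v. u \<le> v \<Longrightarrow> (f0 has_integral (V v - V u)) {u..v}"
    by (rule absolutely_continuous_monotone_density[OF V(1) \<open>mono V\<close>]) (rule that)
  have part: "\<exists>g. (\<forall>x. 0 \<le> g x) \<and> (\<forall>u v. u \<le> v \<longrightarrow> (g has_integral ((V v - h (F v)) - (V u - h (F u)))) {u..v})"
    if h: "\<And>z w. \<bar>h z - h w\<bar> \<le> cmod (z - w)" for h :: "complex \<Rightarrow> real"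
  proof -
    have "absolutely_continuous_on UNIV (\<lambda>t. complex_of_real (V t - h (F t)))"
    proof (rule absolutely_continuous_on_dominated[OF V(1) F, of _ 1 1])
      fix u v
      show "cmod (complex_of_real (V v - h (F v)) - complex_of_real (V u - h (F u)))
        \<le> 1 * cmod (complex_of_real (V v) - complex_of_real (V u)) + 1 * cmod (F v - F u)"
        using h[of "F v" "F u"] by (simp flip: of_real_diff)
    qed
    moreover have "mono (\<lambda>t. V t - h (F t))"
    proof (rule monoI)
      fix u v :: real assume "u \<le> v"
      show "V u - h (F u) \<le> V v - h (F v)" using V(2)[OF \<open>u \<le> v\<close>] h[of "F v" "F u"] by linarith
    qed
    ultimately obtain g where "\<And>x. 0 \<le> g x"
      "\<And>u v. u \<le> v \<Longrightarrow> (g has_integral ((V v - h (F v)) - (V u - h (F u)))) {u..v}"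
      by (rule absolutely_continuous_monotone_density) (rule that)
    then show ?thesis by blast
  qed
  have hR: "\<bar>Re z - Re w\<bar> \<le> cmod (z - w)" for z w
    using abs_Re_le_cmod[of "z - w"] by simp
  have hI: "\<bar>Im z - Im w\<bar> \<le> cmod (z - w)" for z w
    using abs_Im_le_cmod[of "z - w"] by simp
  from part[of Re, OF hR] obtain f1 where f1: "\<And>x. 0 \<le> f1 x"
    "\<And>u v. u \<le> v \<Longrightarrow> (f1 has_integral ((V v - Re (F v)) - (V u - Re (F u)))) {u..v}" by blast
  from part[of Im, OF hI] obtain f2 where f2: "\<And>x. 0 \<le> f2 x"
    "\<And>u v. u \<le> v \<Longrightarrow> (f2 has_integral ((V v - Im (F v)) - (V u - Im (F u)))) {u..v}" by blast
  have ai: "g absolutely_integrable_on {u..v}"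
    if "\<And>x. 0 \<le> g x" "\<And>u v. u \<le> v \<Longrightarrow> (g has_integral G u v) {u..v}" for g :: "real \<Rightarrow> real" and G u v
  proof (rule nonnegative_absolutely_integrable_1)
    show "g integrable_on {u..v}"
    proof (cases "u \<le> v")
      case True
      then show ?thesis using that(2) by blast
    next
      case False
      then have "{u..v} = {}" by simp
      then show ?thesis by (simp only: integrable_on_empty)
    qed
  qed (rule that)
  define f where "f x = complex_of_real (f0 x - f1 x) + \<i> * complex_of_real (f0 x - f2 x)" for x
  have f_eq: "f = (\<lambda>x. (f0 x - f1 x) *\<^sub>R 1 + (f0 x - f2 x) *\<^sub>R \<i>)"
    by (auto simp: f_def scaleR_conv_of_real)
  show ?thesis
  proof (rule that)
    fix u v :: real
    have "f0 absolutely_integrable_on {u..v}" "f1 absolutely_integrable_on {u..v}" "f2 absolutely_integrable_on {u..v}"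
      by (rule ai[OF f0] ai[OF f1] ai[OF f2]; assumption)+
    then have "(\<lambda>x. f0 x - f1 x) absolutely_integrable_on {u..v}" "(\<lambda>x. f0 x - f2 x) absolutely_integrable_on {u..v}"
      by (auto intro: set_integral_diff(1))
    moreover have "(\<lambda>x. g x *\<^sub>R w) absolutely_integrable_on {u..v}"
      if "g absolutely_integrable_on {u..v}" for g and w :: complex
      using absolutely_integrable_linear[OF that bounded_linear_scaleR_left[of w]] by (simp add: o_def)
    ultimately have "(\<lambda>x. (f0 x - f1 x) *\<^sub>R (1::complex)) absolutely_integrable_on {u..v}"
      "(\<lambda>x. (f0 x - f2 x) *\<^sub>R \<i>) absolutely_integrable_on {u..v}"
      by simp_all
    then show "f absolutely_integrable_on {u..v}" unfolding f_eq by (rule set_integral_add(1))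
    assume "u \<le> v"
    have lin: "((\<lambda>x. g x *\<^sub>R w) has_integral (I *\<^sub>R w)) {u..v}" if "(g has_integral I) {u..v}"
      for g and I :: real and w :: complex
      using has_integral_linear[OF that bounded_linear_scaleR_left[of w]] by (simp add: o_def)
    have "((\<lambda>x. f0 x - f1 x) has_integral (Re (F v) - Re (F u))) {u..v}"
      using has_integral_diff[OF f0(2)[OF \<open>u \<le> v\<close>] f1(2)[OF \<open>u \<le> v\<close>]] by (simp add: algebra_simps)
    moreover have "((\<lambda>x. f0 x - f2 x) has_integral (Im (F v) - Im (F u))) {u..v}"
      using has_integral_diff[OF f0(2)[OF \<open>u \<le> v\<close>] f2(2)[OF \<open>u \<le> v\<close>]] by (simp add: algebra_simps)
    ultimately have "(f has_integral ((Re (F v) - Re (F u)) *\<^sub>R 1 + (Im (F v) - Im (F u)) *\<^sub>R \<i>)) {u..v}"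
      unfolding f_eq by (rule has_integral_add[OF lin lin])
    moreover have "(Re (F v) - Re (F u)) *\<^sub>R 1 + (Im (F v) - Im (F u)) *\<^sub>R \<i> = F v - F u"
      by (simp add: complex_eq_iff)
    ultimately show "(f has_integral (F v - F u)) {u..v}" by simp
  qed
qed

text \<open>\<open>F\<close> is extended to the line by clamping, where a global density and
  Lebesgue's differentiation theorem apply; near an interior point the extension coincides with
  \<open>F\<close>.\<close>

theorem absolutely_continuous_on_imp_integral:
  assumes F: "absolutely_continuous_on {c..d} F" and "c \<le> d"
  obtains f N where "negligible N" "f absolutely_integrable_on {c..d}"
    "\<And>x. x \<in> {c<..<d} - N \<Longrightarrow> (F has_vector_derivative f x) (at x)"
    "\<And>u v. c \<le> u \<Longrightarrow> u \<le> v \<Longrightarrow> v \<le> d \<Longrightarrow> (f has_integral (F v - F u)) {u..v}"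
proof -
  define G where "G t = F (max c (min t d))" for t
  have G_eq: "G t = F t" if "t \<in> {c..d}" for t
    using that by (simp add: G_def)
  have "absolutely_continuous_on UNIV G"
    unfolding G_def by (rule absolutely_continuous_on_clamp[OF F \<open>c \<le> d\<close>])
  moreover have "G t = G (max c (min t d))" for t using \<open>c \<le> d\<close> by (auto simp: G_def)
  ultimately obtain f where f: "\<And>u v. f absolutely_integrable_on {u..v}"
    "\<And>u v. u \<le> v \<Longrightarrow> (f has_integral (G v - G u)) {u..v}"
    using absolutely_continuous_clamped_density by blast
  have "f integrable_on {u..v}" for u v using f(1) by (rule set_lebesgue_integral_eq_integral(1))
  moreover have "G v - G u = integral {u..v} f" if "u \<le> v" for u v
    using f(2)[OF that] by (simp add: integral_unique)
  ultimately obtain N where N: "negligible N" "\<And>x. x \<notin> N \<Longrightarrow> (G has_vector_derivative f x) (at x)"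
    using indefinite_integral_derivative_AE[of f G] by blast
  show ?thesis
  proof (rule that[OF N(1) f(1)])
    show "(F has_vector_derivative f x) (at x)" if "x \<in> {c<..<d} - N" for x
    proof (rule has_vector_derivative_transform_within_open[of G])
      show "(G has_vector_derivative f x) (at x)" using N(2) that by auto
    qed (use that G_eq in \<open>auto intro: open_greaterThanLessThan\<close>)
    show "(f has_integral (F v - F u)) {u..v}" if "c \<le> u" "u \<le> v" "v \<le> d" for u v
      using f(2)[OF that(2)] that G_eq by simp
  qed
qed

text \<open>Derivatives are unique, so an almost everywhere derivative given by any formula agrees
  with the density up to a null set. Green's formula uses this with an explicit integrand.\<close>

lemma absolutely_continuous_on_has_integral:
  assumes F: "absolutely_continuous_on {c..d} F" and "c \<le> d" and N: "negligible N"
    and f: "\<And>x. x \<in> {c<..<d} - N \<Longrightarrow> (F has_vector_derivative f x) (at x)"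
  shows "f absolutely_integrable_on {c..d}" "(f has_integral (F d - F c)) {c..d}"
proof -
  obtain g M where g: "negligible M" "g absolutely_integrable_on {c..d}"
    "\<And>x. x \<in> {c<..<d} - M \<Longrightarrow> (F has_vector_derivative g x) (at x)"
    "(g has_integral (F d - F c)) {c..d}"
    using absolutely_continuous_on_imp_integral[OF F \<open>c \<le> d\<close>] \<open>c \<le> d\<close> by (metis order_refl)
  have neg: "negligible (N \<union> M \<union> {c, d})" using N g(1) by simp
  have eq: "f x = g x" if "x \<in> {c..d} - (N \<union> M \<union> {c, d})" for x
    using vector_derivative_unique_at[OF f[of x] g(3)[of x]] that by auto
  show "f absolutely_integrable_on {c..d}"
    using absolutely_integrable_spike[OF g(2) neg] eq by blast
  show "(f has_integral (F d - F c)) {c..d}"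
    by (rule has_integral_spike[OF neg eq g(4)])
qed

text \<open>Square integrability gives a quantitative bound: by Young's inequality an increment of
  \<open>F\<close> is at most \<open>\<eta> / 2\<close> times the increment of the primitive
  \<open>H\<close> of \<open>(cmod (g t))\<^sup>2\<close>, plus the length divided by
  \<open>2 * \<eta>\<close>.\<close>

lemma absolutely_continuous_on_indefinite_integral:
  assumes g: "g absolutely_integrable_on {c..d}" and g2: "(\<lambda>t. (cmod (g t))\<^sup>2) integrable_on {c..d}"
    and F: "\<And>u v. c \<le> u \<Longrightarrow> u \<le> v \<Longrightarrow> v \<le> d \<Longrightarrow> F v - F u = integral {u..v} g"
  shows "absolutely_continuous_on {c..d} F"
  unfolding absolutely_continuous_on_iff
proof (intro allI impI)
  fix \<epsilon> :: real assume "\<epsilon> > 0"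
  let ?g2 = "\<lambda>t. (cmod (g t))\<^sup>2"
  define H where "H t = integral {c..t} ?g2" for t
  have g2': "?g2 integrable_on {u..v}" if "c \<le> u" "v \<le> d" for u v
    using g2 by (rule integrable_on_subinterval) (use that in auto)
  have H_diff: "H v - H u = integral {u..v} ?g2" if "c \<le> u" "u \<le> v" "v \<le> d" for u v
    using Henstock_Kurzweil_Integration.integral_combine[of c u v ?g2] g2'[of c v] that by (simp add: H_def)
  have H_mono: "mono_on {c..d} H"
  proof (rule mono_onI)
    fix u v assume uv: "u \<in> {c..d}" "v \<in> {c..d}" "u \<le> v"
    have "0 \<le> integral {u..v} ?g2" by (rule integral_nonneg) (use g2' uv in auto)
    then show "H u \<le> H v" using H_diff[of u v] uv by simp
  qed
  \<comment> \<open>This makes the share of \<open>H\<close> at most \<epsilon> / 2; with total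
    length below \<open>\<eta> * \<epsilon>\<close> the share of the lengths is less than \<epsilon>
    / 2.\<close>
  define \<eta> where "\<eta> = \<epsilon> / (1 + \<bar>H d - H c\<bar>)"
  have \<eta>: "\<eta> > 0" using \<open>\<epsilon> > 0\<close> by (simp add: \<eta>_def add_pos_nonneg)
  have bound: "cmod (F v - F u) \<le> \<eta> / 2 * (H v - H u) + 1 / (2 * \<eta>) * (v - u)"
    if uv: "c \<le> u" "u \<le> v" "v \<le> d" for u v
  proof -
    have 1: "((\<lambda>t. \<eta> / 2 * ?g2 t + 1 / (2 * \<eta>)) has_integral (\<eta> / 2 * (H v - H u) + (v - u) *\<^sub>R (1 / (2 * \<eta>)))) {u..v}"
      unfolding H_diff[OF uv]
      using has_integral_add[OF has_integral_mult_right[OF integrable_integral[OF g2'], of u v "\<eta> / 2"]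
          has_integral_const_real[of "1 / (2 * \<eta>)" u v]] uv by simp
    have "g absolutely_integrable_on {u..v}"
      using g by (rule set_integrable_subset) (use uv in auto)
    have "cmod (integral {u..v} g) \<le> integral {u..v} (\<lambda>t. \<eta> / 2 * ?g2 t + 1 / (2 * \<eta>))"
    proof (rule integral_norm_bound_integral)
      show "g integrable_on {u..v}"
        using \<open>g absolutely_integrable_on {u..v}\<close> by (rule set_lebesgue_integral_eq_integral(1))
      show "(\<lambda>t. \<eta> / 2 * ?g2 t + 1 / (2 * \<eta>)) integrable_on {u..v}" using 1 by (rule has_integral_integrable)
      show "cmod (g t) \<le> \<eta> / 2 * ?g2 t + 1 / (2 * \<eta>)" for t
      proof -
        have "0 \<le> (\<eta> * cmod (g t) - 1)\<^sup>2 / (2 * \<eta>)" using \<eta> by simp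
        also have "\<dots> = \<eta> / 2 * ?g2 t + 1 / (2 * \<eta>) - cmod (g t)"
          using \<eta> by (simp add: power2_eq_square field_simps)
        finally show ?thesis by simp
      qed
    qed
    also have "\<dots> = \<eta> / 2 * (H v - H u) + 1 / (2 * \<eta>) * (v - u)"
      using 1 by (simp add: integral_unique)
    finally show ?thesis by (simp only: F[OF uv])
  qed
  show "\<exists>\<delta>>0. \<forall>P. nonoverlapping P \<and> (\<forall>(u, v)\<in>P. {u..v} \<subseteq> {c..d}) \<and> (\<Sum>(u, v)\<in>P. v - u) < \<delta> \<longrightarrow>
      (\<Sum>(u, v)\<in>P. cmod (F v - F u)) < \<epsilon>"
  proof (intro exI[of _ "\<eta> * \<epsilon>"] conjI allI impI)
    show "\<eta> * \<epsilon> > 0" using \<eta> \<open>\<epsilon> > 0\<close> by simp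
    fix P assume P: "nonoverlapping P \<and> (\<forall>(u, v)\<in>P. {u..v} \<subseteq> {c..d}) \<and> (\<Sum>(u, v)\<in>P. v - u) < \<eta> * \<epsilon>"
    have inP: "c \<le> u \<and> u \<le> v \<and> v \<le> d" if "(u, v) \<in> P" for u v
    proof -
      have "u < v" "{u..v} \<subseteq> {c..d}" using P that unfolding nonoverlapping_def by blast+
      then show ?thesis by simp
    qed
    show "(\<Sum>(u, v)\<in>P. cmod (F v - F u)) < \<epsilon>"
    proof (cases "P = {}")
      case False
      then have "c \<le> d" using inP by fastforce
      have "(\<Sum>(u, v)\<in>P. cmod (F v - F u)) \<le> (\<Sum>(u, v)\<in>P. \<eta> / 2 * (H v - H u) + 1 / (2 * \<eta>) * (v - u))"
        unfolding case_prod_unfold using inP by (intro sum_mono bound) auto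
      also have "\<dots> = \<eta> / 2 * (\<Sum>(u, v)\<in>P. H v - H u) + 1 / (2 * \<eta>) * (\<Sum>(u, v)\<in>P. v - u)"
        by (simp add: sum.distrib sum_distrib_left case_prod_unfold)
      also have "\<dots> < \<eta> / 2 * (1 + \<bar>H d - H c\<bar>) + 1 / (2 * \<eta>) * (\<eta> * \<epsilon>)"
      proof (rule add_le_less_mono)
        have "(\<Sum>(u, v)\<in>P. H v - H u) \<le> H d - H c"
          using P inP by (intro nonoverlapping_sum_le[OF _ _ H_mono \<open>c \<le> d\<close>]) blast+
        then show "\<eta> / 2 * (\<Sum>(u, v)\<in>P. H v - H u) \<le> \<eta> / 2 * (1 + \<bar>H d - H c\<bar>)"
          using \<eta> by (intro mult_left_mono) auto
        show "1 / (2 * \<eta>) * (\<Sum>(u, v)\<in>P. v - u) < 1 / (2 * \<eta>) * (\<eta> * \<epsilon>)"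
          using P \<eta> by (intro mult_strict_left_mono) auto
      qed
      also have "\<dots> = \<epsilon>" proof -
        have "\<eta> * (1 + \<bar>H d - H c\<bar>) = \<epsilon>" unfolding \<eta>_def by simp
        then show ?thesis using \<eta> by simp
      qed
      finally show ?thesis .
    qed (use \<open>\<epsilon> > 0\<close> in auto)
  qed
qed

section \<open>Square-integrable functions\<close>

lemma integrable_lebesgue_on_iff:
  "S \<in> sets lebesgue \<Longrightarrow> integrable (lebesgue_on S) f \<longleftrightarrow> f absolutely_integrable_on S"
  unfolding set_integrable_def by (subst integrable_restrict_space) auto

lemma integrable_lebesgue_on_nonneg:
  fixes f :: "real \<Rightarrow> real"
  assumes "f integrable_on {c..d}" "\<And>t. t \<in> {c..d} \<Longrightarrow> 0 \<le> f t"
  shows "integrable (lebesgue_on {c..d}) f"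
  using nonnegative_absolutely_integrable_1[OF assms] by (simp add: integrable_lebesgue_on_iff)

text \<open>Rests on the completeness of Lebesgue measure; representatives may be changed on null
  sets without losing measurability.\<close>

lemma borel_measurable_lebesgue_on_AE:
  fixes f :: "'a::euclidean_space \<Rightarrow> 'b::euclidean_space"
  assumes f: "f \<in> borel_measurable (lebesgue_on S)" and S: "S \<in> sets lebesgue"
    and ae: "AE t in lebesgue_on S. f t = g t"
  shows "g \<in> borel_measurable (lebesgue_on S)"
proof -
  have "AE t in lebesgue. (if t \<in> S then f t else 0) = (if t \<in> S then g t else 0)"
    using ae S by (subst (asm) AE_restrict_space_iff) (auto elim!: eventually_mono)
  moreover have "(\<lambda>t. if t \<in> S then f t else 0) \<in> borel_measurable lebesgue"
    using f by (simp add: borel_measurable_if[OF S])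
  ultimately have "(\<lambda>t. if t \<in> S then g t else 0) \<in> borel_measurable lebesgue"
    by (rule borel_measurable_AE[rotated])
  then show ?thesis by (rule borel_measurable_if_D)
qed

lemma AE_lebesgue_on_iff_negligible:
  fixes S :: "'a::euclidean_space set"
  assumes "S \<in> sets lebesgue"
  shows "(AE t in lebesgue_on S. P t) \<longleftrightarrow> (\<exists>N. negligible N \<and> (\<forall>t\<in>S - N. P t))"
proof
  assume "AE t in lebesgue_on S. P t"
  then have "AE t in lebesgue. t \<in> S \<longrightarrow> P t"
    using assms by (subst (asm) AE_restrict_space_iff) auto
  then have "{t. \<not> (t \<in> S \<longrightarrow> P t)} \<in> null_sets lebesgue"
    by (simp add: completion.AE_iff_null_sets)
  then have "negligible {t. \<not> (t \<in> S \<longrightarrow> P t)}" by (simp add: negligible_iff_null_sets)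
  then show "\<exists>N. negligible N \<and> (\<forall>t\<in>S - N. P t)" by blast
next
  assume "\<exists>N. negligible N \<and> (\<forall>t\<in>S - N. P t)"
  then obtain N where N: "negligible N" "\<forall>t\<in>S - N. P t" by blast
  then have "AE t in lebesgue. t \<in> S \<longrightarrow> P t"
    by (intro AE_I'[of N]) (auto simp: negligible_iff_null_sets)
  then show "AE t in lebesgue_on S. P t"
    using assms by (subst AE_restrict_space_iff) auto
qed

lemma borel_measurable_cnj [measurable (raw)]:
  "f \<in> borel_measurable M \<Longrightarrow> (\<lambda>t. cnj (f t)) \<in> borel_measurable M"
  by (rule borel_measurable_continuous_on[of cnj]) (auto intro: continuous_intros)

lemma L2_measurable: "f \<in> L2 M \<Longrightarrow> f \<in> borel_measurable M"
  by (simp add: L2_def)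

lemma L2_bounded_by:
  assumes "f \<in> borel_measurable M" "integrable M h" "\<And>t. t \<in> space M \<Longrightarrow> (cmod (f t))\<^sup>2 \<le> h t"
  shows "f \<in> L2 M"
proof -
  have "integrable M (\<lambda>t. (cmod (f t))\<^sup>2)"
    by (rule Bochner_Integration.integrable_bound[OF assms(2)])
       (use assms in \<open>auto intro!: AE_I2 order_trans[OF _ abs_ge_self]\<close>)
  then show ?thesis using assms(1) by (simp add: L2_def)
qed

lemma L2_integrable_mult:
  assumes "f \<in> L2 M" "g \<in> L2 M"
  shows "integrable M (\<lambda>t. f t * cnj (g t))"
proof (rule Bochner_Integration.integrable_bound)
  show "integrable M (\<lambda>t. (cmod (f t))\<^sup>2 + (cmod (g t))\<^sup>2)" using assms by (simp add: L2_def)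
  show "(\<lambda>t. f t * cnj (g t)) \<in> borel_measurable M" using assms[THEN L2_measurable] by measurable
  show "AE t in M. norm (f t * cnj (g t)) \<le> norm ((cmod (f t))\<^sup>2 + (cmod (g t))\<^sup>2)"
  proof (rule AE_I2)
    fix t
    have "0 \<le> (cmod (f t) - cmod (g t))\<^sup>2 + (cmod (f t))\<^sup>2 + (cmod (g t))\<^sup>2" by simp
    also have "\<dots> = 2 * ((cmod (f t))\<^sup>2 + (cmod (g t))\<^sup>2) - 2 * (cmod (f t) * cmod (g t))"
      by (simp add: power2_eq_square algebra_simps)
    finally show "norm (f t * cnj (g t)) \<le> norm ((cmod (f t))\<^sup>2 + (cmod (g t))\<^sup>2)"
      by (simp add: norm_mult)
  qed
qed

lemma L2_add:
  assumes "f \<in> L2 M" "g \<in> L2 M"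
  shows "(\<lambda>t. f t + g t) \<in> L2 M"
proof (rule L2_bounded_by)
  show "integrable M (\<lambda>t. 2 * (cmod (f t))\<^sup>2 + 2 * (cmod (g t))\<^sup>2)" using assms by (simp add: L2_def)
  show "(\<lambda>t. f t + g t) \<in> borel_measurable M" using assms[THEN L2_measurable] by measurable
  show "(cmod (f t + g t))\<^sup>2 \<le> 2 * (cmod (f t))\<^sup>2 + 2 * (cmod (g t))\<^sup>2" for t
  proof -
    have "(cmod (f t + g t))\<^sup>2 \<le> (cmod (f t) + cmod (g t))\<^sup>2"
      by (intro power_mono norm_triangle_ineq) simp
    also have "\<dots> \<le> (cmod (f t) + cmod (g t))\<^sup>2 + (cmod (f t) - cmod (g t))\<^sup>2" by simp
    also have "\<dots> = 2 * (cmod (f t))\<^sup>2 + 2 * (cmod (g t))\<^sup>2"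
      by (simp add: power2_eq_square algebra_simps)
    finally show ?thesis .
  qed
qed

lemma L2_mult_bounded:
  assumes f: "f \<in> L2 M" and h: "h \<in> borel_measurable M" and B: "\<And>t. t \<in> space M \<Longrightarrow> cmod (h t) \<le> B"
  shows "(\<lambda>t. h t * f t) \<in> L2 M"
proof (rule L2_bounded_by)
  show "integrable M (\<lambda>t. B\<^sup>2 * (cmod (f t))\<^sup>2)" using f by (simp add: L2_def)
  show "(\<lambda>t. h t * f t) \<in> borel_measurable M" using L2_measurable[OF f] h by measurable
  show "(cmod (h t * f t))\<^sup>2 \<le> B\<^sup>2 * (cmod (f t))\<^sup>2" if "t \<in> space M" for t
    using B[OF that] by (simp add: norm_mult power_mult_distrib mult_right_mono power_mono)
qed

lemma L2_cmult: "f \<in> L2 M \<Longrightarrow> (\<lambda>t. c * f t) \<in> L2 M"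
  by (rule L2_mult_bounded[of f M "\<lambda>_. c" "cmod c"]) auto

lemma L2_diff: "f \<in> L2 M \<Longrightarrow> g \<in> L2 M \<Longrightarrow> (\<lambda>t. f t - g t) \<in> L2 M"
  using L2_add[of f M "\<lambda>t. -1 * g t"] L2_cmult[of g M "-1"] by simp

lemma L2_0: "(\<lambda>_. 0) \<in> L2 M"
  by (simp add: L2_def)

lemma L2_AE_cong:
  assumes f: "f \<in> L2 (lebesgue_on S)" and S: "S \<in> sets lebesgue"
    and ae: "AE t in lebesgue_on S. f t = g t"
  shows "g \<in> L2 (lebesgue_on S)"
proof -
  have g: "g \<in> borel_measurable (lebesgue_on S)"
    by (rule borel_measurable_lebesgue_on_AE[OF L2_measurable[OF f] S ae])
  have "integrable (lebesgue_on S) (\<lambda>t. (cmod (g t))\<^sup>2)"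
    by (rule Bochner_Integration.integrable_cong_AE_imp[of _ "\<lambda>t. (cmod (f t))\<^sup>2"])
       (use f g ae in \<open>auto simp: L2_def elim!: eventually_mono\<close>)
  then show ?thesis using g by (simp add: L2_def)
qed

lemma L2_inner_AE_cong:
  fixes u v :: "'a::euclidean_space \<Rightarrow> complex"
  assumes "u \<in> borel_measurable (lebesgue_on S)" "v \<in> borel_measurable (lebesgue_on S)" "S \<in> sets lebesgue"
    "AE t in lebesgue_on S. u t = u' t" "AE t in lebesgue_on S. v t = v' t"
  shows "L2_inner (lebesgue_on S) u v = L2_inner (lebesgue_on S) u' v'"
  unfolding L2_inner_def
proof (rule integral_cong_AE)
  have "u' \<in> borel_measurable (lebesgue_on S)" "v' \<in> borel_measurable (lebesgue_on S)"
    using assms by (auto intro: borel_measurable_lebesgue_on_AE)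
  then show "(\<lambda>t. u' t * cnj (v' t)) \<in> borel_measurable (lebesgue_on S)" by measurable
  show "(\<lambda>t. u t * cnj (v t)) \<in> borel_measurable (lebesgue_on S)" using assms(1,2) by measurable
  show "AE t in lebesgue_on S. u t * cnj (v t) = u' t * cnj (v' t)"
    using assms(4,5) by eventually_elim simp
qed

lemma L2_imp_integrable:
  assumes "f \<in> L2 (lebesgue_on {c..d::real})"
  shows "integrable (lebesgue_on {c..d}) f"
proof -
  have "(\<lambda>_. 1) \<in> L2 (lebesgue_on {c..d})"
    by (simp add: L2_def finite_measure.integrable_const[OF finite_measure_lebesgue_on])
  from L2_integrable_mult[OF assms this] show ?thesis by simp
qed

text \<open>Reduces to the whole line by extending the integrand by zero and the primitive by
  constants.\<close>

lemma indefinite_integral_derivative_AE_on: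
  fixes f :: "real \<Rightarrow> 'a::euclidean_space"
  assumes f: "f integrable_on {c..d}" and "c \<le> d"
    and F: "\<And>u v. c \<le> u \<Longrightarrow> u \<le> v \<Longrightarrow> v \<le> d \<Longrightarrow> F v - F u = integral {u..v} f"
  obtains N where "negligible N" "\<And>x. x \<in> {c<..<d} - N \<Longrightarrow> (F has_vector_derivative f x) (at x)"
proof -
  define f0 where "f0 x = (if x \<in> {c..d} then f x else 0)" for x
  define F0 where "F0 t = F (max c (min t d))" for t
  have int: "integral {u..v} f0 = integral {max u c..min v d} f" for u v
    unfolding f0_def using Henstock_Kurzweil_Integration.integral_restrict_Int[of "{u..v}" "{c..d}" f]
    by (simp add: max.commute min.commute)
  have "f0 integrable_on {u..v}" for u v
    unfolding f0_def
    using Henstock_Kurzweil_Integration.integrable_restrict_Int[of "{c..d}" f "{u..v}"]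
      integrable_on_subinterval[OF f, of "max u c" "min v d"] by (simp add: max.commute min.commute)
  moreover have "F0 v - F0 u = integral {u..v} f0" if "u \<le> v" for u v
  proof (cases "max u c \<le> min v d")
    case True
    then have "F (min v d) - F (max u c) = integral {max u c..min v d} f" by (intro F) auto
    moreover have "max c (min v d) = min v d" "max c (min u d) = max u c" using True \<open>c \<le> d\<close> by auto
    ultimately show ?thesis by (simp only: int F0_def)
  next
    case False
    then have "max c (min v d) = max c (min u d)" using \<open>c \<le> d\<close> that by auto
    then show ?thesis using False by (simp add: int F0_def)
  qed
  ultimately obtain N where N: "negligible N" "\<And>x. x \<notin> N \<Longrightarrow> (F0 has_vector_derivative f0 x) (at x)"
    using indefinite_integral_derivative_AE[of f0 F0] by blast
  show ?thesis
  proof (rule that[OF N(1)])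
    fix x assume x: "x \<in> {c<..<d} - N"
    show "(F has_vector_derivative f x) (at x)"
    proof (rule has_vector_derivative_transform_within_open)
      show "(F0 has_vector_derivative f x) (at x)" using N(2)[of x] x by (simp add: f0_def)
      show "x \<in> {c<..<d}" using x by simp
      show "F0 y = F y" if "y \<in> {c<..<d}" for y using that by (simp add: F0_def max_def)
    qed (rule open_greaterThanLessThan)
  qed
qed

section \<open>Solutions of the Legendre system\<close>

locale legendre =
  fixes a :: real
  assumes a_pos: "a > 0"
begin

abbreviation L :: "real measure" where "L \<equiv> lebesgue_interval a"

definition p :: "real \<Rightarrow> real" where "p t = 1 - t\<^sup>2 / a\<^sup>2"

lemma p_factor: "p t = (a - t) * (a + t) / a\<^sup>2"
  using a_pos by (simp add: p_def field_simps power2_eq_square)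

lemma p_pos: "t \<in> {-a<..<a} \<Longrightarrow> p t > 0"
  unfolding p_factor using a_pos by (intro divide_pos_pos mult_pos_pos) auto

text \<open>The second equation is kept in integrated form, so it holds without an exceptional set.
  The datum \<open>g\<close> is any representative of the image of \<open>x\<close>, which makes
  linear combinations exact and not merely valid almost everywhere. Square integrability of
  \<open>x\<close> is a consequence, \<open>sol_L2\<close>.\<close>

definition sol :: "(real \<Rightarrow> complex) \<Rightarrow> (real \<Rightarrow> complex) \<Rightarrow> (real \<Rightarrow> complex) \<Rightarrow> bool" where
  "sol x \<psi> g \<longleftrightarrow> g \<in> L2 L \<and>
     (\<forall>t\<in>{-a<..<a}. (x has_vector_derivative \<psi> t / of_real (p t)) (at t)) \<and>
     (\<forall>s t. -a < s \<and> s \<le> t \<and> t < a \<longrightarrow> \<psi> t - \<psi> s = - integral {s..t} g)"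

lemma solD:
  assumes "sol x \<psi> g"
  shows "g \<in> L2 L"
    "\<And>t. t \<in> {-a<..<a} \<Longrightarrow> (x has_vector_derivative \<psi> t / of_real (p t)) (at t)"
    "\<And>s t. -a < s \<Longrightarrow> s \<le> t \<Longrightarrow> t < a \<Longrightarrow> \<psi> t - \<psi> s = - integral {s..t} g"
  using assms by (auto simp: sol_def)

lemma L2_absolutely_integrable:
  assumes "g \<in> L2 L" "-a \<le> s" "t \<le> a"
  shows "g absolutely_integrable_on {s..t}"
proof -
  have "g absolutely_integrable_on {-a..a}"
    using L2_imp_integrable[OF assms(1)] by (simp add: integrable_lebesgue_on_iff)
  then show ?thesis by (rule set_integrable_subset) (use assms in auto)
qed

lemma L2_integrable_on:
  assumes "g \<in> L2 L" "-a \<le> s" "t \<le> a"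
  shows "g integrable_on {s..t}"
  using L2_absolutely_integrable[OF assms] by (rule set_lebesgue_integral_eq_integral(1))

lemma L2_norm2_integrable_on:
  assumes "g \<in> L2 L" "-a \<le> s" "t \<le> a"
  shows "(\<lambda>t. (cmod (g t))\<^sup>2) integrable_on {s..t}"
proof -
  have "(\<lambda>t. (cmod (g t))\<^sup>2) integrable_on {-a..a}"
    using assms(1) by (intro integrable_on_lebesgue_on) (auto simp: L2_def)
  then show ?thesis by (rule integrable_on_subinterval) (use assms in auto)
qed

lemma sol_AC:
  assumes "sol x \<psi> g" "-a < s" "t < a"
  shows "absolutely_continuous_on {s..t} \<psi>"
proof (rule absolutely_continuous_on_indefinite_integral)
  have g: "(\<lambda>t. - g t) \<in> L2 L" using L2_cmult[OF solD(1)[OF assms(1)], of "-1"] by simp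
  show "(\<lambda>t. - g t) absolutely_integrable_on {s..t}"
    using L2_absolutely_integrable[OF g] assms by auto
  show "(\<lambda>t. (cmod (- g t))\<^sup>2) integrable_on {s..t}"
    using L2_norm2_integrable_on[OF g] assms by auto
  show "\<psi> v - \<psi> u = integral {u..v} (\<lambda>t. - g t)" if "s \<le> u" "u \<le> v" "v \<le> t" for u v
    using solD(3)[OF assms(1), of u v] that assms(2,3) by simp
qed

lemma sol_derivative_AE:
  assumes "sol x \<psi> g"
  obtains N where "negligible N" "\<And>t. t \<in> {-a<..<a} - N \<Longrightarrow> (\<psi> has_vector_derivative - g t) (at t)"
proof -
  \<comment> \<open>The integrated equation lives on the open interval, which is therefore exhausted
    by compact ones. The summand 2 makes the first of them \<open>{-a/2..a/2}\<close>, so none is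
    degenerate.\<close>
  have "\<exists>N. negligible N \<and> (\<forall>t \<in> {-a + a / (real n + 2)<..<a - a / (real n + 2)} - N. (\<psi> has_vector_derivative - g t) (at t))" for n
  proof -
    let ?s = "-a + a / (real n + 2)" and ?t = "a - a / (real n + 2)"
    have half: "a / (real n + 2) \<le> a / 2" using a_pos by (intro divide_left_mono) auto
    have *: "a / (real n + 2) > 0" using a_pos by simp
    moreover have "a / (real n + 2) < a" using half a_pos by linarith
    ultimately have *: "a / (real n + 2) > 0" "a / (real n + 2) < a" by blast+
    have le: "?s \<le> ?t" using half a_pos by linarith
    have int: "(\<lambda>t. - g t) integrable_on {?s..?t}"
      using L2_integrable_on[OF solD(1)[OF assms], of ?s ?t] * by (intro integrable_neg) auto
    have "\<psi> v - \<psi> u = integral {u..v} (\<lambda>t. - g t)" if "?s \<le> u" "u \<le> v" "v \<le> ?t" for u v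
      using solD(3)[OF assms, of u v] that * by simp
    from indefinite_integral_derivative_AE_on[OF int le this] show ?thesis by metis
  qed
  then obtain N where N: "\<And>n. negligible (N n)"
    "\<And>n t. t \<in> {-a + a / (real n + 2)<..<a - a / (real n + 2)} - N n \<Longrightarrow> (\<psi> has_vector_derivative - g t) (at t)"
    by metis
  show ?thesis
  proof (rule that)
    show "negligible (\<Union>n. N n)" using N(1) by (rule negligible_Union_nat)
    fix t assume t: "t \<in> {-a<..<a} - (\<Union>n. N n)"
    define \<epsilon> where "\<epsilon> = min (a - t) (a + t)"
    have "\<epsilon> > 0" using t by (auto simp: \<epsilon>_def)
    obtain n :: nat where "a / \<epsilon> < real n" using reals_Archimedean2 by blast
    then have "a < \<epsilon> * real n" using \<open>\<epsilon> > 0\<close> by (simp add: field_simps)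
    also have "\<dots> \<le> \<epsilon> * (real n + 2)" using \<open>\<epsilon> > 0\<close> by simp
    finally have "a < \<epsilon> * (real n + 2)" .
    then have "a / (real n + 2) < \<epsilon>" by (simp add: field_simps)
    then show "(\<psi> has_vector_derivative - g t) (at t)"
      using N(2)[of t n] t by (auto simp: \<epsilon>_def)
  qed
qed

lemma sol_vector_derivative:
  assumes "sol x \<psi> g" "t \<in> {-a<..<a}"
  shows "vector_derivative x (at t) = \<psi> t / of_real (p t)"
  using solD(2)[OF assms] by (rule vector_derivative_at)

lemma sol_psi:
  assumes "sol x \<psi> g" "t \<in> {-a<..<a}"
  shows "of_real (p t) * vector_derivative x (at t) = \<psi> t"
  using sol_vector_derivative[OF assms] p_pos[OF assms(2)] by simp

lemma sol_legendre_expr: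
  assumes "sol x \<psi> g"
  shows "AE t in L. g t = legendre_expr a x t"
proof -
  obtain N where N: "negligible N" "\<And>t. t \<in> {-a<..<a} - N \<Longrightarrow> (\<psi> has_vector_derivative - g t) (at t)"
    using sol_derivative_AE[OF assms] by blast
  have "g t = legendre_expr a x t" if "t \<in> {-a..a} - (N \<union> {-a, a})" for t
  proof -
    have t: "t \<in> {-a<..<a}" "t \<notin> N" using that by auto
    have "((\<lambda>s. complex_of_real (1 - s\<^sup>2 / a\<^sup>2) * vector_derivative x (at s)) has_vector_derivative - g t) (at t)"
    proof (rule has_vector_derivative_transform_within_open)
      show "(\<psi> has_vector_derivative - g t) (at t)" using N(2) t by simp
      show "\<psi> s = complex_of_real (1 - s\<^sup>2 / a\<^sup>2) * vector_derivative x (at s)" if "s \<in> {-a<..<a}" for s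
        using sol_psi[OF assms that] by (simp only: p_def)
    qed (use t in \<open>auto intro: open_greaterThanLessThan\<close>)
    then show ?thesis unfolding legendre_expr_def by (simp add: vector_derivative_at)
  qed
  moreover have "negligible (N \<union> {-a, a})" using N(1) by simp
  ultimately have "\<exists>N. negligible N \<and> (\<forall>t\<in>{-a..a} - N. g t = legendre_expr a x t)" by blast
  then show ?thesis by (subst AE_lebesgue_on_iff_negligible) auto
qed

lemma absolutely_continuous_on_p: "absolutely_continuous_on {s..t} (\<lambda>r. complex_of_real (p r))"
proof -
  have sq: "absolutely_continuous_on {s..t} (\<lambda>r. complex_of_real r * complex_of_real r)"
    by (intro absolutely_continuous_on_mult absolutely_continuous_on_id)
  show ?thesis
  proof (rule absolutely_continuous_on_dominated[OF sq sq, of _ "1 / a\<^sup>2" 0])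
    fix u v
    have "p v - p u = - ((v * v - u * u) / a\<^sup>2)" by (simp add: p_def power2_eq_square diff_divide_distrib)
    then have "\<bar>p v - p u\<bar> = 1 / a\<^sup>2 * \<bar>v * v - u * u\<bar>" by (simp only: abs_minus_cancel abs_divide) simp
    then show "cmod (complex_of_real (p v) - complex_of_real (p u))
      \<le> 1 / a\<^sup>2 * cmod (complex_of_real v * complex_of_real v - complex_of_real u * complex_of_real u) +
         0 * cmod (complex_of_real v * complex_of_real v - complex_of_real u * complex_of_real u)"
      by (simp flip: of_real_diff of_real_mult)
  qed
qed

lemma absolutely_continuous_on_inverse_p:
  assumes "-a < s" "t < a"
  shows "absolutely_continuous_on {s..t} (\<lambda>r. inverse (complex_of_real (p r)))"
proof -
  \<comment> \<open>The factors \<open>a - r\<close> and \<open>a + r\<close> of \<open>p r\<close>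
    are bounded below separately, each at its worst end of \<open>{s..t}\<close>.\<close>
  define m where "m = (a - t) * (a + s) / a\<^sup>2"
  have m: "m > 0" unfolding m_def using assms a_pos by simp
  have pm: "m \<le> p r" if "r \<in> {s..t}" for r
    unfolding m_def p_factor using that assms a_pos by (intro divide_right_mono mult_mono) auto
  show ?thesis
  proof (rule absolutely_continuous_on_dominated[OF absolutely_continuous_on_p absolutely_continuous_on_p, of _ _ _ "1 / (m * m)" 0])
    fix u v :: real assume uv: "u < v" "{u..v} \<subseteq> {s..t}"
    then have "m \<le> p u" "m \<le> p v" by (auto intro!: pm)
    then have pp: "m * m \<le> p u * p v" "p u > 0" "p v > 0" using m by (auto intro!: mult_mono)
    have "inverse (complex_of_real (p v)) - inverse (complex_of_real (p u)) = complex_of_real ((p u - p v) / (p u * p v))"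
      using pp by (simp add: field_simps)
    then have "cmod (inverse (complex_of_real (p v)) - inverse (complex_of_real (p u))) = \<bar>p u - p v\<bar> / (p u * p v)"
      using pp by (simp only: norm_of_real) (simp add: abs_mult)
    also have "\<dots> \<le> \<bar>p u - p v\<bar> / (m * m)" using pp m by (intro divide_left_mono) auto
    finally show "cmod (inverse (complex_of_real (p v)) - inverse (complex_of_real (p u)))
      \<le> 1 / (m * m) * cmod (complex_of_real (p v) - complex_of_real (p u)) + 0 * cmod (complex_of_real (p v) - complex_of_real (p u))"
      by (simp add: abs_minus_commute flip: of_real_diff)
  qed
qed

text \<open>The fundamental theorem for absolutely continuous functions, applied to \<open>p\<close>
  times the derivative of \<open>x\<close>, yields the integrated equation. On the exceptional null
  set \<open>legendre_expr\<close> has arbitrary values, which the integral ignores.\<close>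

lemma D_max_imp_sol:
  assumes "x \<in> D_max a"
  shows "sol x (\<lambda>t. of_real (p t) * vector_derivative x (at t)) (legendre_expr a x)"
  unfolding sol_def
proof (intro conjI allI impI ballI)
  show "legendre_expr a x \<in> L2 L" using assms by (simp add: D_max_def)
  fix t assume t: "t \<in> {-a<..<a}"
  have "x differentiable (at t)" using assms t by (simp add: D_max_def legendre_class_def)
  then show "(x has_vector_derivative of_real (p t) * vector_derivative x (at t) / of_real (p t)) (at t)"
    using p_pos[OF t] by (simp add: vector_derivative_works)
next
  fix s t assume st: "-a < s \<and> s \<le> t \<and> t < a"
  let ?\<psi> = "\<lambda>t. of_real (p t) * vector_derivative x (at t)"
  have "absolutely_continuous_on {s..t} (\<lambda>t. vector_derivative x (at t))"
    using assms st by (simp add: D_max_def legendre_class_def)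
  then have "absolutely_continuous_on {s..t} ?\<psi>"
    by (rule absolutely_continuous_on_mult[OF absolutely_continuous_on_p])
  then obtain f N where N: "negligible N"
    "\<And>r. r \<in> {s<..<t} - N \<Longrightarrow> (?\<psi> has_vector_derivative f r) (at r)"
    and f: "\<And>u v. s \<le> u \<Longrightarrow> u \<le> v \<Longrightarrow> v \<le> t \<Longrightarrow> (f has_integral (?\<psi> v - ?\<psi> u)) {u..v}"
    using st by (elim absolutely_continuous_on_imp_integral) blast+
  have "(f has_integral (?\<psi> t - ?\<psi> s)) {s..t}" using f st by simp
  then have "((\<lambda>r. - legendre_expr a x r) has_integral (?\<psi> t - ?\<psi> s)) {s..t}"
  proof (rule has_integral_spike[rotated 2])
    show "negligible (N \<union> {s, t})" using N(1) by simp
    show "- legendre_expr a x r = f r" if "r \<in> {s..t} - (N \<union> {s, t})" for r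
      using vector_derivative_at[OF N(2)[of r]] that by (simp add: legendre_expr_def p_def)
  qed
  from has_integral_neg[OF this] show "?\<psi> t - ?\<psi> s = - integral {s..t} (legendre_expr a x)"
    by (simp add: integral_unique)
qed

lemma sol_psi_bounded:
  assumes "sol x \<psi> g"
  obtains K where "K > 0" "\<And>t. t \<in> {-a<..<a} \<Longrightarrow> cmod (\<psi> t) \<le> K"
proof -
  let ?J = "integral {-a..a} (\<lambda>t. cmod (g t))"
  have ng: "(\<lambda>t. cmod (g t)) integrable_on {s..t}" if "-a \<le> s" "t \<le> a" for s t
    using L2_absolutely_integrable[OF solD(1)[OF assms] that] by (simp add: absolutely_integrable_on_def)
  have J: "cmod (integral {s..t} g) \<le> ?J" if "-a < s" "t < a" for s t
  proof -
    have "cmod (integral {s..t} g) \<le> integral {s..t} (\<lambda>t. cmod (g t))"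
      using L2_integrable_on[OF solD(1)[OF assms]] ng that by (intro integral_norm_bound_integral) auto
    also have "\<dots> \<le> ?J" using ng that by (intro integral_subset_le) auto
    finally show ?thesis .
  qed
  have J0: "?J \<ge> 0" using ng by (intro integral_nonneg) auto
  show ?thesis
  proof (rule that)
    show "cmod (\<psi> 0) + ?J + 1 > 0" using J0 by (simp add: add_nonneg_pos)
    fix t assume t: "t \<in> {-a<..<a}"
    have "cmod (\<psi> t - \<psi> 0) \<le> ?J"
    proof (cases "0 \<le> t")
      case True
      then show ?thesis using solD(3)[OF assms, of 0 t] J[of 0 t] t a_pos by simp
    next
      case False
      then show ?thesis using solD(3)[OF assms, of t 0] J[of t 0] t a_pos by (simp add: norm_minus_commute)
    qed
    then show "cmod (\<psi> t) \<le> cmod (\<psi> 0) + ?J + 1"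
      using norm_triangle_ineq2[of "\<psi> t" "\<psi> 0"] by linarith
  qed
qed

text \<open>The majorant for the square of the comparison function below: squaring the power -1/4
  gives an inverse square root. The primitive is continuous up to the end points, so the fundamental
  theorem applies despite the singular integrand.\<close>

lemma integrable_inverse_sqrt:
  "integrable L (\<lambda>t. 1 / sqrt (a - t) + 1 / sqrt (a + t))"
proof -
  have "((\<lambda>t. 1 / sqrt (a + t)) has_integral (2 * sqrt (a + a) - 2 * sqrt (a + (-a)))) {-a..a}"
  proof (rule fundamental_theorem_of_calculus_interior[where f = "\<lambda>t. 2 * sqrt (a + t)"])
    show "continuous_on {-a..a} (\<lambda>t. 2 * sqrt (a + t))" by (intro continuous_on_mult continuous_on_real_sqrt continuous_on_add continuous_on_const continuous_on_id)
    show "((\<lambda>t. 2 * sqrt (a + t)) has_vector_derivative 1 / sqrt (a + t)) (at t)" if "t \<in> {-a<..<a}" for t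
    proof -
      have "((\<lambda>t. a + t) has_real_derivative 1) (at t)"
        using DERIV_add[OF DERIV_const[of a] DERIV_ident] by simp
      from DERIV_chain2[where f = sqrt, OF DERIV_real_sqrt this] that
      have "((\<lambda>t. sqrt (a + t)) has_real_derivative inverse (sqrt (a + t)) / 2 * 1) (at t)" by simp
      from DERIV_cmult[OF this, of 2]
      have "((\<lambda>t. 2 * sqrt (a + t)) has_real_derivative 1 / sqrt (a + t)) (at t)"
        by (simp add: inverse_eq_divide)
      then show ?thesis by (rule has_real_derivative_iff_has_vector_derivative[THEN iffD1])
    qed
  qed (use a_pos in auto)
  then have 1: "(\<lambda>t. 1 / sqrt (a + t)) integrable_on {-a..a}" by (rule has_integral_integrable)
  then have "(\<lambda>t. 1 / sqrt (a + - t)) integrable_on {- a..- (- a)}"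
    by (rule Henstock_Kurzweil_Integration.integrable_reflect_real[THEN iffD2])
  then have 2: "(\<lambda>t. 1 / sqrt (a - t)) integrable_on {-a..a}" by simp
  have "0 \<le> 1 / sqrt (a - t) + 1 / sqrt (a + t)" if "t \<in> {-a..a}" for t
  proof -
    have "0 \<le> a - t" "0 \<le> a + t" using that by auto
    then show ?thesis by simp
  qed
  with Henstock_Kurzweil_Integration.integrable_add[OF 2 1] show ?thesis
    by (rule integrable_lebesgue_on_nonneg)
qed


lemma sol_continuous: "sol x \<psi> g \<Longrightarrow> continuous_on {-a<..<a} x"
  by (rule continuous_at_imp_continuous_on) (meson solD(2) has_vector_derivative_continuous)

lemma sol_measurable:
  assumes "sol x \<psi> g"
  shows "x \<in> borel_measurable L"
proof -
  have "(\<lambda>t. if t \<in> {-a<..<a} then x t else 0) \<in> borel_measurable lebesgue"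
    using continuous_imp_measurable_on_sets_lebesgue[OF sol_continuous[OF assms]]
    by (subst borel_measurable_if) auto
  then have m: "(\<lambda>t. if t \<in> {-a<..<a} then x t else 0) \<in> borel_measurable L"
    by (rule measurable_restrict_space1)
  show ?thesis
  proof (rule borel_measurable_lebesgue_on_AE[OF m])
    have "\<exists>N. negligible N \<and> (\<forall>t\<in>{-a..a} - N. (if t \<in> {-a<..<a} then x t else 0) = x t)"
      by (rule exI[of _ "{-a, a}"]) auto
    then show "AE t in L. (if t \<in> {-a<..<a} then x t else 0) = x t"
      by (subst AE_lebesgue_on_iff_negligible) auto
  qed simp
qed

text \<open>The comparison function \<open>(a - t) powr (-1/4) - (a + t) powr (-1/4)\<close> dominates the
  logarithmic growth of solutions and is still square integrable.\<close>

lemma sol_growth: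
  assumes "sol x \<psi> g"
  obtains C where "C \<ge> 0"
    "\<And>t. t \<in> {-a<..<a} \<Longrightarrow> cmod (x t - x 0) \<le> C * \<bar>(a - t) powr (-1/4) - (a + t) powr (-1/4)\<bar>"
proof -
  obtain K where K: "K > 0" "\<And>t. t \<in> {-a<..<a} \<Longrightarrow> cmod (\<psi> t) \<le> K"
    using sol_psi_bounded[OF assms] by blast
  define \<phi> where "\<phi> t = (a - t) powr (-1/4) - (a + t) powr (-1/4)" for t
  \<comment> \<open>\<open>1 / p t\<close> is \<open>a / 2\<close> times
    \<open>1 / (a - t) + 1 / (a + t)\<close>, and \<open>1 / r\<close> is at most
    \<open>(2 * a) powr (1/4) * r powr (-5/4)\<close> for \<open>0 < r\<close> and
    \<open>r < 2 * a\<close>. As the derivative of \<phi> carries a factor 1/4, this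
    \<open>C\<close> is what makes the derivative of \<open>C * \<phi>\<close> dominate that of
    \<open>x\<close>.\<close>
  define C where "C = 2 * a * K * (2 * a) powr (1/4)"
  have C: "C \<ge> 0" using K a_pos by (simp add: C_def)
  have \<phi>': "((\<lambda>t. C * \<phi> t) has_real_derivative C * (((a - t) powr (-5/4) + (a + t) powr (-5/4)) / 4)) (at t)"
    if "t \<in> {-a<..<a}" for t
  proof -
    have "a - t > 0" "a + t > 0" using that by auto
    have 1: "((\<lambda>t. (a - t) powr (-1/4)) has_real_derivative (-1/4) * (a - t) powr (-1/4 - 1) * (-1)) (at t)"
      by (rule DERIV_chain2[where g = "\<lambda>t. a - t", OF has_real_derivative_powr[OF \<open>a - t > 0\<close>]])
         (auto intro!: derivative_eq_intros)
    have 2: "((\<lambda>t. (a + t) powr (-1/4)) has_real_derivative (-1/4) * (a + t) powr (-1/4 - 1) * 1) (at t)"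
      by (rule DERIV_chain2[where g = "\<lambda>t. a + t", OF has_real_derivative_powr[OF \<open>a + t > 0\<close>]])
         (auto intro!: derivative_eq_intros)
    have "(-1/4 - 1 :: real) = -5/4" by simp
    then show ?thesis unfolding \<phi>_def using DERIV_cmult[OF DERIV_diff[OF 1 2], of C] by (simp add: add_divide_distrib)
  qed
  have bound: "cmod (\<psi> t / of_real (p t)) \<le> C * (((a - t) powr (-5/4) + (a + t) powr (-5/4)) / 4)"
    if "t \<in> {-a<..<a}" for t
  proof -
    have r: "1 / r \<le> (2 * a) powr (1/4) * r powr (-5/4)" if "0 < r" "r < 2 * a" for r
    proof -
      have "r powr (1/4) * r powr (-5/4) = r powr (1/4 + -5/4)" by (rule powr_add[symmetric])
      also have "\<dots> = r powr (-1)" by simp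
      also have "\<dots> = 1 / r" using that by (simp only: powr_minus_divide powr_one less_imp_le)
      finally have "1 / r = r powr (1/4) * r powr (-5/4)" ..
      also have "\<dots> \<le> (2 * a) powr (1/4) * r powr (-5/4)"
        using that by (intro mult_right_mono powr_mono2) auto
      finally show ?thesis .
    qed
    have pos: "a - t > 0" "a + t > 0" using that by auto
    have "cmod (\<psi> t / of_real (p t)) = cmod (\<psi> t) / p t"
      using p_pos[OF that] by (simp add: norm_divide)
    also have "\<dots> \<le> K / p t" using K(2)[OF that] p_pos[OF that] by (intro divide_right_mono) auto
    also have "K / p t = K * (a / 2 * (1 / (a - t) + 1 / (a + t)))"
      using pos a_pos unfolding p_factor by (simp add: field_simps power2_eq_square)
    also have "\<dots> \<le> K * (a / 2 * ((2 * a) powr (1/4) * (a - t) powr (-5/4) + (2 * a) powr (1/4) * (a + t) powr (-5/4)))"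
      using K(1) a_pos that pos by (intro mult_left_mono add_mono r) auto
    also have "\<dots> = C * (((a - t) powr (-5/4) + (a + t) powr (-5/4)) / 4)"
      by (simp add: C_def algebra_simps)
    finally show ?thesis .
  qed
  have growth: "cmod (x v - x u) \<le> C * \<phi> v - C * \<phi> u" if uv: "-a < u" "u < v" "v < a" for u v
  proof (rule differentiable_bound_general[OF \<open>u < v\<close>])
    show "continuous_on {u..v} x" using sol_continuous[OF assms] by (rule continuous_on_subset) (use uv in auto)
    show "continuous_on {u..v} (\<lambda>t. C * \<phi> t)"
    proof (rule continuous_at_imp_continuous_on, rule ballI)
      fix t assume "t \<in> {u..v}"
      then have "t \<in> {-a<..<a}" using uv by auto
      from DERIV_isCont[OF \<phi>'[OF this]] show "isCont (\<lambda>t. C * \<phi> t) t" .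
    qed
    show "(x has_vector_derivative \<psi> t / of_real (p t)) (at t)" if "u < t" "t < v" for t
      using solD(2)[OF assms] uv that by simp
    show "((\<lambda>t. C * \<phi> t) has_vector_derivative C * (((a - t) powr (-5/4) + (a + t) powr (-5/4)) / 4)) (at t)"
      if "u < t" "t < v" for t
      using \<phi>'[of t] uv that by (intro has_real_derivative_iff_has_vector_derivative[THEN iffD1]) auto
    show "cmod (\<psi> t / of_real (p t)) \<le> C * (((a - t) powr (-5/4) + (a + t) powr (-5/4)) / 4)"
      if "u < t" "t < v" for t using bound[of t] uv that by auto
  qed
  have \<phi>0: "\<phi> 0 = 0" by (simp add: \<phi>_def)
  show ?thesis
  proof (rule that[OF C])
    fix t assume t: "t \<in> {-a<..<a}"
    consider "t < 0" | "t = 0" | "t > 0" by linarith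
    then have "cmod (x t - x 0) \<le> C * \<bar>\<phi> t\<bar>"
    proof cases
      case 1
      then have "cmod (x t - x 0) \<le> C * - \<phi> t"
        using growth[of t 0] t a_pos \<phi>0 by (simp add: norm_minus_commute)
      also have "\<dots> \<le> C * \<bar>\<phi> t\<bar>" using C by (intro mult_left_mono) auto
      finally show ?thesis .
    next
      case 3
      then have "cmod (x t - x 0) \<le> C * \<phi> t"
        using growth[of 0 t] t a_pos \<phi>0 by simp
      also have "\<dots> \<le> C * \<bar>\<phi> t\<bar>" using C by (intro mult_left_mono) auto
      finally show ?thesis .
    qed (use C in simp)
    then show "cmod (x t - x 0) \<le> C * \<bar>(a - t) powr (-1/4) - (a + t) powr (-1/4)\<bar>" by (simp add: \<phi>_def)
  qed
qed

text \<open>The limit-circle property of both end points: square integrability is read off from the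
  growth bound, whatever the solution.\<close>

lemma sol_L2:
  assumes "sol x \<psi> g"
  shows "x \<in> L2 L"
proof -
  obtain C where C: "C \<ge> 0"
    "\<And>t. t \<in> {-a<..<a} \<Longrightarrow> cmod (x t - x 0) \<le> C * \<bar>(a - t) powr (-1/4) - (a + t) powr (-1/4)\<bar>"
    using sol_growth[OF assms] by blast
  \<comment> \<open>The values of \<open>x\<close> at the end points are arbitrary, whereas the
    pointwise majorant has to hold on the closed interval.\<close>
  define y where "y t = (if t \<in> {-a<..<a} then x t else 0)" for t
  have ae: "AE t in L. x t = y t"
    by (subst AE_lebesgue_on_iff_negligible) (auto simp: y_def intro!: exI[of _ "{-a, a}"])
  have "y \<in> L2 L"
  proof (rule L2_bounded_by)
    show "y \<in> borel_measurable L"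
      by (rule borel_measurable_lebesgue_on_AE[OF sol_measurable[OF assms] _ ae]) simp
    let ?h = "\<lambda>t. 2 * (cmod (x 0))\<^sup>2 + 2 * C\<^sup>2 * (1 / sqrt (a - t) + 1 / sqrt (a + t))"
    show "integrable L ?h"
      by (intro Bochner_Integration.integrable_add integrable_mult_right integrable_inverse_sqrt
          finite_measure.integrable_const[OF finite_measure_lebesgue_on]) simp
    fix t assume "t \<in> space L"
    then have tI: "t \<in> {-a..a}" by simp
    show "(cmod (y t))\<^sup>2 \<le> ?h t"
    proof (cases "t \<in> {-a<..<a}")
      case True
      then have pos: "a - t > 0" "a + t > 0" by auto
      let ?u = "(a - t) powr (-1/4)" and ?v = "(a + t) powr (-1/4)"
      have sq: "(r powr (-1/4))\<^sup>2 = 1 / sqrt r" if "r > 0" for r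
      proof -
        have "(r powr (-1/4))\<^sup>2 = r powr (-(1/2))" by (simp add: power2_eq_square powr_add[symmetric])
        also have "\<dots> = 1 / sqrt r" using that by (simp only: powr_minus_divide powr_half_sqrt less_imp_le)
        finally show ?thesis .
      qed
      have "(cmod (x t))\<^sup>2 \<le> (cmod (x 0) + C * \<bar>?u - ?v\<bar>)\<^sup>2"
        using C(2)[OF True] norm_triangle_ineq2[of "x t" "x 0"] by (intro power_mono) auto
      also have "\<dots> \<le> (cmod (x 0) + C * \<bar>?u - ?v\<bar>)\<^sup>2 + (cmod (x 0) - C * \<bar>?u - ?v\<bar>)\<^sup>2" by simp
      also have "\<dots> = 2 * (cmod (x 0))\<^sup>2 + 2 * C\<^sup>2 * (\<bar>?u - ?v\<bar>)\<^sup>2"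
        by (simp only: power2_sum power2_diff power_mult_distrib)
      also have "\<dots> \<le> 2 * (cmod (x 0))\<^sup>2 + 2 * C\<^sup>2 * (?u\<^sup>2 + ?v\<^sup>2)"
      proof -
        have "(\<bar>?u - ?v\<bar>)\<^sup>2 \<le> ?u\<^sup>2 + ?v\<^sup>2" by (simp add: power2_diff)
        then show ?thesis by (intro add_left_mono mult_left_mono) auto
      qed
      also have "\<dots> = ?h t" using sq[OF pos(1)] sq[OF pos(2)] by simp
      finally show ?thesis using True by (simp add: y_def)
    next
      case False
      have "0 \<le> a - t" "0 \<le> a + t" using tI by auto
      then have "0 \<le> ?h t" by (intro add_nonneg_nonneg[of _ "2 * C\<^sup>2 * (1 / sqrt (a - t) + 1 / sqrt (a + t))"] mult_nonneg_nonneg) simp_all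
      then show ?thesis unfolding y_def if_not_P[OF False] by simp
    qed
  qed
  then show ?thesis by (rule L2_AE_cong[OF _ _ AE_symmetric[OF ae]]) simp
qed

lemma sol_imp_D_max:
  assumes "sol x \<psi> g"
  shows "x \<in> D_max a"
  unfolding D_max_def legendre_class_def
proof (intro CollectI conjI IntI ballI allI impI)
  show "x \<in> L2 L" by (rule sol_L2[OF assms])
  show "legendre_expr a x \<in> L2 L"
    by (rule L2_AE_cong[OF solD(1)[OF assms] _ sol_legendre_expr[OF assms]]) simp
  show "x differentiable (at t)" if "t \<in> {-a<..<a}" for t
    using solD(2)[OF assms that] by (rule differentiableI_vector)
  fix c d assume cd: "-a < c \<and> c \<le> d \<and> d < a"
  have "absolutely_continuous_on {c..d} (\<lambda>t. \<psi> t * inverse (complex_of_real (p t)))"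
    using cd by (intro absolutely_continuous_on_mult sol_AC[OF assms] absolutely_continuous_on_inverse_p) auto
  then show "absolutely_continuous_on {c..d} (\<lambda>t. vector_derivative x (at t))"
  proof (rule absolutely_continuous_on_cong)
    show "\<psi> t * inverse (complex_of_real (p t)) = vector_derivative x (at t)" if "t \<in> {c..d}" for t
      using sol_vector_derivative[OF assms, of t] that cd by (simp add: field_simps)
  qed
qed

lemma D_max_iff_sol: "x \<in> D_max a \<longleftrightarrow> (\<exists>\<psi> g. sol x \<psi> g)"
  using D_max_imp_sol sol_imp_D_max by blast

section \<open>Linear combinations and reflection of solutions\<close>

lemma sol_add:
  assumes "sol x \<psi> g" "sol y \<omega> h"
  shows "sol (\<lambda>t. x t + y t) (\<lambda>t. \<psi> t + \<omega> t) (\<lambda>t. g t + h t)"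
  unfolding sol_def
proof (intro conjI ballI allI impI)
  show "(\<lambda>t. g t + h t) \<in> L2 L" using assms[THEN solD(1)] by (rule L2_add)
  show "((\<lambda>t. x t + y t) has_vector_derivative (\<psi> t + \<omega> t) / of_real (p t)) (at t)"
    if "t \<in> {-a<..<a}" for t
    using has_vector_derivative_add[OF solD(2)[OF assms(1) that] solD(2)[OF assms(2) that]]
    by (simp add: add_divide_distrib)
  fix s t assume st: "-a < s \<and> s \<le> t \<and> t < a"
  have "integral {s..t} (\<lambda>t. g t + h t) = integral {s..t} g + integral {s..t} h"
    by (rule integral_add) (use st assms[THEN solD(1)] in \<open>auto intro: L2_integrable_on\<close>)
  then show "\<psi> t + \<omega> t - (\<psi> s + \<omega> s) = - integral {s..t} (\<lambda>t. g t + h t)"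
    using solD(3)[OF assms(1), of s t] solD(3)[OF assms(2), of s t] st
    by (simp only: add_diff_add minus_add_distrib)
qed

lemma sol_cmult:
  assumes "sol x \<psi> g"
  shows "sol (\<lambda>t. c * x t) (\<lambda>t. c * \<psi> t) (\<lambda>t. c * g t)"
  unfolding sol_def
proof (intro conjI ballI allI impI)
  show "(\<lambda>t. c * g t) \<in> L2 L" using solD(1)[OF assms] by (rule L2_cmult)
  show "((\<lambda>t. c * x t) has_vector_derivative (c * \<psi> t) / of_real (p t)) (at t)"
    if "t \<in> {-a<..<a}" for t
    using has_vector_derivative_mult_right[OF solD(2)[OF assms that], of c] by simp
  fix s t assume st: "-a < s \<and> s \<le> t \<and> t < a"
  have "integral {s..t} (\<lambda>t. c * g t) = c * integral {s..t} g" by simp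
  then show "c * \<psi> t - c * \<psi> s = - integral {s..t} (\<lambda>t. c * g t)"
    using solD(3)[OF assms, of s t] st by (simp flip: right_diff_distrib)
qed

lemma L2_reflect:
  assumes "g \<in> L2 L"
  shows "(\<lambda>t. g (- t)) \<in> L2 L"
proof -
  have "integrable L (\<lambda>t. g (- t))" and i: "integrable L (\<lambda>t. (cmod (g (- t)))\<^sup>2)"
    using L2_imp_integrable[OF assms] assms
      Equivalence_Lebesgue_Henstock_Integration.integrable_reflect_real[where a = "-a" and b = a and f = g]
      Equivalence_Lebesgue_Henstock_Integration.integrable_reflect_real[where a = "-a" and b = a and f = "\<lambda>t. (cmod (g t))\<^sup>2"]
    by (auto simp: L2_def)
  then show ?thesis by (simp add: L2_def)
qed

text \<open>As \<open>p\<close> is even, reflection preserves the system; this lets the right end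
  point be treated as a left one.\<close>

lemma sol_reflect:
  assumes "sol x \<psi> g"
  shows "sol (\<lambda>t. x (- t)) (\<lambda>t. - \<psi> (- t)) (\<lambda>t. g (- t))"
  unfolding sol_def
proof (intro conjI ballI allI impI)
  show "(\<lambda>t. g (- t)) \<in> L2 L" using solD(1)[OF assms] by (rule L2_reflect)
  show "((\<lambda>t. x (- t)) has_vector_derivative (- \<psi> (- t)) / of_real (p t)) (at t)" if "t \<in> {-a<..<a}" for t
  proof -
    have "(uminus has_vector_derivative (-1 :: real)) (at t)"
      using has_vector_derivative_minus[OF has_vector_derivative_id] .
    from vector_diff_chain_at[OF this, of x "\<psi> (- t) / of_real (p (- t))"]
    show ?thesis using solD(2)[OF assms, of "- t"] that by (simp add: o_def p_def)
  qed
  fix s t assume st: "-a < s \<and> s \<le> t \<and> t < a"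
  have "integral {s..t} (\<lambda>r. g (- r)) = integral {-t..-s} g"
    using Henstock_Kurzweil_Integration.integral_reflect_real[where a = "-t" and b = "-s" and f = g] by simp
  then show "- \<psi> (- t) - - \<psi> (- s) = - integral {s..t} (\<lambda>r. g (- r))"
    using solD(3)[OF assms, of "-t" "-s"] st by simp
qed

end

section \<open>Generalized boundary values and Green's formula\<close>

text \<open>The Hoelder bound gives uniform continuity, and uniformly continuous functions extend to
  the closure.\<close>

lemma sqrt_modulus_limit_at_right:
  fixes f :: "real \<Rightarrow> complex"
  assumes "u < v" and f: "\<And>s t. u < s \<Longrightarrow> s < t \<Longrightarrow> t < v \<Longrightarrow> cmod (f t - f s) \<le> K * sqrt (t - s)"
  obtains l where "(f \<longlongrightarrow> l) (at_right u)"
proof -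
  have "uniformly_continuous_on {u<..<v} f"
    unfolding uniformly_continuous_on_def
  proof (intro allI impI)
    fix e :: real assume "e > 0"
    define z where "z = e / (\<bar>K\<bar> + 1)"
    define d where "d = z\<^sup>2"
    have "z > 0" using \<open>e > 0\<close> by (simp add: z_def add_nonneg_pos)
    then have d: "d > 0" "sqrt d = e / (\<bar>K\<bar> + 1)" unfolding z_def[symmetric] by (simp_all add: d_def)
    have *: "cmod (f t - f s) < e" if "u < s" "s < t" "t < v" "t - s < d" for s t
    proof -
      have "cmod (f t - f s) \<le> K * sqrt (t - s)" using f that by blast
      also have "\<dots> \<le> (\<bar>K\<bar> + 1) * sqrt (t - s)" using that by (intro mult_right_mono) auto
      also have "\<dots> < (\<bar>K\<bar> + 1) * sqrt d" using that by (intro mult_strict_left_mono) auto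
      also have "\<dots> = e" unfolding d(2) by (simp add: add_nonneg_eq_0_iff)
      finally show ?thesis .
    qed
    show "\<exists>d>0. \<forall>x\<in>{u<..<v}. \<forall>x'\<in>{u<..<v}. dist x' x < d \<longrightarrow> dist (f x') (f x) < e"
    proof (intro exI[of _ d] conjI ballI impI d(1))
      fix s t assume "s \<in> {u<..<v}" "t \<in> {u<..<v}" "dist t s < d"
      then show "dist (f t) (f s) < e"
        using *[of s t] *[of t s] \<open>e > 0\<close>
        by (cases s t rule: linorder_cases) (auto simp: dist_norm norm_minus_commute)
    qed
  qed
  moreover have "u \<in> closure {u<..<v}" using \<open>u < v\<close> by simp
  ultimately obtain l where "(f \<longlongrightarrow> l) (at u within {u<..<v})"
    by (rule uniformly_continuous_on_extension_at_closure)
  moreover have "at u within {u<..<v} = at_right u"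
    by (rule at_within_nhd[of u "{..<v}"]) (use \<open>u < v\<close> in auto)
  ultimately show ?thesis using that by simp
qed

lemma tendsto_sqrt_ln: "((\<lambda>t. sqrt (a + t) * ln (a + t)) \<longlongrightarrow> 0) (at_right (- a :: real))"
proof -
  have "((\<lambda>r. sqrt r * ln r) \<longlongrightarrow> 0) (at_right (0 :: real))" by real_asymp
  then show ?thesis by (subst filterlim_at_right_to_0) simp
qed

lemma tendsto_id_ln:
  "((\<lambda>t. (t + b) * ln (b + t)) \<longlongrightarrow> 0) (at_right (- b :: real))"
  "((\<lambda>t. (t - b) * ln (b - t)) \<longlongrightarrow> 0) (at_left b)"
proof -
  have *: "((\<lambda>r. r * ln r) \<longlongrightarrow> 0) (at_right (0 :: real))" by real_asymp
  then show "((\<lambda>t. (t + b) * ln (b + t)) \<longlongrightarrow> 0) (at_right (- b :: real))"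
    by (subst filterlim_at_right_to_0) simp
  have "((\<lambda>r. - (r * ln r)) \<longlongrightarrow> - 0) (at_right (0 :: real))" using * by (rule tendsto_minus)
  then show "((\<lambda>t. (t - b) * ln (b - t)) \<longlongrightarrow> 0) (at_left b)"
    by (subst filterlim_at_left_to_right, subst filterlim_at_right_to_0) simp
qed

text \<open>Here \<open>r\<close> stands for \<open>t + a\<close> or \<open>t - a\<close>,
  \<open>s\<close> for the logarithm and \<open>q\<close> for the remaining factor of
  \<open>p\<close>. Since \<open>r\<close> and \<open>s\<close> are real, the two terms containing
  \<open>s\<close> are equal and cancel.\<close>

lemma boundary_form_identity:
  fixes x y x' y' :: complex and q r s :: real
  shows "complex_of_real q * (complex_of_real r * x' * cnj (complex_of_real (r * s) * y' - y) -
      (complex_of_real (r * s) * x' - x) * cnj (complex_of_real r * y')) =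
    x * cnj (complex_of_real q * complex_of_real r * y') - complex_of_real q * complex_of_real r * x' * cnj y"
  by (simp add: algebra_simps)

context legendre
begin

text \<open>Cauchy-Schwarz against the constant 1, obtained from Young's inequality with weight
  \<open>q = sqrt (t - s)\<close>, the choice for which both terms are of order
  \<open>q\<close>.\<close>

lemma L2_integral_bound:
  assumes g: "g \<in> L2 L"
  obtains G where "\<And>s t. -a \<le> s \<Longrightarrow> s < t \<Longrightarrow> t \<le> a \<Longrightarrow> cmod (integral {s..t} g) \<le> G * sqrt (t - s)"
proof (rule that)
  let ?g2 = "\<lambda>t. (cmod (g t))\<^sup>2"
  fix s t assume st: "-a \<le> s" "s < t" "t \<le> a"
  define q where "q = sqrt (t - s)"
  have q: "q > 0" "q * q = t - s" using st by (auto simp: q_def)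
  have int: "(\<lambda>r. q / 2 * ?g2 r) integrable_on {s..t}" "(\<lambda>r. 1 / (2 * q)) integrable_on {s..t}"
    using L2_norm2_integrable_on[OF g] st by (auto intro!: integrable_on_mult_right)
  have "cmod (integral {s..t} g) \<le> integral {s..t} (\<lambda>r. q / 2 * ?g2 r + 1 / (2 * q))"
  proof (rule integral_norm_bound_integral)
    show "g integrable_on {s..t}" using L2_integrable_on[OF g] st by simp
    show "(\<lambda>r. q / 2 * ?g2 r + 1 / (2 * q)) integrable_on {s..t}"
      by (rule Henstock_Kurzweil_Integration.integrable_add[OF int])
    show "cmod (g r) \<le> q / 2 * ?g2 r + 1 / (2 * q)" for r
    proof -
      have "0 \<le> (q * cmod (g r) - 1)\<^sup>2 / (2 * q)" using q by simp
      also have "\<dots> = q / 2 * ?g2 r + 1 / (2 * q) - cmod (g r)"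
        using q(1) by (simp add: power2_eq_square field_simps)
      finally show ?thesis by simp
    qed
  qed
  also have "\<dots> = q / 2 * integral {s..t} ?g2 + (t - s) / (2 * q)"
    using st by (subst Henstock_Kurzweil_Integration.integral_add[OF int]) simp
  also have "(t - s) / (2 * q) = q / 2" using q by (simp add: field_simps)
  also have "q / 2 * integral {s..t} ?g2 \<le> q / 2 * integral {-a..a} ?g2"
    using st q(1) by (intro mult_left_mono integral_subset_le L2_norm2_integrable_on[OF g]) auto
  finally show "cmod (integral {s..t} g) \<le> ((integral {-a..a} ?g2 + 1) / 2) * sqrt (t - s)"
    by (simp add: q_def algebra_simps)
qed

text \<open>The limit of \<psi> comes with a rate of order \<open>sqrt (a + t)\<close>. This rate
  passes to \<open>(t + a)\<close> times the derivative of \<open>x\<close>; it is integrable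
  against \<open>1 / (a + t)\<close> and stronger than the logarithm, and these two facts give the
  second limit.\<close>

lemma sol_left_limits:
  assumes "sol x \<psi> g"
  shows "\<exists>b c. ((\<lambda>t. complex_of_real (t + a) * vector_derivative x (at t)) \<longlongrightarrow> b) (at_right (-a)) \<and>
    ((\<lambda>t. complex_of_real ((t + a) * ln (a + t)) * vector_derivative x (at t) - x t) \<longlongrightarrow> c) (at_right (-a))"
proof -
  obtain G where G: "\<And>s t. -a \<le> s \<Longrightarrow> s < t \<Longrightarrow> t \<le> a \<Longrightarrow> cmod (integral {s..t} g) \<le> G * sqrt (t - s)"
    using L2_integral_bound[OF solD(1)[OF assms]] by blast
  have \<psi>_mod: "cmod (\<psi> t - \<psi> s) \<le> G * sqrt (t - s)" if "-a < s" "s < t" "t < a" for s t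
    using G[of s t] solD(3)[OF assms, of s t] that by simp
  have "- a < a" using a_pos by simp
  then obtain \<psi>0 where \<psi>0: "(\<psi> \<longlongrightarrow> \<psi>0) (at_right (-a))"
    using sqrt_modulus_limit_at_right[of "-a" a \<psi> G] \<psi>_mod by blast
  have \<psi>0_mod: "cmod (\<psi> t - \<psi>0) \<le> \<bar>G\<bar> * sqrt (a + t)" if "-a < t" "t < a" for t
  proof (rule Lim_norm_ubound)
    show "((\<lambda>s. \<psi> t - \<psi> s) \<longlongrightarrow> \<psi> t - \<psi>0) (at_right (-a))" by (intro tendsto_intros \<psi>0)
    have "eventually (\<lambda>s. s \<in> {-a<..<t}) (at_right (-a))" using that(1) by (rule eventually_at_right_real)
    then show "eventually (\<lambda>s. cmod (\<psi> t - \<psi> s) \<le> \<bar>G\<bar> * sqrt (a + t)) (at_right (-a))"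
    proof eventually_elim
      case (elim s)
      then have "cmod (\<psi> t - \<psi> s) \<le> G * sqrt (t - s)" using \<psi>_mod that by simp
      also have "\<dots> \<le> \<bar>G\<bar> * sqrt (t - s)" using elim by (intro mult_right_mono) auto
      also have "\<dots> \<le> \<bar>G\<bar> * sqrt (a + t)" using elim by (intro mult_left_mono) auto
      finally show ?case .
    qed
  qed simp
  \<comment> \<open>\<open>(t + a)\<close> times the derivative of \<open>x\<close>, with the zero
    of \<open>p\<close> at \<open>-a\<close> cancelled; the remaining factor
    \<open>a\<^sup>2 / (a - t)\<close> has the value \<open>a / 2\<close> there, whence
    \<open>b\<close>.\<close>
  define B where "B t = \<psi> t * of_real (a\<^sup>2 / (a - t))" for t
  define b where "b = \<psi>0 * of_real (a / 2)"
  have B: "complex_of_real (t + a) * vector_derivative x (at t) = B t" if t: "t \<in> {-a<..<a}" for t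
  proof -
    have "a - t > 0" "a + t > 0" using t by auto
    moreover have "(t + a) * (a - t) = a\<^sup>2 * p t" using a_pos by (simp add: p_factor mult.commute add.commute)
    ultimately have "(t + a) / p t = a\<^sup>2 / (a - t)" using p_pos[OF t] by (simp add: frac_eq_eq)
    then have "complex_of_real (t + a) / complex_of_real (p t) = complex_of_real (a\<^sup>2 / (a - t))"
      by (simp only: of_real_divide[symmetric])
    then show ?thesis
      unfolding B_def sol_vector_derivative[OF assms t]
      by (simp only: times_divide_eq_right mult.commute[of "\<psi> t"] times_divide_eq_left[symmetric])
  qed
  \<comment> \<open>The first summand combines the Hoelder bound for \<psi> with
    \<open>a\<^sup>2 / (a - t) \<le> a\<close>; the second bounds the distance of this factor from
    \<open>a / 2\<close>, which is at most \<open>(a + t) / 2\<close>. Both use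
    \<open>t \<le> 0\<close>.\<close>
  define K where "K = a * \<bar>G\<bar> + cmod \<psi>0 * (sqrt a / 2)"
  have D: "cmod (B t - b) \<le> K * sqrt (a + t)" if t: "-a < t" "t \<le> 0" for t
  proof -
    have "B t - b = of_real (a\<^sup>2 / (a - t)) * (\<psi> t - \<psi>0) + \<psi>0 * of_real (a\<^sup>2 / (a - t) - a / 2)"
    proof -
      have "\<psi> t * w - \<psi>0 * v = w * (\<psi> t - \<psi>0) + \<psi>0 * (w - v)" for w v by (simp add: algebra_simps)
      then show ?thesis by (simp only: B_def b_def of_real_diff)
    qed
    then have "cmod (B t - b) \<le> \<bar>a\<^sup>2 / (a - t)\<bar> * cmod (\<psi> t - \<psi>0) + cmod \<psi>0 * \<bar>a\<^sup>2 / (a - t) - a / 2\<bar>"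
      by (metis norm_mult norm_of_real norm_triangle_ineq)
    also have "\<dots> \<le> a * (\<bar>G\<bar> * sqrt (a + t)) + cmod \<psi>0 * (sqrt a / 2 * sqrt (a + t))"
    proof (intro add_mono mult_mono mult_left_mono)
      have "a\<^sup>2 / (a - t) \<le> a" using t a_pos by (simp add: divide_le_eq power2_eq_square mult_le_0_iff)
      moreover have "a\<^sup>2 / (a - t) \<ge> 0" using t a_pos by simp
      ultimately show "\<bar>a\<^sup>2 / (a - t)\<bar> \<le> a" by (simp only: abs_of_nonneg)
      show "cmod (\<psi> t - \<psi>0) \<le> \<bar>G\<bar> * sqrt (a + t)" using \<psi>0_mod t a_pos by simp
      have "a\<^sup>2 / (a - t) - a / 2 = (a / (a - t)) * ((a + t) / 2)"
        using t a_pos by (simp add: field_simps power2_eq_square)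
      moreover have "0 \<le> a / (a - t)" "a / (a - t) \<le> 1" using t a_pos by (auto simp: divide_le_eq)
      ultimately have "\<bar>a\<^sup>2 / (a - t) - a / 2\<bar> \<le> 1 * ((a + t) / 2)"
        using t by (simp only: abs_mult) (intro mult_mono, auto)
      also have "\<dots> = sqrt (a + t) / 2 * sqrt (a + t)" using t by simp
      also have "\<dots> \<le> sqrt a / 2 * sqrt (a + t)" using t by (intro mult_right_mono) auto
      finally show "\<bar>a\<^sup>2 / (a - t) - a / 2\<bar> \<le> sqrt a / 2 * sqrt (a + t)" .
    qed (use a_pos in auto)
    also have "\<dots> = K * sqrt (a + t)" by (simp add: K_def algebra_simps)
    finally show ?thesis .
  qed
  have ev: "eventually (\<lambda>t. t \<in> {-a<..<0}) (at_right (-a))" using a_pos by (intro eventually_at_right_real) simp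
  have sqrt0: "((\<lambda>t. K * sqrt (a + t)) \<longlongrightarrow> 0) (at_right (-a))"
  proof -
    have "((\<lambda>t. K * sqrt (a + t)) \<longlongrightarrow> K * sqrt (a + (-a))) (at_right (-a))" by (intro tendsto_intros)
    then show ?thesis by simp
  qed
  have "((\<lambda>t. B t - b) \<longlongrightarrow> 0) (at_right (-a))"
    by (rule Lim_null_comparison[OF _ sqrt0]) (use ev in \<open>eventually_elim, use D in auto\<close>)
  then have B_lim: "(B \<longlongrightarrow> b) (at_right (-a))" by (simp add: LIM_zero_iff)
  \<comment> \<open>This removes the logarithmic singularity of \<open>x\<close>: the derivative of
    \<open>E\<close> is \<open>(b - B t) / (a + t)\<close>, bounded by
    \<open>K / sqrt (a + t)\<close>, so that \<open>E\<close> is again Hoelder continuous of order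
    1/2.\<close>
  define E where "E t = b * of_real (ln (a + t)) - x t" for t
  have "cmod (E v - E u) \<le> 2 * K * sqrt (v - u)" if uv: "-a < u" "u < v" "v < 0" for u v
  proof -
    have "cmod (E v - E u) \<le> 2 * K * sqrt (a + v) - 2 * K * sqrt (a + u)"
    proof (rule differentiable_bound_general[OF \<open>u < v\<close>])
      have xc: "continuous_on {u..v} x" by (rule continuous_on_subset[OF sol_continuous[OF assms]]) (use uv a_pos in auto)
      show "continuous_on {u..v} E"
        unfolding E_def using uv by (intro continuous_intros xc) auto
      show "continuous_on {u..v} (\<lambda>t. 2 * K * sqrt (a + t))" by (intro continuous_intros)
      fix t assume t: "u < t" "t < v"
      then have pos: "a + t > 0" and tI: "t \<in> {-a<..<a}" using uv a_pos by auto
      have "((\<lambda>t. ln (a + t)) has_real_derivative 1 / (a + t)) (at t)"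
        using pos by (auto intro!: derivative_eq_intros)
      then have "((\<lambda>t. complex_of_real (ln (a + t))) has_vector_derivative of_real (1 / (a + t))) (at t)"
        by (intro has_vector_derivative_of_real)
           (simp add: has_real_derivative_iff_has_vector_derivative)
      then show "(E has_vector_derivative (b * of_real (1 / (a + t)) - \<psi> t / of_real (p t))) (at t)"
        unfolding E_def
        by (intro has_vector_derivative_diff has_vector_derivative_mult_right solD(2)[OF assms tI])
      have "((\<lambda>t. a + t) has_real_derivative 1) (at t)"
        using DERIV_add[OF DERIV_const[of a] DERIV_ident] by simp
      from DERIV_chain2[where f = sqrt, OF DERIV_real_sqrt this] pos
      have "((\<lambda>t. sqrt (a + t)) has_real_derivative inverse (sqrt (a + t)) / 2 * 1) (at t)" by simp
      from DERIV_cmult[OF this, of "2 * K"]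
      have "((\<lambda>t. 2 * K * sqrt (a + t)) has_real_derivative K / sqrt (a + t)) (at t)"
        by (simp add: inverse_eq_divide)
      then show "((\<lambda>t. 2 * K * sqrt (a + t)) has_vector_derivative K / sqrt (a + t)) (at t)"
        by (rule has_real_derivative_iff_has_vector_derivative[THEN iffD1])
      have "\<psi> t / of_real (p t) = B t * of_real (1 / (a + t))"
      proof -
        have "\<psi> t / of_real (p t) = (of_real (t + a) * vector_derivative x (at t)) / of_real (a + t)"
          using sol_vector_derivative[OF assms tI] pos by (simp add: add.commute flip: of_real_add)
        then show ?thesis unfolding B[OF tI] by (simp add: divide_inverse)
      qed
      then have "cmod (b * of_real (1 / (a + t)) - \<psi> t / of_real (p t)) = cmod (B t - b) * (1 / (a + t))"
        using pos by (metis abs_of_pos left_diff_distrib norm_minus_commute norm_mult norm_of_real zero_less_divide_1_iff)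
      also have "\<dots> \<le> K * sqrt (a + t) * (1 / (a + t))"
        using D[of t] t uv pos by (intro mult_right_mono) auto
      also have "\<dots> = K / sqrt (a + t)" using pos by (simp add: real_div_sqrt field_simps)
      finally show "cmod (b * of_real (1 / (a + t)) - \<psi> t / of_real (p t)) \<le> K / sqrt (a + t)" .
    qed
    also have "\<dots> = 2 * K * (sqrt (a + v) - sqrt (a + u))" by (simp add: algebra_simps)
    also have "\<dots> \<le> 2 * K * sqrt (v - u)"
    proof (rule mult_left_mono)
      have "sqrt (a + v) \<le> sqrt (v - u) + sqrt (a + u)"
        using sqrt_add_le_add_sqrt[of "v - u" "a + u"] uv by (simp add: add.commute[of v a])
      then show "sqrt (a + v) - sqrt (a + u) \<le> sqrt (v - u)" by simp
      show "0 \<le> 2 * K" using a_pos by (simp add: K_def)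
    qed
    finally show ?thesis .
  qed
  then obtain l where l: "(E \<longlongrightarrow> l) (at_right (-a))"
    using sqrt_modulus_limit_at_right[of "-a" 0 E "2 * K"] a_pos by auto
  \<comment> \<open>The square root rate of \<open>B t - b\<close> beats the logarithm, so replacing
    \<open>b\<close> by \<open>B t\<close> in \<open>E\<close> does not change the limit.\<close>
  have "((\<lambda>t. (B t - b) * of_real (ln (a + t))) \<longlongrightarrow> 0) (at_right (-a))"
  proof (rule Lim_null_comparison)
    have "((\<lambda>t. K * \<bar>sqrt (a + t) * ln (a + t)\<bar>) \<longlongrightarrow> K * \<bar>0\<bar>) (at_right (-a))"
      by (intro tendsto_intros tendsto_sqrt_ln)
    then show "((\<lambda>t. K * \<bar>sqrt (a + t) * ln (a + t)\<bar>) \<longlongrightarrow> 0) (at_right (-a))" by simp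
    show "eventually (\<lambda>t. cmod ((B t - b) * of_real (ln (a + t))) \<le> K * \<bar>sqrt (a + t) * ln (a + t)\<bar>) (at_right (-a))"
      using ev
    proof eventually_elim
      case (elim t)
      have "cmod ((B t - b) * of_real (ln (a + t))) = cmod (B t - b) * \<bar>ln (a + t)\<bar>"
        by (simp only: norm_mult norm_of_real)
      also have "\<dots> \<le> K * sqrt (a + t) * \<bar>ln (a + t)\<bar>" using D elim by (intro mult_right_mono) auto
      also have "\<dots> = K * \<bar>sqrt (a + t) * ln (a + t)\<bar>" using elim by (simp add: abs_mult)
      finally show ?case .
    qed
  qed
  from tendsto_add[OF this l]
  have C_lim: "((\<lambda>t. B t * of_real (ln (a + t)) - x t) \<longlongrightarrow> l) (at_right (-a))"
    by (simp add: E_def algebra_simps)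
  have "((\<lambda>t. complex_of_real (t + a) * vector_derivative x (at t)) \<longlongrightarrow> b) (at_right (-a))"
    by (rule Lim_transform_eventually[OF B_lim]) (use ev in \<open>eventually_elim, use B a_pos in auto\<close>)
  moreover have "((\<lambda>t. complex_of_real ((t + a) * ln (a + t)) * vector_derivative x (at t) - x t) \<longlongrightarrow> l) (at_right (-a))"
  proof (rule Lim_transform_eventually[OF C_lim])
    show "eventually (\<lambda>t. B t * of_real (ln (a + t)) - x t =
        complex_of_real ((t + a) * ln (a + t)) * vector_derivative x (at t) - x t) (at_right (-a))"
      using ev
    proof eventually_elim
      case (elim t)
      then have "t \<in> {-a<..<a}" using a_pos by simp
      note B[OF this, symmetric]
      then show ?case by (simp only: of_real_mult) (simp only: mult_ac)
    qed
  qed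
  ultimately show ?thesis by blast
qed

text \<open>The signs in the definitions at \<open>a\<close> are chosen such that the expressions
  for \<open>x\<close> at the right end are those of its reflection at the left end.\<close>

lemma sol_right_limits:
  assumes "sol x \<psi> g"
  shows "\<exists>b c. ((\<lambda>t. complex_of_real (t - a) * vector_derivative x (at t)) \<longlongrightarrow> b) (at_left a) \<and>
    ((\<lambda>t. complex_of_real ((t - a) * ln (a - t)) * vector_derivative x (at t) - x t) \<longlongrightarrow> c) (at_left a)"
proof -
  let ?y = "\<lambda>t. x (- t)"
  obtain b c where bc: "((\<lambda>t. complex_of_real (t + a) * vector_derivative ?y (at t)) \<longlongrightarrow> b) (at_right (-a))"
    "((\<lambda>t. complex_of_real ((t + a) * ln (a + t)) * vector_derivative ?y (at t) - ?y t) \<longlongrightarrow> c) (at_right (-a))"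
    using sol_left_limits[OF sol_reflect[OF assms]] by blast
  have y': "vector_derivative ?y (at t) = - vector_derivative x (at (- t))" if "t \<in> {-a<..<a}" for t
    using sol_vector_derivative[OF sol_reflect[OF assms] that] sol_vector_derivative[OF assms, of "- t"] that
    by (simp add: p_def)
  have ev: "eventually (\<lambda>t. t \<in> {-a<..<a}) (at_right (-a))" using a_pos by (intro eventually_at_right_real) simp
  have "((\<lambda>t. complex_of_real (- t - a) * vector_derivative x (at (- t))) \<longlongrightarrow> b) (at_right (-a))"
  proof (rule Lim_transform_eventually[OF bc(1)])
    show "eventually (\<lambda>t. complex_of_real (t + a) * vector_derivative ?y (at t) =
        complex_of_real (- t - a) * vector_derivative x (at (- t))) (at_right (-a))"
      using ev
    proof eventually_elim
      case (elim t)
      show ?case unfolding y'[OF elim] by (simp add: algebra_simps)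
    qed
  qed
  moreover have "((\<lambda>t. complex_of_real ((- t - a) * ln (a - - t)) * vector_derivative x (at (- t)) - x (- t)) \<longlongrightarrow> c) (at_right (-a))"
  proof (rule Lim_transform_eventually[OF bc(2)])
    show "eventually (\<lambda>t. complex_of_real ((t + a) * ln (a + t)) * vector_derivative ?y (at t) - ?y t =
        complex_of_real ((- t - a) * ln (a - - t)) * vector_derivative x (at (- t)) - x (- t)) (at_right (-a))"
      using ev
    proof eventually_elim
      case (elim t)
      show ?case unfolding y'[OF elim] by (simp add: algebra_simps)
    qed
  qed
  ultimately show ?thesis by (auto simp: filterlim_at_left_to_right)
qed

text \<open>\<open>Lim\<close> is informative only once a limit exists; here existence is turned
  into convergence to the defined boundary values.\<close>

lemma D_max_tendsto:
  assumes "x \<in> D_max a"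
  shows "((\<lambda>t. complex_of_real (t + a) * vector_derivative x (at t)) \<longlongrightarrow> b_left a x) (at_right (-a))"
    "((\<lambda>t. complex_of_real ((t + a) * ln (a + t)) * vector_derivative x (at t) - x t) \<longlongrightarrow> c_left a x) (at_right (-a))"
    "((\<lambda>t. complex_of_real (t - a) * vector_derivative x (at t)) \<longlongrightarrow> b_right a x) (at_left a)"
    "((\<lambda>t. complex_of_real ((t - a) * ln (a - t)) * vector_derivative x (at t) - x t) \<longlongrightarrow> c_right a x) (at_left a)"
proof -
  have *: "(f \<longlongrightarrow> Lim F f) F" if "(f \<longlongrightarrow> l) F" "F \<noteq> bot" for f :: "real \<Rightarrow> complex" and l F
    using tendsto_Lim[OF that(2,1)] that(1) by simp
  obtain b c where l: "((\<lambda>t. complex_of_real (t + a) * vector_derivative x (at t)) \<longlongrightarrow> b) (at_right (-a))"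
    "((\<lambda>t. complex_of_real ((t + a) * ln (a + t)) * vector_derivative x (at t) - x t) \<longlongrightarrow> c) (at_right (-a))"
    using sol_left_limits[OF D_max_imp_sol[OF assms]] by blast
  obtain b' c' where r: "((\<lambda>t. complex_of_real (t - a) * vector_derivative x (at t)) \<longlongrightarrow> b') (at_left a)"
    "((\<lambda>t. complex_of_real ((t - a) * ln (a - t)) * vector_derivative x (at t) - x t) \<longlongrightarrow> c') (at_left a)"
    using sol_right_limits[OF D_max_imp_sol[OF assms]] by blast
  show "((\<lambda>t. complex_of_real (t + a) * vector_derivative x (at t)) \<longlongrightarrow> b_left a x) (at_right (-a))"
    unfolding b_left_def by (rule *[OF l(1)]) simp
  show "((\<lambda>t. complex_of_real ((t + a) * ln (a + t)) * vector_derivative x (at t) - x t) \<longlongrightarrow> c_left a x) (at_right (-a))"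
    unfolding c_left_def by (rule *[OF l(2)]) simp
  show "((\<lambda>t. complex_of_real (t - a) * vector_derivative x (at t)) \<longlongrightarrow> b_right a x) (at_left a)"
    unfolding b_right_def by (rule *[OF r(1)]) simp
  show "((\<lambda>t. complex_of_real ((t - a) * ln (a - t)) * vector_derivative x (at t) - x t) \<longlongrightarrow> c_right a x) (at_left a)"
    unfolding c_right_def by (rule *[OF r(2)]) simp
qed

section \<open>Green's formula\<close>

lemma sol_AC_self:
  assumes "sol x \<psi> g" "-a < s" "t < a"
  shows "absolutely_continuous_on {s..t} x"
proof -
  have "continuous_on {s..t} (\<lambda>r. \<psi> r * inverse (complex_of_real (p r)))"
    using assms by (intro absolutely_continuous_on_imp_continuous_on absolutely_continuous_on_mult
        sol_AC absolutely_continuous_on_inverse_p)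
  then have "bounded ((\<lambda>r. \<psi> r * inverse (complex_of_real (p r))) ` {s..t})"
    by (intro compact_imp_bounded compact_continuous_image) auto
  then obtain K where K: "\<And>r. r \<in> {s..t} \<Longrightarrow> cmod (\<psi> r * inverse (complex_of_real (p r))) \<le> K"
    unfolding bounded_iff by blast
  show ?thesis
  proof (rule absolutely_continuous_on_Lipschitz)
    fix u v :: real assume uv: "u < v" "{u..v} \<subseteq> {s..t}"
    have "cmod (x v - x u) \<le> K * v - K * u"
    proof (rule differentiable_bound_general[OF \<open>u < v\<close>])
      show "continuous_on {u..v} x"
        by (rule continuous_on_subset[OF sol_continuous[OF assms(1)]]) (use uv assms in auto)
      show "(x has_vector_derivative \<psi> r / of_real (p r)) (at r)" if "u < r" "r < v" for r
        using solD(2)[OF assms(1), of r] that uv assms by auto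
      show "((\<lambda>r. K * r) has_vector_derivative K) (at r)" for r
        using has_vector_derivative_mult_right[OF has_vector_derivative_id, of K] by simp
      show "cmod (\<psi> r / of_real (p r)) \<le> K" if "u < r" "r < v" for r
        using K[of r] that uv by (auto simp: divide_inverse)
    qed (intro continuous_on_mult continuous_on_const continuous_on_id)
    then show "cmod (x v - x u) \<le> K * (v - u)" by (simp add: right_diff_distrib)
  qed
qed

text \<open>The Wronskian \<open>W\<close> is absolutely continuous, and in its derivative the two
  products of \<psi> with the conjugate of \<omega>, divided by \<open>p\<close>, cancel because
  \<open>p\<close> is real.\<close>

lemma green_compact:
  assumes x: "sol x \<psi> g" and y: "sol y \<omega> h" and st: "-a < s" "s \<le> t" "t < a"
  defines "W \<equiv> \<lambda>r. x r * cnj (\<omega> r) - \<psi> r * cnj (y r)"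
  shows "((\<lambda>r. g r * cnj (y r) - x r * cnj (h r)) has_integral (W t - W s)) {s..t}"
proof -
  obtain N where N: "negligible N" "\<And>t. t \<in> {-a<..<a} - N \<Longrightarrow> (\<psi> has_vector_derivative - g t) (at t)"
    using sol_derivative_AE[OF x] by blast
  obtain M where M: "negligible M" "\<And>t. t \<in> {-a<..<a} - M \<Longrightarrow> (\<omega> has_vector_derivative - h t) (at t)"
    using sol_derivative_AE[OF y] by blast
  have "absolutely_continuous_on {s..t} (\<lambda>r. x r * cnj (\<omega> r) + - (\<psi> r * cnj (y r)))"
    using st x y
    by (intro absolutely_continuous_on_add absolutely_continuous_on_minus absolutely_continuous_on_mult
        absolutely_continuous_on_cnj sol_AC[of x \<psi> g] sol_AC[of y \<omega> h] sol_AC_self[of x \<psi> g] sol_AC_self[of y \<omega> h])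
  then have AC: "absolutely_continuous_on {s..t} W" by (simp add: W_def)
  show ?thesis
  proof (rule absolutely_continuous_on_has_integral(2)[OF AC st(2)])
    show "negligible (N \<union> M)" using N(1) M(1) by simp
    fix r assume r: "r \<in> {s<..<t} - (N \<union> M)"
    then have r': "r \<in> {-a<..<a}" using st by auto
    have dx: "(x has_vector_derivative \<psi> r / of_real (p r)) (at r)" by (rule solD(2)[OF x r'])
    have dy: "((\<lambda>r. cnj (y r)) has_vector_derivative cnj (\<omega> r / of_real (p r))) (at r)"
      by (rule has_vector_derivative_cnj[OF solD(2)[OF y r']])
    have d\<psi>: "(\<psi> has_vector_derivative - g r) (at r)" using N(2) r r' by blast
    have "(\<omega> has_vector_derivative - h r) (at r)" using M(2) r r' by blast
    then have d\<omega>: "((\<lambda>r. cnj (\<omega> r)) has_vector_derivative cnj (- h r)) (at r)"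
      by (rule has_vector_derivative_cnj)
    have "(W has_vector_derivative ((x r * cnj (- h r) + \<psi> r / of_real (p r) * cnj (\<omega> r)) -
        (\<psi> r * cnj (\<omega> r / of_real (p r)) + - g r * cnj (y r)))) (at r)"
      unfolding W_def
      by (intro has_vector_derivative_diff has_vector_derivative_mult dx dy d\<psi> d\<omega>)
    moreover have "(x r * cnj (- h r) + \<psi> r / of_real (p r) * cnj (\<omega> r)) -
        (\<psi> r * cnj (\<omega> r / of_real (p r)) + - g r * cnj (y r)) = g r * cnj (y r) - x r * cnj (h r)"
      by simp
    ultimately show "(W has_vector_derivative (g r * cnj (y r) - x r * cnj (h r))) (at r)" by simp
  qed
qed

text \<open>The logarithmic terms cancel identically:
  \<open>x = B ln - C\<close> and \<open>p x' = q B\<close> with \<open>q\<close> regular at the end point, where \<open>B\<close> and \<open>C\<close> are the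
  functions whose limits are the generalized boundary values.\<close>

lemma green:
  assumes x: "x \<in> D_max a" and y: "y \<in> D_max a"
  shows "L2_inner L (legendre_expr a x) y - L2_inner L x (legendre_expr a y) =
    - of_real (2 / a) * ((b_left a x * cnj (c_left a y) - c_left a x * cnj (b_left a y)) +
      (b_right a x * cnj (c_right a y) - c_right a x * cnj (b_right a y)))"
proof -
  let ?dx = "\<lambda>t. vector_derivative x (at t)" and ?dy = "\<lambda>t. vector_derivative y (at t)"
  let ?g = "legendre_expr a x" and ?h = "legendre_expr a y"
  define \<psi> where "\<psi> = (\<lambda>t. of_real (p t) * ?dx t)"
  define \<omega> where "\<omega> = (\<lambda>t. of_real (p t) * ?dy t)"
  define W where "W r = x r * cnj (\<omega> r) - \<psi> r * cnj (y r)" for r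
  define f where "f r = ?g r * cnj (y r) - x r * cnj (?h r)" for r
  have sx: "sol x \<psi> ?g" and sy: "sol y \<omega> ?h"
    unfolding \<psi>_def \<omega>_def by (rule D_max_imp_sol[OF x], rule D_max_imp_sol[OF y])
  have L2: "x \<in> L2 L" "y \<in> L2 L" "?g \<in> L2 L" "?h \<in> L2 L"
    using x y by (auto simp: D_max_def)
  have i1: "integrable L (\<lambda>r. ?g r * cnj (y r))" and i2: "integrable L (\<lambda>r. x r * cnj (?h r))"
    using L2 by (auto intro: L2_integrable_mult)
  then have intf: "integrable L f" unfolding f_def by (rule Bochner_Integration.integrable_diff)
  have lhs: "L2_inner L ?g y - L2_inner L x ?h = integral {-a..a} f"
  proof -
    have "L2_inner L ?g y - L2_inner L x ?h = integral\<^sup>L L f"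
      unfolding L2_inner_def f_def by (rule Bochner_Integration.integral_diff[OF i1 i2, symmetric])
    also have "\<dots> = integral {-a..a} f" by (rule lebesgue_integral_eq_integral[OF intf]) simp
    finally show ?thesis .
  qed
  have f_int: "f integrable_on {-a..a}" using intf by (rule integrable_on_lebesgue_on) simp
  \<comment> \<open>\<open>F\<close> has the same increments as \<open>W\<close> and is continuous
    up to the end points, so the integral over the whole interval is the difference of the two
    limits of \<open>W\<close>.\<close>
  define F where "F t = integral {-a..t} f" for t
  have F_cont: "continuous_on {-a..a} F" unfolding F_def by (rule indefinite_integral_continuous_1[OF f_int])
  have F_diff: "W t - W s = F t - F s" if "-a < s" "s \<le> t" "t < a" for s t
  proof -
    have "(f has_integral (W t - W s)) {s..t}"
      unfolding f_def W_def by (rule green_compact[OF sx sy that])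
    moreover have "integral {-a..s} f + integral {s..t} f = integral {-a..t} f"
      using that by (intro Henstock_Kurzweil_Integration.integral_combine integrable_on_subinterval[OF f_int]) auto
    ultimately have "integral {-a..s} f + (W t - W s) = integral {-a..t} f" by (simp only: integral_unique)
    then show ?thesis by (simp add: F_def algebra_simps)
  qed
  have "- a < a" using a_pos by simp
  have F_left: "(F \<longlongrightarrow> F (-a)) (at_right (-a))" and F_right: "(F \<longlongrightarrow> F a) (at_left a)"
    by (rule continuous_on_Icc_at_rightD[OF F_cont \<open>- a < a\<close>],
        rule continuous_on_Icc_at_leftD[OF F_cont \<open>- a < a\<close>])
  have W_left: "(W \<longlongrightarrow> of_real (2 / a) * (b_left a x * cnj (c_left a y) - c_left a x * cnj (b_left a y))) (at_right (-a))"
  proof -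
    let ?B = "\<lambda>t. complex_of_real (t + a) * ?dx t" and ?C = "\<lambda>t. complex_of_real ((t + a) * ln (a + t)) * ?dx t - x t"
    let ?B' = "\<lambda>t. complex_of_real (t + a) * ?dy t" and ?C' = "\<lambda>t. complex_of_real ((t + a) * ln (a + t)) * ?dy t - y t"
    \<comment> \<open>At the left end \<open>p\<close> is \<open>t + a\<close> times the regular
      factor \<open>(a - t) / a\<^sup>2\<close>, which tends to \<open>2 / a\<close>.\<close>
    have "((\<lambda>t. (a - t) / a\<^sup>2) \<longlongrightarrow> (a - (-a)) / a\<^sup>2) (at_right (-a))"
      by (intro tendsto_intros) (use a_pos in auto)
    moreover have "(a - (-a)) / a\<^sup>2 = 2 / a" using a_pos by (simp add: power2_eq_square)
    ultimately have "((\<lambda>t. (a - t) / a\<^sup>2) \<longlongrightarrow> 2 / a) (at_right (-a))" by (simp only:)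
    then have "((\<lambda>t. complex_of_real ((a - t) / a\<^sup>2)) \<longlongrightarrow> of_real (2 / a)) (at_right (-a))"
      by (rule tendsto_of_real)
    then have "((\<lambda>t. complex_of_real ((a - t) / a\<^sup>2) * (?B t * cnj (?C' t) - ?C t * cnj (?B' t))) \<longlongrightarrow>
        of_real (2 / a) * (b_left a x * cnj (c_left a y) - c_left a x * cnj (b_left a y))) (at_right (-a))"
      by (intro tendsto_mult tendsto_diff tendsto_cnj D_max_tendsto x y)
    moreover have "complex_of_real ((a - t) / a\<^sup>2) * (?B t * cnj (?C' t) - ?C t * cnj (?B' t)) = W t" for t
    proof -
      have "complex_of_real (p t) = complex_of_real ((a - t) / a\<^sup>2) * complex_of_real (t + a)"
        unfolding p_factor of_real_mult[symmetric] by (simp add: add.commute)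
      then show ?thesis
        unfolding W_def \<psi>_def \<omega>_def by (simp only: boundary_form_identity)
    qed
    ultimately show ?thesis by simp
  qed
  have W_right: "(W \<longlongrightarrow> - of_real (2 / a) * (b_right a x * cnj (c_right a y) - c_right a x * cnj (b_right a y))) (at_left a)"
  proof -
    let ?B = "\<lambda>t. complex_of_real (t - a) * ?dx t" and ?C = "\<lambda>t. complex_of_real ((t - a) * ln (a - t)) * ?dx t - x t"
    let ?B' = "\<lambda>t. complex_of_real (t - a) * ?dy t" and ?C' = "\<lambda>t. complex_of_real ((t - a) * ln (a - t)) * ?dy t - y t"
    \<comment> \<open>Now \<open>p\<close> is \<open>t - a\<close> times the negative of
      \<open>(a + t) / a\<^sup>2\<close>. The opposite sign makes both ends contribute with equal
      sign to the difference of the limits.\<close>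
    have "((\<lambda>t. (a + t) / a\<^sup>2) \<longlongrightarrow> (a + a) / a\<^sup>2) (at_left a)"
      by (intro tendsto_intros) (use a_pos in auto)
    moreover have "(a + a) / a\<^sup>2 = 2 / a" using a_pos by (simp add: power2_eq_square)
    ultimately have "((\<lambda>t. (a + t) / a\<^sup>2) \<longlongrightarrow> 2 / a) (at_left a)" by (simp only:)
    then have "((\<lambda>t. - complex_of_real ((a + t) / a\<^sup>2)) \<longlongrightarrow> - of_real (2 / a)) (at_left a)"
      by (intro tendsto_minus tendsto_of_real)
    then have "((\<lambda>t. - complex_of_real ((a + t) / a\<^sup>2) * (?B t * cnj (?C' t) - ?C t * cnj (?B' t))) \<longlongrightarrow>
        - of_real (2 / a) * (b_right a x * cnj (c_right a y) - c_right a x * cnj (b_right a y))) (at_left a)"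
      by (intro tendsto_mult tendsto_diff tendsto_cnj D_max_tendsto x y)
    moreover have "- complex_of_real ((a + t) / a\<^sup>2) * (?B t * cnj (?C' t) - ?C t * cnj (?B' t)) = W t" for t
    proof -
      have "complex_of_real (p t) = - complex_of_real ((a + t) / a\<^sup>2) * complex_of_real (t - a)"
        unfolding p_factor of_real_mult[symmetric] of_real_minus[symmetric] by (simp add: algebra_simps diff_divide_distrib)
      then show ?thesis
        unfolding W_def \<psi>_def \<omega>_def of_real_minus[symmetric] by (simp only: boundary_form_identity)
    qed
    ultimately show ?thesis by simp
  qed
  let ?WL = "of_real (2 / a) * (b_left a x * cnj (c_left a y) - c_left a x * cnj (b_left a y))"
  let ?WR = "- of_real (2 / a) * (b_right a x * cnj (c_right a y) - c_right a x * cnj (b_right a y))"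
  have F0: "F (-a) = 0" by (simp add: F_def)
  have left: "W t - ?WL = F t" if t: "-a < t" "t < a" for t
  proof (rule tendsto_unique)
    show "((\<lambda>s. W t - W s) \<longlongrightarrow> W t - ?WL) (at_right (-a))" by (intro tendsto_intros W_left)
    have ev: "eventually (\<lambda>s. s \<in> {-a<..<t}) (at_right (-a))" using t(1) by (rule eventually_at_right_real)
    have "((\<lambda>s. F t - F s) \<longlongrightarrow> F t - F (-a)) (at_right (-a))" by (intro tendsto_intros F_left)
    then show "((\<lambda>s. W t - W s) \<longlongrightarrow> F t) (at_right (-a))"
      unfolding F0 diff_zero
      by (rule Lim_transform_eventually) (use ev in \<open>eventually_elim, use F_diff t in auto\<close>)
  qed simp
  have "?WR - ?WL = F a"
  proof (rule tendsto_unique)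
    show "((\<lambda>t. W t - ?WL) \<longlongrightarrow> ?WR - ?WL) (at_left a)" by (intro tendsto_diff tendsto_const W_right)
    have ev: "eventually (\<lambda>s. s \<in> {-a<..<a}) (at_left a)" using \<open>- a < a\<close> by (rule eventually_at_left_real)
    show "((\<lambda>t. W t - ?WL) \<longlongrightarrow> F a) (at_left a)"
      by (rule Lim_transform_eventually[OF F_right]) (use ev in \<open>eventually_elim, use left in auto\<close>)
  qed simp
  then show ?thesis unfolding lhs F_def by (simp add: algebra_simps)
qed

end

text \<open>The set where continuous functions differ is open, and a nonempty open set is not
  negligible.\<close>

lemma continuous_AE_eq:
  fixes f g :: "'a::euclidean_space \<Rightarrow> 'b::real_normed_vector"
  assumes "open S" "continuous_on S f" "continuous_on S g" "negligible N"
    and eq: "\<And>t. t \<in> S - N \<Longrightarrow> f t = g t" and "t \<in> S"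
  shows "f t = g t"
proof (rule ccontr)
  assume ne: "f t \<noteq> g t"
  let ?A = "S \<inter> (\<lambda>t. f t - g t) -` (- {0})"
  have "open ?A"
    by (rule continuous_open_preimage) (use assms in \<open>auto intro!: continuous_intros\<close>)
  moreover have "?A \<noteq> {}" using ne \<open>t \<in> S\<close> by auto
  moreover have "?A \<subseteq> N" using eq by auto
  then have "negligible ?A" using \<open>negligible N\<close> by (rule negligible_subset[rotated])
  ultimately show False using open_not_negligible by blast
qed

section \<open>Linearity of the boundary values and explicit solutions\<close>

context legendre
begin

lemma sol_lin:
  assumes "sol x \<psi> g" "sol y \<omega> h"
  shows "sol (\<lambda>t. c * x t + d * y t) (\<lambda>t. c * \<psi> t + d * \<omega> t) (\<lambda>t. c * g t + d * h t)"
  by (intro sol_add sol_cmult assms)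

lemma sol_cong:
  assumes x: "sol x \<psi> g" and eq: "\<And>t. t \<in> {-a<..<a} \<Longrightarrow> y t = x t"
  shows "sol y \<psi> g"
proof -
  have "(y has_vector_derivative \<psi> t / of_real (p t)) (at t)" if "t \<in> {-a<..<a}" for t
    by (rule has_vector_derivative_transform_within_open[OF solD(2)[OF x that] _ that])
       (auto simp: eq)
  then show ?thesis using x by (simp add: sol_def)
qed

lemma D_max_lin:
  assumes "x \<in> D_max a" "y \<in> D_max a"
  shows "(\<lambda>t. c * x t + d * y t) \<in> D_max a"
  using assms sol_lin unfolding D_max_iff_sol by blast

lemma legendre_expr_lin:
  assumes "x \<in> D_max a" "y \<in> D_max a"
  shows "AE t in L. c * legendre_expr a x t + d * legendre_expr a y t = legendre_expr a (\<lambda>t. c * x t + d * y t) t"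
  by (rule sol_legendre_expr[OF sol_lin[OF D_max_imp_sol D_max_imp_sol]]) (use assms in auto)

lemma D_max_vector_derivative_lin:
  assumes "x \<in> D_max a" "y \<in> D_max a" "t \<in> {-a<..<a}"
  shows "vector_derivative (\<lambda>t. c * x t + d * y t) (at t) =
    c * vector_derivative x (at t) + d * vector_derivative y (at t)"
proof (rule vector_derivative_at)
  have "x differentiable (at t)" "y differentiable (at t)"
    using assms by (auto simp: D_max_def legendre_class_def)
  then show "((\<lambda>t. c * x t + d * y t) has_vector_derivative
      c * vector_derivative x (at t) + d * vector_derivative y (at t)) (at t)"
    by (intro has_vector_derivative_add has_vector_derivative_mult_right) (simp_all add: vector_derivative_works)
qed

lemma eventually_ends:
  "eventually (\<lambda>t. t \<in> {-a<..<a}) (at_right (-a))" "eventually (\<lambda>t. t \<in> {-a<..<a}) (at_left a)"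
proof -
  have "-a < a" using a_pos by simp
  then show "eventually (\<lambda>t. t \<in> {-a<..<a}) (at_right (-a))" "eventually (\<lambda>t. t \<in> {-a<..<a}) (at_left a)"
    by (rule eventually_at_right_real, rule eventually_at_left_real)
qed

lemma boundary_lin:
  assumes x: "x \<in> D_max a" and y: "y \<in> D_max a"
  shows "b_left a (\<lambda>t. c * x t + d * y t) = c * b_left a x + d * b_left a y"
    "c_left a (\<lambda>t. c * x t + d * y t) = c * c_left a x + d * c_left a y"
    "b_right a (\<lambda>t. c * x t + d * y t) = c * b_right a x + d * b_right a y"
    "c_right a (\<lambda>t. c * x t + d * y t) = c * c_right a x + d * c_right a y"
proof -
  let ?z = "\<lambda>t. c * x t + d * y t"
  note z = D_max_lin[OF x y, of c d]
  have 1: "((\<lambda>t. A t * vector_derivative ?z (at t)) \<longlongrightarrow> c * l + d * m) F"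
    if "((\<lambda>t. A t * vector_derivative x (at t)) \<longlongrightarrow> l) F" "((\<lambda>t. A t * vector_derivative y (at t)) \<longlongrightarrow> m) F"
      "eventually (\<lambda>t. t \<in> {-a<..<a}) F" for A l m F
  proof (rule Lim_transform_eventually[OF tendsto_add[OF tendsto_mult_left[OF that(1)] tendsto_mult_left[OF that(2)]]])
    show "\<forall>\<^sub>F t in F. c * (A t * vector_derivative x (at t)) + d * (A t * vector_derivative y (at t)) = A t * vector_derivative ?z (at t)"
      using that(3)
    proof eventually_elim
      case (elim t)
      show ?case unfolding D_max_vector_derivative_lin[OF x y elim] by (simp add: algebra_simps)
    qed
  qed
  have 2: "((\<lambda>t. A t * vector_derivative ?z (at t) - ?z t) \<longlongrightarrow> c * l + d * m) F"
    if "((\<lambda>t. A t * vector_derivative x (at t) - x t) \<longlongrightarrow> l) F" "((\<lambda>t. A t * vector_derivative y (at t) - y t) \<longlongrightarrow> m) F"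
      "eventually (\<lambda>t. t \<in> {-a<..<a}) F" for A l m F
  proof (rule Lim_transform_eventually[OF tendsto_add[OF tendsto_mult_left[OF that(1)] tendsto_mult_left[OF that(2)]]])
    show "\<forall>\<^sub>F t in F. c * (A t * vector_derivative x (at t) - x t) + d * (A t * vector_derivative y (at t) - y t) = A t * vector_derivative ?z (at t) - ?z t"
      using that(3)
    proof eventually_elim
      case (elim t)
      show ?case unfolding D_max_vector_derivative_lin[OF x y elim] by (simp add: algebra_simps)
    qed
  qed
  show "b_left a ?z = c * b_left a x + d * b_left a y"
    by (rule tendsto_unique[OF _ D_max_tendsto(1)[OF z] 1[OF D_max_tendsto(1)[OF x] D_max_tendsto(1)[OF y] eventually_ends(1)]]) simp
  show "c_left a ?z = c * c_left a x + d * c_left a y"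
    by (rule tendsto_unique[OF _ D_max_tendsto(2)[OF z] 2[OF D_max_tendsto(2)[OF x] D_max_tendsto(2)[OF y] eventually_ends(1)]]) simp
  show "b_right a ?z = c * b_right a x + d * b_right a y"
    by (rule tendsto_unique[OF _ D_max_tendsto(3)[OF z] 1[OF D_max_tendsto(3)[OF x] D_max_tendsto(3)[OF y] eventually_ends(2)]]) simp
  show "c_right a ?z = c * c_right a x + d * c_right a y"
    by (rule tendsto_unique[OF _ D_max_tendsto(4)[OF z] 2[OF D_max_tendsto(4)[OF x] D_max_tendsto(4)[OF y] eventually_ends(2)]]) simp
qed

text \<open>The explicit functions below are built from real-valued ones, so computing their
  boundary values reduces to limits of real functions.\<close>

lemma boundary_real:
  fixes f f' :: "real \<Rightarrow> real"
  defines "x \<equiv> \<lambda>t. complex_of_real (f t)"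
  assumes x: "x \<in> D_max a"
    and f': "\<And>t. t \<in> {-a<..<a} \<Longrightarrow> (f has_real_derivative f' t) (at t)"
  shows "((\<lambda>t. (t + a) * f' t) \<longlongrightarrow> l) (at_right (-a)) \<Longrightarrow> b_left a x = of_real l"
    "((\<lambda>t. (t + a) * ln (a + t) * f' t - f t) \<longlongrightarrow> l) (at_right (-a)) \<Longrightarrow> c_left a x = of_real l"
    "((\<lambda>t. (t - a) * f' t) \<longlongrightarrow> l) (at_left a) \<Longrightarrow> b_right a x = of_real l"
    "((\<lambda>t. (t - a) * ln (a - t) * f' t - f t) \<longlongrightarrow> l) (at_left a) \<Longrightarrow> c_right a x = of_real l"
proof -
  have x': "vector_derivative x (at t) = of_real (f' t)" if "t \<in> {-a<..<a}" for t
    unfolding x_def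
    by (intro vector_derivative_at has_vector_derivative_of_real
        has_real_derivative_iff_has_vector_derivative[THEN iffD1] f' that)
  have 1: "((\<lambda>t. complex_of_real (A t) * vector_derivative x (at t)) \<longlongrightarrow> of_real l) F"
    if "((\<lambda>t. A t * f' t) \<longlongrightarrow> l) F" "eventually (\<lambda>t. t \<in> {-a<..<a}) F" for A F
  proof (rule Lim_transform_eventually[OF tendsto_of_real[OF that(1)]])
    show "\<forall>\<^sub>F t in F. complex_of_real (A t * f' t) = complex_of_real (A t) * vector_derivative x (at t)"
      using that(2)
    proof eventually_elim
      case (elim t)
      show ?case unfolding x'[OF elim] by simp
    qed
  qed
  have 2: "((\<lambda>t. complex_of_real (A t) * vector_derivative x (at t) - x t) \<longlongrightarrow> of_real l) F"
    if "((\<lambda>t. A t * f' t - f t) \<longlongrightarrow> l) F" "eventually (\<lambda>t. t \<in> {-a<..<a}) F" for A F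
  proof (rule Lim_transform_eventually[OF tendsto_of_real[OF that(1)]])
    show "\<forall>\<^sub>F t in F. complex_of_real (A t * f' t - f t) = complex_of_real (A t) * vector_derivative x (at t) - x t"
      using that(2)
    proof eventually_elim
      case (elim t)
      show ?case unfolding x'[OF elim] by (simp add: x_def)
    qed
  qed
  show "b_left a x = of_real l" if "((\<lambda>t. (t + a) * f' t) \<longlongrightarrow> l) (at_right (-a))"
    by (rule tendsto_unique[OF _ D_max_tendsto(1)[OF x] 1[OF that eventually_ends(1)]]) simp
  show "c_left a x = of_real l" if "((\<lambda>t. (t + a) * ln (a + t) * f' t - f t) \<longlongrightarrow> l) (at_right (-a))"
    by (rule tendsto_unique[OF _ D_max_tendsto(2)[OF x] 2[OF that eventually_ends(1)]]) simp
  show "b_right a x = of_real l" if "((\<lambda>t. (t - a) * f' t) \<longlongrightarrow> l) (at_left a)"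
    by (rule tendsto_unique[OF _ D_max_tendsto(3)[OF x] 1[OF that eventually_ends(2)]]) simp
  show "c_right a x = of_real l" if "((\<lambda>t. (t - a) * ln (a - t) * f' t - f t) \<longlongrightarrow> l) (at_left a)"
    by (rule tendsto_unique[OF _ D_max_tendsto(4)[OF x] 2[OF that eventually_ends(2)]]) simp
qed

lemma continuous_L2:
  assumes "continuous_on {-a..a} f"
  shows "f \<in> L2 L"
proof -
  have "f \<in> borel_measurable L" using assms by (rule continuous_imp_measurable_on_sets_lebesgue) simp
  moreover have "integrable L (\<lambda>t. (cmod (f t))\<^sup>2)"
    by (rule integrable_lebesgue_on_nonneg[OF integrable_continuous_real]) (use assms in \<open>auto intro!: continuous_intros\<close>)
  ultimately show ?thesis by (simp add: L2_def)
qed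

text \<open>The function \<open>h\<close> is \<open>p\<close> times the derivative of
  \<open>f\<close>, in a form differentiable across the end points; for the logarithms below it
  exists because \<open>p\<close> cancels the pole of the derivative.\<close>

lemma sol_real:
  fixes f f' h g :: "real \<Rightarrow> real"
  assumes f': "\<And>t. t \<in> {-a<..<a} \<Longrightarrow> (f has_real_derivative f' t) (at t)"
    and h: "\<And>t. t \<in> {-a<..<a} \<Longrightarrow> p t * f' t = h t"
    and h': "\<And>t. (h has_real_derivative - g t) (at t)" and g: "continuous_on {-a..a} g"
  shows "sol (\<lambda>t. of_real (f t)) (\<lambda>t. of_real (h t)) (\<lambda>t. of_real (g t))"
  unfolding sol_def
proof (intro conjI ballI allI impI)
  show "(\<lambda>t. complex_of_real (g t)) \<in> L2 L"
    by (rule continuous_L2) (use g in \<open>auto intro!: continuous_intros\<close>)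
  fix t assume t: "t \<in> {-a<..<a}"
  have "f' t = h t / p t" using h[OF t] p_pos[OF t] by (simp add: field_simps)
  moreover have "((\<lambda>t. complex_of_real (f t)) has_vector_derivative of_real (f' t)) (at t)"
    by (intro has_vector_derivative_of_real has_real_derivative_iff_has_vector_derivative[THEN iffD1] f' t)
  ultimately show "((\<lambda>t. complex_of_real (f t)) has_vector_derivative complex_of_real (h t) / complex_of_real (p t)) (at t)"
    by simp
next
  fix s t assume st: "-a < s \<and> s \<le> t \<and> t < a"
  have "((\<lambda>t. - complex_of_real (g t)) has_integral (complex_of_real (h t) - complex_of_real (h s))) {s..t}"
  proof (rule fundamental_theorem_of_calculus[where f = "\<lambda>t. complex_of_real (h t)"])
    show "((\<lambda>t. complex_of_real (h t)) has_vector_derivative - complex_of_real (g r)) (at r within {s..t})" for r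
      using has_vector_derivative_at_within[OF has_vector_derivative_of_real[OF h'[of r]]] by simp
  qed (use st in simp)
  from has_integral_neg[OF this]
  show "complex_of_real (h t) - complex_of_real (h s) = - integral {s..t} (\<lambda>t. complex_of_real (g t))"
    by (simp add: integral_unique)
qed

lemma boundary_one:
  "(\<lambda>_. 1) \<in> D_max a" "b_left a (\<lambda>_. 1) = 0" "c_left a (\<lambda>_. 1) = -1" "b_right a (\<lambda>_. 1) = 0" "c_right a (\<lambda>_. 1) = -1"
proof -
  have "sol (\<lambda>t. of_real 1) (\<lambda>t. of_real 0) (\<lambda>t. of_real 0)"
    by (rule sol_real[where f' = "\<lambda>_. 0"]) auto
  then show D: "(\<lambda>_. 1) \<in> D_max a" using D_max_iff_sol by auto
  show "b_left a (\<lambda>_. 1) = 0" "c_left a (\<lambda>_. 1) = -1" "b_right a (\<lambda>_. 1) = 0" "c_right a (\<lambda>_. 1) = -1"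
    using boundary_real[of "\<lambda>_. 1" "\<lambda>_. 0"] D by force+
qed

lemma boundary_id:
  "of_real \<in> D_max a" "b_left a of_real = 0" "c_left a of_real = of_real a" "b_right a of_real = 0" "c_right a of_real = - of_real a"
proof -
  have "sol (\<lambda>t. of_real t) (\<lambda>t. of_real (p t)) (\<lambda>t. of_real (2 * t / a\<^sup>2))"
  proof (rule sol_real[where f' = "\<lambda>_. 1"])
    show "(p has_real_derivative - (2 * t / a\<^sup>2)) (at t)" for t
      using DERIV_diff[OF DERIV_const[of 1] DERIV_cdivide[OF DERIV_pow[of 2 t UNIV], of "a\<^sup>2"]]
      by (simp add: p_def[abs_def])
  qed (use a_pos in \<open>auto intro!: continuous_intros\<close>)
  then show D: "of_real \<in> D_max a" using D_max_iff_sol by auto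
  note br = boundary_real[of "\<lambda>t. t" "\<lambda>_. 1", OF D DERIV_ident]
  have "((\<lambda>t. (t + a) * 1) \<longlongrightarrow> ((-a) + a) * 1) (at_right (-a))" by (intro tendsto_intros)
  then show "b_left a of_real = 0" using br(1)[of 0] by simp
  have "((\<lambda>t. (t - a) * 1) \<longlongrightarrow> (a - a) * 1) (at_left a)" by (intro tendsto_intros)
  then show "b_right a of_real = 0" using br(3)[of 0] by simp
  have "((\<lambda>t. (t + a) * ln (a + t) - t) \<longlongrightarrow> 0 - (-a)) (at_right (-a))" by (intro tendsto_diff tendsto_id_ln tendsto_ident_at)
  then show "c_left a of_real = of_real a" using br(2)[of a] by simp
  have "((\<lambda>t. (t - a) * ln (a - t) - t) \<longlongrightarrow> 0 - a) (at_left a)" by (intro tendsto_diff tendsto_id_ln tendsto_ident_at)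
  then show "c_right a of_real = - of_real a" using br(4)[of "-a"] by simp
qed

lemma sol_ln:
  "sol (\<lambda>t. of_real (ln (a + t))) (\<lambda>t. of_real ((a - t) / a\<^sup>2)) (\<lambda>t. of_real (1 / a\<^sup>2))"
  "sol (\<lambda>t. of_real (ln (a - t))) (\<lambda>t. of_real (- ((a + t) / a\<^sup>2))) (\<lambda>t. of_real (1 / a\<^sup>2))"
proof -
  show "sol (\<lambda>t. of_real (ln (a + t))) (\<lambda>t. of_real ((a - t) / a\<^sup>2)) (\<lambda>t. of_real (1 / a\<^sup>2))"
  proof (rule sol_real[where f' = "\<lambda>t. 1 / (a + t)"])
    show "((\<lambda>t. ln (a + t)) has_real_derivative 1 / (a + t)) (at t)" if "t \<in> {-a<..<a}" for t
      using that by (auto intro!: derivative_eq_intros)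
    show "p t * (1 / (a + t)) = (a - t) / a\<^sup>2" if "t \<in> {-a<..<a}" for t
      using that by (simp add: p_factor)
    show "((\<lambda>t. (a - t) / a\<^sup>2) has_real_derivative - (1 / a\<^sup>2)) (at t)" for t
      using DERIV_cdivide[OF DERIV_diff[OF DERIV_const[of a] DERIV_ident], of "a\<^sup>2" t UNIV] by simp
  qed auto
  show "sol (\<lambda>t. of_real (ln (a - t))) (\<lambda>t. of_real (- ((a + t) / a\<^sup>2))) (\<lambda>t. of_real (1 / a\<^sup>2))"
  proof (rule sol_real[where f' = "\<lambda>t. - 1 / (a - t)"])
    show "((\<lambda>t. ln (a - t)) has_real_derivative - 1 / (a - t)) (at t)" if "t \<in> {-a<..<a}" for t
      using that by (auto intro!: derivative_eq_intros)
    show "p t * (- 1 / (a - t)) = - ((a + t) / a\<^sup>2)" if "t \<in> {-a<..<a}" for t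
      using that by (simp add: p_factor)
    show "((\<lambda>t. - ((a + t) / a\<^sup>2)) has_real_derivative - (1 / a\<^sup>2)) (at t)" for t
      using DERIV_minus[OF DERIV_cdivide[OF DERIV_add[OF DERIV_const[of a] DERIV_ident], of "a\<^sup>2" t UNIV]] by simp
  qed auto
qed

lemma boundary_ln_plus:
  defines "x \<equiv> \<lambda>t. complex_of_real (ln (a + t))"
  shows "x \<in> D_max a" "b_left a x = 1" "c_left a x = 0" "b_right a x = 0" "c_right a x = - of_real (ln (2 * a))"
proof -
  show D: "x \<in> D_max a" unfolding x_def using sol_ln(1) D_max_iff_sol by blast
  have "((\<lambda>t. ln (a + t)) has_real_derivative 1 / (a + t)) (at t)" if "t \<in> {-a<..<a}" for t
    using that by (auto intro!: derivative_eq_intros)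
  note br = boundary_real[of "\<lambda>t. ln (a + t)" "\<lambda>t. 1 / (a + t)", OF D[unfolded x_def] this, folded x_def]
  have "((\<lambda>t. (t + a) * (1 / (a + t))) \<longlongrightarrow> 1) (at_right (-a))"
    by (rule tendsto_eventually, rule eventually_mono[OF eventually_ends(1)]) auto
  then show "b_left a x = 1" using br(1)[of 1] by simp
  have "((\<lambda>t. (t + a) * ln (a + t) * (1 / (a + t)) - ln (a + t)) \<longlongrightarrow> 0) (at_right (-a))"
    by (rule tendsto_eventually, rule eventually_mono[OF eventually_ends(1)]) (auto simp: add.commute[of _ a])
  then show "c_left a x = 0" using br(2)[of 0] by simp
  have r: "((\<lambda>t. 1 / (a + t)) \<longlongrightarrow> 1 / (a + a)) (at_left a)"
    by (intro tendsto_intros) (use a_pos in auto)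
  have "((\<lambda>t. (t - a) * (1 / (a + t))) \<longlongrightarrow> (a - a) * (1 / (a + a))) (at_left a)"
    by (intro tendsto_mult r tendsto_diff tendsto_const tendsto_ident_at)
  then show "b_right a x = 0" using br(3)[of 0] by simp
  have "((\<lambda>t. (t - a) * ln (a - t) * (1 / (a + t)) - ln (a + t)) \<longlongrightarrow> 0 * (1 / (a + a)) - ln (a + a)) (at_left a)"
    by (intro tendsto_diff tendsto_mult[OF tendsto_id_ln(2) r] tendsto_intros) (use a_pos in auto)
  then show "c_right a x = - of_real (ln (2 * a))" using br(4)[of "- ln (2 * a)"] by simp
qed

lemma boundary_ln_minus:
  defines "x \<equiv> \<lambda>t. complex_of_real (ln (a - t))"
  shows "x \<in> D_max a" "b_left a x = 0" "c_left a x = - of_real (ln (2 * a))" "b_right a x = 1" "c_right a x = 0"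
proof -
  show D: "x \<in> D_max a" unfolding x_def using sol_ln(2) D_max_iff_sol by blast
  have "((\<lambda>t. ln (a - t)) has_real_derivative - 1 / (a - t)) (at t)" if "t \<in> {-a<..<a}" for t
    using that by (auto intro!: derivative_eq_intros)
  note br = boundary_real[of "\<lambda>t. ln (a - t)" "\<lambda>t. - 1 / (a - t)", OF D[unfolded x_def] this, folded x_def]
  have "((\<lambda>t. (t - a) * (- 1 / (a - t))) \<longlongrightarrow> 1) (at_left a)"
    by (rule tendsto_eventually, rule eventually_mono[OF eventually_ends(2)]) (auto simp: field_simps)
  then show "b_right a x = 1" using br(3)[of 1] by simp
  have "((\<lambda>t. (t - a) * ln (a - t) * (- 1 / (a - t)) - ln (a - t)) \<longlongrightarrow> 0) (at_left a)"
    by (rule tendsto_eventually, rule eventually_mono[OF eventually_ends(2)]) (auto simp: field_simps)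
  then show "c_right a x = 0" using br(4)[of 0] by simp
  have r: "((\<lambda>t. - 1 / (a - t)) \<longlongrightarrow> - 1 / (a - (-a))) (at_right (-a))"
    by (intro tendsto_intros) (use a_pos in auto)
  have "((\<lambda>t. (t + a) * (- 1 / (a - t))) \<longlongrightarrow> ((-a) + a) * (- 1 / (a - (-a)))) (at_right (-a))"
    by (intro tendsto_mult r tendsto_add tendsto_const tendsto_ident_at)
  then show "b_left a x = 0" using br(1)[of 0] by simp
  have "((\<lambda>t. (t + a) * ln (a + t) * (- 1 / (a - t)) - ln (a - t)) \<longlongrightarrow> 0 * (- 1 / (a - (-a))) - ln (a - (-a))) (at_right (-a))"
    by (intro tendsto_diff tendsto_mult[OF tendsto_id_ln(1) r] tendsto_intros) (use a_pos in auto)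
  then show "c_left a x = - of_real (ln (2 * a))" using br(2)[of "- ln (2 * a)"] by simp
qed

text \<open>The two logarithms supply the \<open>b\<close> values, one at each end, and affine
  functions supply the \<open>c\<close> values. Each logarithm has the \<open>c\<close> value
  \<open>- ln (2 * a)\<close> at the opposite end, which the corrections in \<open>A\<close> and
  \<open>B\<close> compensate.\<close>

lemma boundary_surj:
  "\<exists>x\<in>D_max a. b_left a x = \<beta> \<and> c_left a x = \<gamma> \<and> b_right a x = \<beta>' \<and> c_right a x = \<gamma>'"
proof -
  define A where "A = \<gamma> + \<beta>' * of_real (ln (2 * a))"
  define B where "B = \<gamma>' + \<beta> * of_real (ln (2 * a))"
  let ?y = "\<lambda>t. \<beta> * complex_of_real (ln (a + t)) + \<beta>' * complex_of_real (ln (a - t))"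
  \<comment> \<open>The affine function with \<open>c\<close> values \<open>A\<close> at
    \<open>-a\<close> and \<open>B\<close> at \<open>a\<close>: the constant 1 has the values -1 and
    -1, the identity has \<open>a\<close> and \<open>- a\<close>.\<close>
  let ?z = "\<lambda>t. - ((A + B) / 2) * 1 + (A - B) / (2 * of_real a) * complex_of_real t"
  let ?x = "\<lambda>t. 1 * ?y t + 1 * ?z t"
  note ln = boundary_ln_plus boundary_ln_minus
  note pol = boundary_one boundary_id
  note y = D_max_lin[OF boundary_ln_plus(1) boundary_ln_minus(1), of \<beta> \<beta>']
  note z = D_max_lin[OF boundary_one(1) boundary_id(1), of "- ((A + B) / 2)" "(A - B) / (2 * of_real a)"]
  have a0: "complex_of_real a \<noteq> 0" using a_pos by simp
  show ?thesis
  proof (rule bexI[of _ ?x])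
    show "?x \<in> D_max a" by (rule D_max_lin[OF y z])
    show "b_left a ?x = \<beta> \<and> c_left a ?x = \<gamma> \<and> b_right a ?x = \<beta>' \<and> c_right a ?x = \<gamma>'"
      unfolding boundary_lin[OF y z]
        boundary_lin[OF boundary_ln_plus(1) boundary_ln_minus(1)]
        boundary_lin[OF boundary_one(1) boundary_id(1)] ln pol
      using a0 by (simp add: A_def B_def field_simps)
  qed
qed

text \<open>By continuity on the open interval a class contains at most one element of the maximal
  domain, up to values outside that interval.\<close>

lemma D_max_AE_eq:
  assumes x: "x \<in> D_max a" and y: "y \<in> D_max a" and ae: "AE t in L. x t = y t" and "t \<in> {-a<..<a}"
  shows "x t = y t"
proof -
  obtain N where N: "negligible N" "\<forall>t\<in>{-a..a} - N. x t = y t"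
    using ae by (subst (asm) AE_lebesgue_on_iff_negligible) auto
  show ?thesis
  proof (rule continuous_AE_eq[OF _ _ _ N(1)])
    show "continuous_on {-a<..<a} x" by (rule sol_continuous[OF D_max_imp_sol[OF x]])
    show "continuous_on {-a<..<a} y" by (rule sol_continuous[OF D_max_imp_sol[OF y]])
  qed (use N(2) \<open>t \<in> _\<close> in auto)
qed

lemma boundary_cong:
  assumes x: "x \<in> D_max a" and y: "y \<in> D_max a" and eq: "\<And>t. t \<in> {-a<..<a} \<Longrightarrow> x t = y t"
  shows "b_left a x = b_left a y" "c_left a x = c_left a y" "b_right a x = b_right a y" "c_right a x = c_right a y"
    "AE t in L. legendre_expr a x t = legendre_expr a y t"
proof -
  have d: "vector_derivative x (at t) = vector_derivative y (at t)" if "t \<in> {-a<..<a}" for t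
    using sol_vector_derivative[OF sol_cong[OF D_max_imp_sol[OF y] eq] that]
      sol_vector_derivative[OF D_max_imp_sol[OF y] that] by simp
  have A: "((\<lambda>t. A t * vector_derivative y (at t)) \<longlongrightarrow> l) F"
    if "((\<lambda>t. A t * vector_derivative x (at t)) \<longlongrightarrow> l) F" "eventually (\<lambda>t. t \<in> {-a<..<a}) F" for A l F
    by (rule Lim_transform_eventually[OF that(1) eventually_mono[OF that(2)]]) (simp add: d)
  have B: "((\<lambda>t. A t * vector_derivative y (at t) - y t) \<longlongrightarrow> l) F"
    if "((\<lambda>t. A t * vector_derivative x (at t) - x t) \<longlongrightarrow> l) F" "eventually (\<lambda>t. t \<in> {-a<..<a}) F" for A l F
    by (rule Lim_transform_eventually[OF that(1) eventually_mono[OF that(2)]]) (simp add: d eq)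
  show "b_left a x = b_left a y"
    by (rule tendsto_unique[OF _ A[OF D_max_tendsto(1)[OF x] eventually_ends(1)] D_max_tendsto(1)[OF y]]) simp
  show "c_left a x = c_left a y"
    by (rule tendsto_unique[OF _ B[OF D_max_tendsto(2)[OF x] eventually_ends(1)] D_max_tendsto(2)[OF y]]) simp
  show "b_right a x = b_right a y"
    by (rule tendsto_unique[OF _ A[OF D_max_tendsto(3)[OF x] eventually_ends(2)] D_max_tendsto(3)[OF y]]) simp
  show "c_right a x = c_right a y"
    by (rule tendsto_unique[OF _ B[OF D_max_tendsto(4)[OF x] eventually_ends(2)] D_max_tendsto(4)[OF y]]) simp
  have "sol x (\<lambda>t. of_real (p t) * vector_derivative y (at t)) (legendre_expr a y)"
    using D_max_imp_sol[OF y] eq by (rule sol_cong)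
  from sol_legendre_expr[OF this] show "AE t in L. legendre_expr a x t = legendre_expr a y t"
    by (rule AE_symmetric)
qed

end

section \<open>The adjoint of the compactly supported operator\<close>

text \<open>A compact subset of the open interval keeps a positive distance from both ends;
  \<open>k\<close> is the largest modulus occurring in it.\<close>

lemma compact_support_vanishing:
  assumes "compact (interval_support a x)" "a > 0"
  obtains k where "0 \<le> k" "k < a" "\<And>t. k < \<bar>t\<bar> \<Longrightarrow> \<bar>t\<bar> < a \<Longrightarrow> x t = 0"
proof -
  let ?K = "interval_support a x"
  \<comment> \<open>Inserting 0 makes the maximum exist even for empty support.\<close>
  have "compact (insert 0 ?K)" using assms(1) by (rule compact_insert)
  then have "\<exists>m\<in>insert 0 ?K. \<forall>t\<in>insert 0 ?K. \<bar>t\<bar> \<le> \<bar>m\<bar>"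
    by (rule continuous_attains_sup[OF _ _ continuous_on_rabs[OF continuous_on_id]]) auto
  then obtain m where m: "m \<in> insert 0 ?K" "\<forall>t\<in>insert 0 ?K. \<bar>t\<bar> \<le> \<bar>m\<bar>" ..
  show ?thesis
  proof (rule that)
    have "m = 0 \<or> m \<in> {-a<..<a}" using m(1) unfolding interval_support_def by blast
    then show "\<bar>m\<bar> < a" using assms(2) by (auto simp: abs_less_iff)
    fix t assume t: "\<bar>m\<bar> < \<bar>t\<bar>" "\<bar>t\<bar> < a"
    have "t \<notin> ?K"
    proof
      assume "t \<in> ?K"
      then have "\<bar>t\<bar> \<le> \<bar>m\<bar>" using m(2) by blast
      then show False using t by simp
    qed
    moreover have tI: "t \<in> {-a<..<a}" using t(2) by (simp add: abs_less_iff)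
    ultimately have "t \<notin> closure {t \<in> {-a<..<a}. x t \<noteq> 0}" unfolding interval_support_def by blast
    then have "t \<notin> {t \<in> {-a<..<a}. x t \<noteq> 0}" by (rule contra_subsetD[OF closure_subset])
    then show "x t = 0" using tI by blast
  qed simp
qed

lemma interval_support_compactI:
  assumes "k < a" "\<And>t. k < \<bar>t\<bar> \<Longrightarrow> \<bar>t\<bar> < a \<Longrightarrow> x t = 0"
  shows "compact (interval_support a x)"
proof -
  have "{t \<in> {-a<..<a}. x t \<noteq> 0} \<subseteq> {-k..k}"
  proof
    fix t assume t: "t \<in> {t \<in> {-a<..<a}. x t \<noteq> 0}"
    then have "\<bar>t\<bar> < a" by (simp add: abs_less_iff)
    then have "\<not> k < \<bar>t\<bar>" using assms(2)[of t] t by blast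
    then show "t \<in> {-k..k}" by auto
  qed
  then have "closure {t \<in> {-a<..<a}. x t \<noteq> 0} \<subseteq> {-k..k}" by (rule closure_minimal) simp
  moreover from this have "interval_support a x = closure {t \<in> {-a<..<a}. x t \<noteq> 0}"
    unfolding interval_support_def using assms(1) by auto
  moreover have "compact ({-k..k} \<inter> closure {t \<in> {-a<..<a}. x t \<noteq> 0})"
    by (rule compact_Int_closed) auto
  ultimately show ?thesis by (simp only: inf.absorb2)
qed

context legendre
begin

text \<open>The primitive of \<open>z\<close> is continuous, so its quotient by \<open>p\<close> is
  continuous on the open interval and has an antiderivative there, although \<open>p\<close>
  vanishes at the ends.\<close>

lemma sol_exists:
  assumes z: "z \<in> L2 L"
  shows "\<exists>y. sol y (\<lambda>t. - integral {-a..t} z) z"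
proof -
  let ?\<psi> = "\<lambda>t. - integral {-a..t} z"
  have int: "z integrable_on {-a..a}" using L2_integrable_on[OF z] by simp
  have "continuous_on {-a..a} ?\<psi>"
    by (intro continuous_on_minus indefinite_integral_continuous_1 int)
  then have c\<psi>: "continuous_on {-a<..<a} ?\<psi>" by (rule continuous_on_subset) auto
  have "continuous_on {-a<..<a} (\<lambda>t. ?\<psi> t / of_real (p t))"
  proof (intro continuous_on_divide c\<psi>)
    show "continuous_on {-a<..<a} (\<lambda>t. complex_of_real (p t))"
      unfolding p_def using a_pos by (intro continuous_intros) auto
    show "\<forall>t\<in>{-a<..<a}. complex_of_real (p t) \<noteq> 0" using p_pos by force
  qed
  then have "\<forall>t\<in>{-a<..<a}. isCont (\<lambda>t. ?\<psi> t / of_real (p t)) t"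
    by (simp only: continuous_on_eq_continuous_at[OF open_greaterThanLessThan])
  then have "\<exists>F. \<forall>t::real. ereal (-a) < ereal t \<longrightarrow> ereal t < ereal a \<longrightarrow>
      (F has_vector_derivative ?\<psi> t / of_real (p t)) (at t)"
    using a_pos by (intro einterval_antiderivative) auto
  then obtain y where y: "\<And>t. t \<in> {-a<..<a} \<Longrightarrow> (y has_vector_derivative ?\<psi> t / of_real (p t)) (at t)"
    by auto
  have "?\<psi> t - ?\<psi> s = - integral {s..t} z" if "-a < s" "s \<le> t" "t < a" for s t
  proof -
    have "integral {-a..s} z + integral {s..t} z = integral {-a..t} z"
      using that by (intro Henstock_Kurzweil_Integration.integral_combine integrable_on_subinterval[OF int]) auto
    then show ?thesis by (simp add: algebra_simps)
  qed
  then show ?thesis unfolding sol_def using z y by blast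
qed

lemma boundary_constant_left:
  assumes x: "x \<in> D_max a" and "k < a" and eq: "\<And>t. k < - t \<Longrightarrow> - t < a \<Longrightarrow> x t = c" and "0 \<le> k"
  shows "b_left a x = 0" "c_left a x = - c"
proof -
  have "- a < - k" using \<open>k < a\<close> by simp
  then have ev: "eventually (\<lambda>t. t \<in> {-a<..<-k}) (at_right (-a))" by (rule eventually_at_right_real)
  have d: "vector_derivative x (at t) = 0" if "t \<in> {-a<..<-k}" for t
  proof (rule vector_derivative_at, rule has_vector_derivative_transform_within_open)
    show "((\<lambda>_. c) has_vector_derivative 0) (at t)" by simp
  qed (use that eq in \<open>auto intro: open_greaterThanLessThan\<close>)
  show "b_left a x = 0"
    by (rule tendsto_unique[OF _ D_max_tendsto(1)[OF x] tendsto_eventually[OF eventually_mono[OF ev]]]) (simp_all add: d)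
  show "c_left a x = - c"
    by (rule tendsto_unique[OF _ D_max_tendsto(2)[OF x] tendsto_eventually[OF eventually_mono[OF ev]]]) (auto simp: d eq)
qed

text \<open>A constant other than zero is allowed because the solution in
  \<open>compact_solve\<close> is at first known only to be constant near \<open>a\<close>.\<close>

lemma boundary_constant_right:
  assumes x: "x \<in> D_max a" and "k < a" and eq: "\<And>t. k < t \<Longrightarrow> t < a \<Longrightarrow> x t = c" and "0 \<le> k"
  shows "b_right a x = 0" "c_right a x = - c"
proof -
  have ev: "eventually (\<lambda>t. t \<in> {k<..<a}) (at_left a)" using \<open>k < a\<close> by (rule eventually_at_left_real)
  have d: "vector_derivative x (at t) = 0" if "t \<in> {k<..<a}" for t
  proof (rule vector_derivative_at, rule has_vector_derivative_transform_within_open)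
    show "((\<lambda>_. c) has_vector_derivative 0) (at t)" by simp
  qed (use that eq in \<open>auto intro: open_greaterThanLessThan\<close>)
  show "b_right a x = 0"
    by (rule tendsto_unique[OF _ D_max_tendsto(3)[OF x] tendsto_eventually[OF eventually_mono[OF ev]]]) (simp_all add: d)
  show "c_right a x = - c"
    by (rule tendsto_unique[OF _ D_max_tendsto(4)[OF x] tendsto_eventually[OF eventually_mono[OF ev]]]) (auto simp: d eq)
qed

lemma boundary_compact_support:
  assumes "x \<in> D_max a" "compact (interval_support a x)"
  shows "b_left a x = 0" "c_left a x = 0" "b_right a x = 0" "c_right a x = 0"
proof -
  obtain k where k: "0 \<le> k" "k < a" "\<And>t. k < \<bar>t\<bar> \<Longrightarrow> \<bar>t\<bar> < a \<Longrightarrow> x t = 0"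
    using compact_support_vanishing[OF assms(2) a_pos] by blast
  have "x t = 0" if "k < - t" "- t < a" for t using k(1) k(3)[of t] that by auto
  from boundary_constant_left[OF assms(1) k(2) this k(1)]
  show "b_left a x = 0" "c_left a x = 0" by auto
  have "x t = 0" if "k < t" "t < a" for t using k(1) k(3)[of t] that by auto
  from boundary_constant_right[OF assms(1) k(2) this k(1)]
  show "b_right a x = 0" "c_right a x = 0" by auto
qed

text \<open>Twice the Legendre function of the second kind: with the constants it spans the kernel of the
  maximal operator.  It is written as a linear combination in the form required by \<open>sol_lin\<close> and
  \<open>boundary_lin\<close>.\<close>

definition Q :: "real \<Rightarrow> complex" where
  "Q t = 1 * of_real (ln (a + t)) + (-1) * of_real (ln (a - t))"

lemma Q_real: "cnj (Q t) = Q t"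
  by (simp add: Q_def)

lemma sol_Q: "sol Q (\<lambda>t. of_real (2 / a)) (\<lambda>_. 0)"
proof -
  have "(a - t) / a\<^sup>2 + (a + t) / a\<^sup>2 = 2 / a" for t
    using a_pos by (simp add: add_divide_distrib[symmetric] power2_eq_square)
  then have "(\<lambda>t. 1 * complex_of_real ((a - t) / a\<^sup>2) + (-1) * complex_of_real (- ((a + t) / a\<^sup>2))) =
      (\<lambda>t. of_real (2 / a))"
    by (simp only: of_real_minus minus_mult_minus mult_1 of_real_add[symmetric])
  moreover have "(\<lambda>t. 1 * complex_of_real (1 / a\<^sup>2) + (-1) * complex_of_real (1 / a\<^sup>2)) = (\<lambda>t::real. 0)"
    by simp
  ultimately show ?thesis
    using sol_lin[OF sol_ln, of 1 "-1"] unfolding Q_def[abs_def] by simp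
qed

lemma Q_D_max: "Q \<in> D_max a"
  using sol_Q D_max_iff_sol by blast

lemma Q_boundary: "b_right a Q = -1"
  using boundary_lin(3)[OF boundary_ln_plus(1) boundary_ln_minus(1), of 1 "-1"]
  unfolding Q_def[abs_def] boundary_ln_plus boundary_ln_minus by simp

lemma Q_zero_iff: "t \<in> {-a<..<a} \<Longrightarrow> Q t = 0 \<longleftrightarrow> t = 0"
proof -
  assume t: "t \<in> {-a<..<a}"
  have "Q t = of_real (ln (a + t) - ln (a - t))" by (simp add: Q_def)
  then have "Q t = 0 \<longleftrightarrow> ln (a + t) = ln (a - t)" by (simp only: of_real_eq_0_iff) simp
  also have "\<dots> \<longleftrightarrow> a + t = a - t" using t by (intro ln_inj_iff) auto
  finally show ?thesis by auto
qed

text \<open>The solution is made to vanish to the left of \<open>-k\<close>. Orthogonality to 1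
  makes \<psi> vanish to the right of \<open>k\<close> as well, so \<open>x\<close> is constant
  there; orthogonality to \<open>Q\<close> makes this constant zero by Green's formula.\<close>

lemma compact_solve:
  assumes g: "g \<in> L2 L" and k: "0 < k" "k < a" and g0: "\<And>t. k \<le> \<bar>t\<bar> \<Longrightarrow> g t = 0"
    and orth1: "integral {-a..a} g = 0" and orthQ: "L2_inner L g Q = 0"
  obtains x where "x \<in> D_max a" "compact (interval_support a x)" "AE t in L. g t = legendre_expr a x t"
proof -
  define \<psi> where "\<psi> t = - integral {-a..t} g" for t
  obtain x1 where x1: "sol x1 \<psi> g" using sol_exists[OF g] unfolding \<psi>_def[abs_def] by blast
  define x where "x t = x1 t - x1 (-k)" for t
  have one: "sol (\<lambda>_. 1) (\<lambda>_. 0) (\<lambda>_. 0)"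
    unfolding sol_def by (simp add: L2_0)
  have x: "sol x \<psi> g"
    using sol_lin[OF x1 one, of 1 "- x1 (-k)"] by (simp add: x_def[abs_def])
  then have xD: "x \<in> D_max a" using D_max_iff_sol by blast
  have \<psi>_left: "\<psi> t = 0" if "t \<le> -k" for t
  proof -
    have "integral {-a..t} g = integral {-a..t} (\<lambda>_. 0)"
      by (rule integral_cong) (use that k in \<open>auto intro: g0\<close>)
    then show ?thesis by (simp add: \<psi>_def)
  qed
  have \<psi>_right: "\<psi> t = 0" if "k \<le> t" "t \<le> a" for t
  proof -
    have "integral {t..a} g = integral {t..a} (\<lambda>_. 0)"
      by (rule integral_cong) (use that k in \<open>auto intro: g0\<close>)
    moreover have "integral {-a..t} g + integral {t..a} g = integral {-a..a} g"
      using that k a_pos by (intro Henstock_Kurzweil_Integration.integral_combine L2_integrable_on[OF g]) auto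
    ultimately show ?thesis using orth1 by (simp add: \<psi>_def)
  qed
  have const: "x u = x v" if "-a < u" "u < v" "v < a" "\<And>t. u < t \<Longrightarrow> t < v \<Longrightarrow> \<psi> t = 0" for u v
  proof -
    have "cmod (x v - x u) \<le> (\<lambda>_. 0) v - (\<lambda>_. 0) u"
    proof (rule differentiable_bound_general[OF \<open>u < v\<close>])
      show "continuous_on {u..v} x"
        by (rule continuous_on_subset[OF sol_continuous[OF x]]) (use that in auto)
      show "(x has_vector_derivative 0) (at t)" if "u < t" "t < v" for t
        using solD(2)[OF x, of t] that \<open>-a < u\<close> \<open>v < a\<close> \<open>\<And>t. u < t \<Longrightarrow> t < v \<Longrightarrow> \<psi> t = 0\<close>[OF that] by simp
    qed (auto intro: has_vector_derivative_const)
    then show ?thesis by simp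
  qed
  have x_left: "x t = 0" if "k < - t" "- t < a" for t
    using const[of t "-k"] that k \<psi>_left by (simp add: x_def)
  have x_right: "x t = x k" if "k < t" "t < a" for t
    using const[of k t] that k \<psi>_right by simp
  have bl: "b_left a x = 0" "c_left a x = 0"
    using boundary_constant_left[OF xD k(2) x_left] k by auto
  have br: "b_right a x = 0" "c_right a x = - x k"
    using boundary_constant_right[OF xD k(2) x_right] k by auto
  have ae: "AE t in L. g t = legendre_expr a x t" by (rule sol_legendre_expr[OF x])
  have "L2_inner L (legendre_expr a x) Q = L2_inner L g Q"
    by (rule L2_inner_AE_cong[symmetric])
       (use ae g L2_measurable[OF sol_L2[OF sol_Q]] in \<open>auto intro: L2_measurable\<close>)
  moreover have "L2_inner L x (legendre_expr a Q) = L2_inner L x (\<lambda>_. 0)"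
    by (rule L2_inner_AE_cong[symmetric])
       (use sol_legendre_expr[OF sol_Q] L2_measurable[OF sol_L2[OF x]] in auto)
  \<comment> \<open>Of all boundary terms only \<open>c_right a x * cnj (b_right a Q)\<close>
    survives, and \<open>b_right a Q\<close> is not zero.\<close>
  ultimately have "- of_real (2 / a) * (x k * cnj (-1)) = (0 :: complex)"
    using green[OF xD Q_D_max] unfolding bl br Q_boundary orthQ by (simp add: L2_inner_def)
  then have "x k = 0" using a_pos by simp
  then have "x t = 0" if "k < \<bar>t\<bar>" "\<bar>t\<bar> < a" for t
    using x_left[of t] x_right[of t] that by (cases "t \<ge> 0") auto
  then have "compact (interval_support a x)" by (rule interval_support_compactI[OF k(2)])
  with xD ae show ?thesis using that by blast
qed

lemma integral_cut:
  assumes "0 < k" "k < a"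
  shows "integral {-a..a} (\<lambda>t. if \<bar>t\<bar> < k then h t else 0) = integral {-k..k} (h :: real \<Rightarrow> complex)"
proof -
  have "integral {-a..a} (\<lambda>t. if \<bar>t\<bar> < k then h t else 0) = integral {-a..a} (\<lambda>t. if t \<in> {-k..k} then h t else 0)"
    by (rule integral_spike[of "{-k, k}"]) (use assms in auto)
  also have "\<dots> = integral {-k..k} h"
    using assms Henstock_Kurzweil_Integration.integral_restrict_Int[of "{-a..a}" "{-k..k}" h] by simp
  finally show ?thesis .
qed

text \<open>On \<open>(-k, k)\<close> an element orthogonal to the range of the compactly supported operator is its own
  projection onto the span of \<open>1\<close> and \<open>Q\<close>, which are orthogonal to each other by parity.\<close>

lemma orthogonal_range_local:
  assumes u: "u \<in> L2 L" and k: "0 < k" "k < a"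
    and orth: "\<And>x. x \<in> D_max a \<Longrightarrow> compact (interval_support a x) \<Longrightarrow> L2_inner L (legendre_expr a x) u = 0"
  obtains \<alpha> \<beta> where "AE t in L. \<bar>t\<bar> < k \<longrightarrow> u t = \<alpha> + \<beta> * Q t"
proof -
  have sub: "{-k..k} \<subseteq> {-a<..<a}" using k by auto
  have Qc: "continuous_on {-k..k} Q" using sol_continuous[OF sol_Q] sub by (rule continuous_on_subset)
  have QL: "Q \<in> L2 L" by (rule sol_L2[OF sol_Q])
  have oneL: "(\<lambda>_. 1) \<in> L2 L" using boundary_one(1) by (simp add: D_max_def)
  have Qodd: "Q (- t) = - Q t" for t by (simp add: Q_def)
  have J0: "integral {-k..k} Q = 0"
  proof -
    have "integral {-k..k} Q = integral {-k..k} (\<lambda>t. Q (- t))"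
      using Henstock_Kurzweil_Integration.integral_reflect_real[where a = "-k" and b = k and f = Q] by simp
    also have "\<dots> = - integral {-k..k} Q" by (simp add: Qodd)
    finally have "2 * integral {-k..k} Q = 0" by (simp only: eq_neg_iff_add_eq_0 mult_2)
    then show ?thesis by simp
  qed
  define S where "S = integral {-k..k} (\<lambda>t. Q t * Q t)"
  \<comment> \<open>As \<open>Q\<close> is real, \<open>S\<close> is the squared norm of
    \<open>Q\<close> on \<open>{-k..k}\<close>; it is positive because 0 is the only zero of
    \<open>Q\<close>.\<close>
  have S0: "S \<noteq> 0"
  proof
    assume "S = 0"
    let ?q = "\<lambda>t. (cmod (Q t))\<^sup>2"
    have "Q t * Q t = complex_of_real (?q t)" for t
      using complex_norm_square[of "Q t"] by (simp add: Q_real)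
    then have "integral {-k..k} (\<lambda>t. complex_of_real (?q t)) = 0" using \<open>S = 0\<close> by (simp add: S_def)
    moreover have qi: "?q integrable_on {-k..k}"
      by (rule integrable_continuous_real) (intro continuous_intros Qc)
    have "integral {-k..k} (\<lambda>t. complex_of_real (?q t)) = complex_of_real (integral {-k..k} ?q)"
      using integral_linear[OF qi bounded_linear_of_real] by (simp only: o_def)
    ultimately have "integral {-k..k} ?q = 0" by simp
    moreover have "continuous_on {-k..k} ?q" by (intro continuous_intros Qc)
    ultimately have "\<forall>t\<in>{-k..k}. ?q t = 0"
      using integral_eq_0_iff[of "-k" k ?q] k by auto
    then have "Q (k / 2) = 0" using k by auto
    then show False using Q_zero_iff[of "k / 2"] k by auto
  qed
  have ui: "u integrable_on {-k..k}" using L2_integrable_on[OF u] k by simp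
  have Qi: "Q integrable_on {-k..k}" by (rule integrable_continuous_real[OF Qc])
  have uQ: "(\<lambda>t. u t * Q t) integrable_on {-k..k}"
  proof -
    have "integrable L (\<lambda>t. u t * Q t)" using L2_integrable_mult[OF u QL] by (simp only: Q_real)
    then have "(\<lambda>t. u t * Q t) integrable_on {-a..a}" by (rule integrable_on_lebesgue_on) simp
    then show ?thesis by (rule integrable_on_subinterval) (use k in auto)
  qed
  have QQ: "(\<lambda>t. Q t * Q t) integrable_on {-k..k}"
    by (rule integrable_continuous_real) (intro continuous_intros Qc)
  \<comment> \<open>Fourier coefficients of \<open>u\<close> for the orthogonal functions 1 and
    \<open>Q\<close> on \<open>{-k..k}\<close>, whose squared norms are \<open>2 * k\<close> and
    \<open>S\<close>.\<close>
  define \<alpha> where "\<alpha> = integral {-k..k} u / of_real (2 * k)"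
  define \<beta> where "\<beta> = integral {-k..k} (\<lambda>t. u t * Q t) / S"
  define h where "h t = u t - (\<alpha> + \<beta> * Q t)" for t
  define g where "g t = (if \<bar>t\<bar> < k then h t else 0)" for t
  have hL: "h \<in> L2 L"
    unfolding h_def using L2_diff[OF u L2_add[OF L2_cmult[OF oneL, of \<alpha>] L2_cmult[OF QL, of \<beta>]]] by simp
  have gL: "g \<in> L2 L"
  proof -
    have "(\<lambda>t. indicator {-k<..<k} t * h t) \<in> L2 L"
    proof (rule L2_mult_bounded[OF hL])
      have "indicator {-k<..<k} \<in> borel_measurable lebesgue"
        by (rule borel_measurable_indicator) simp
      then show "indicator {-k<..<k} \<in> borel_measurable L"
        by (rule measurable_restrict_space1)
      show "cmod (indicator {-k<..<k} t) \<le> 1" for t by (simp add: indicator_def)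
    qed
    moreover have "(\<lambda>t. indicator {-k<..<k} t * h t) = g"
      by (rule ext) (auto simp: g_def indicator_def)
    ultimately show ?thesis by simp
  qed
  have g1: "integral {-a..a} g = 0"
  proof -
    have "((\<lambda>_. \<alpha>) has_integral of_real (2 * k) * \<alpha>) {-k..k}"
      using has_integral_const_real[of \<alpha> "-k" k] k by (simp add: scaleR_conv_of_real)
    then have "((\<lambda>t. u t - (\<alpha> + \<beta> * Q t)) has_integral
        (integral {-k..k} u - (of_real (2 * k) * \<alpha> + \<beta> * integral {-k..k} Q))) {-k..k}"
      by (intro has_integral_diff has_integral_add has_integral_mult_right integrable_integral ui Qi)
    then have "integral {-k..k} h = integral {-k..k} u - of_real (2 * k) * \<alpha>"
      unfolding h_def J0 using k by (simp add: integral_unique scaleR_conv_of_real)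
    also have "\<dots> = 0" using k by (simp add: \<alpha>_def)
    finally show ?thesis unfolding g_def integral_cut[OF k] .
  qed
  have gQ: "L2_inner L g Q = 0"
  proof -
    have "L2_inner L g Q = integral {-a..a} (\<lambda>t. g t * Q t)"
      unfolding L2_inner_def using L2_integrable_mult[OF gL QL]
      by (subst lebesgue_integral_eq_integral) (simp_all add: Q_real)
    also have "(\<lambda>t. g t * Q t) = (\<lambda>t. if \<bar>t\<bar> < k then h t * Q t else 0)"
      by (rule ext) (simp add: g_def)
    also have "integral {-a..a} \<dots> = integral {-k..k} (\<lambda>t. h t * Q t)" by (rule integral_cut[OF k])
    also have "(\<lambda>t. h t * Q t) = (\<lambda>t. u t * Q t - (\<alpha> * Q t + \<beta> * (Q t * Q t)))"
      by (rule ext) (simp add: h_def algebra_simps)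
    also have "integral {-k..k} \<dots> = integral {-k..k} (\<lambda>t. u t * Q t) - (\<alpha> * integral {-k..k} Q + \<beta> * S)"
      unfolding S_def
      by (intro integral_unique has_integral_diff has_integral_add has_integral_mult_right integrable_integral uQ Qi QQ)
    also have "\<dots> = 0" using S0 by (simp add: J0 \<beta>_def)
    finally show ?thesis .
  qed
  \<comment> \<open>The remainder \<open>g\<close> is orthogonal to 1 and \<open>Q\<close>, hence in
    the range of the compactly supported operator; the assumption on \<open>u\<close> then makes
    \<open>g\<close> orthogonal to \<open>u\<close>.\<close>
  obtain x where x: "x \<in> D_max a" "compact (interval_support a x)" "AE t in L. g t = legendre_expr a x t"
    using compact_solve[OF gL k _ g1 gQ] by (auto simp: g_def)
  have "L2_inner L g u = L2_inner L (legendre_expr a x) u"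
    by (rule L2_inner_AE_cong) (use x(3) u gL in \<open>auto intro: L2_measurable\<close>)
  then have gu: "L2_inner L g u = 0" using orth[OF x(1,2)] by simp
  have i1: "integrable L (\<lambda>t. g t * cnj (u t))" by (rule L2_integrable_mult[OF gL u])
  have i2: "integrable L (\<lambda>t. g t * cnj (Q t))" by (rule L2_integrable_mult[OF gL QL])
  have i3: "integrable L g" by (rule L2_imp_integrable[OF gL])
  have int_g: "integral\<^sup>L L g = 0"
    using g1 lebesgue_integral_eq_integral[OF i3] by simp
  \<comment> \<open>Where \<open>g\<close> is not cut off it equals
    \<open>u - (\<alpha> + \<beta> * Q)\<close>, so its squared norm is a combination of inner
    products already known to vanish.\<close>
  have "(\<lambda>t. complex_of_real ((cmod (g t))\<^sup>2)) = (\<lambda>t. g t * cnj (u t) - (cnj \<alpha> * g t + cnj \<beta> * (g t * cnj (Q t))))"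
  proof
    fix t
    show "complex_of_real ((cmod (g t))\<^sup>2) = g t * cnj (u t) - (cnj \<alpha> * g t + cnj \<beta> * (g t * cnj (Q t)))"
      unfolding complex_norm_square by (simp add: g_def h_def algebra_simps)
  qed
  then have "(\<integral>t. complex_of_real ((cmod (g t))\<^sup>2) \<partial>L) =
      (\<integral>t. g t * cnj (u t) \<partial>L) - (cnj \<alpha> * integral\<^sup>L L g + cnj \<beta> * (\<integral>t. g t * cnj (Q t) \<partial>L))"
    using i1 i2 i3 by simp
  also have "\<dots> = 0" using gu gQ int_g unfolding L2_inner_def by simp
  finally have "(\<integral>t. (cmod (g t))\<^sup>2 \<partial>L) = 0"
    by (simp only: integral_complex_of_real of_real_eq_0_iff)
  moreover have "integrable L (\<lambda>t. (cmod (g t))\<^sup>2)" using gL by (simp add: L2_def)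
  ultimately have "AE t in L. (cmod (g t))\<^sup>2 = 0"
    by (subst (asm) integral_nonneg_eq_0_iff_AE) auto
  then have "AE t in L. \<bar>t\<bar> < k \<longrightarrow> u t = \<alpha> + \<beta> * Q t"
    by eventually_elim (simp add: g_def h_def split: if_splits)
  then show ?thesis by (rule that)
qed

text \<open>On the window \<open>\<bar>t\<bar> < a / 2\<close> the functions 1 and \<open>Q\<close>
  are linearly independent, so the coefficients for every larger window are those for
  \<open>a / 2\<close>. Countably many windows then exhaust the open interval.\<close>

lemma orthogonal_range:
  assumes u: "u \<in> L2 L"
    and orth: "\<And>x. x \<in> D_max a \<Longrightarrow> compact (interval_support a x) \<Longrightarrow> L2_inner L (legendre_expr a x) u = 0"
  obtains \<alpha> \<beta> where "AE t in L. u t = \<alpha> + \<beta> * Q t"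
proof -
  have "\<exists>\<alpha> \<beta>. AE t in L. \<bar>t\<bar> < k \<longrightarrow> u t = \<alpha> + \<beta> * Q t" if "0 < k" "k < a" for k
    by (rule orthogonal_range_local[OF u that orth]) blast+
  then have "\<forall>k. \<exists>\<alpha> \<beta>. 0 < k \<longrightarrow> k < a \<longrightarrow> (AE t in L. \<bar>t\<bar> < k \<longrightarrow> u t = \<alpha> + \<beta> * Q t)" by blast
  then obtain \<alpha> \<beta> where
    "\<forall>k. 0 < k \<longrightarrow> k < a \<longrightarrow> (AE t in L. \<bar>t\<bar> < k \<longrightarrow> u t = \<alpha> k + \<beta> k * Q t)"
    unfolding choice_iff by blast
  then have ab: "AE t in L. \<bar>t\<bar> < k \<longrightarrow> u t = \<alpha> k + \<beta> k * Q t" if "0 < k" "k < a" for k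
    using that by blast
  let ?k0 = "a / 2"
  have k0: "0 < ?k0" "?k0 < a" using a_pos by auto
  have same: "\<alpha> k = \<alpha> ?k0 \<and> \<beta> k = \<beta> ?k0" if k: "?k0 \<le> k" "k < a" for k
  proof -
    have "0 < k" using k k0 by linarith
    have "AE t in L. \<bar>t\<bar> < ?k0 \<longrightarrow> \<alpha> k + \<beta> k * Q t = \<alpha> ?k0 + \<beta> ?k0 * Q t"
      using ab[OF \<open>0 < k\<close> k(2)] ab[OF k0]
    proof eventually_elim
      case (elim t)
      then show ?case using k(1) by auto
    qed
    then obtain N where N: "negligible N" "\<forall>t\<in>{-a..a} - N. \<bar>t\<bar> < ?k0 \<longrightarrow> \<alpha> k + \<beta> k * Q t = \<alpha> ?k0 + \<beta> ?k0 * Q t"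
      by (subst (asm) AE_lebesgue_on_iff_negligible) auto
    have Qc: "continuous_on {-?k0<..<?k0} Q"
      by (rule continuous_on_subset[OF sol_continuous[OF sol_Q]]) (use a_pos in auto)
    have eq: "\<alpha> k + \<beta> k * Q t = \<alpha> ?k0 + \<beta> ?k0 * Q t" if "t \<in> {-?k0<..<?k0}" for t
    proof (rule continuous_AE_eq[OF _ _ _ N(1) _ that])
      show "continuous_on {-?k0<..<?k0} (\<lambda>t. \<alpha> k + \<beta> k * Q t)" "continuous_on {-?k0<..<?k0} (\<lambda>t. \<alpha> ?k0 + \<beta> ?k0 * Q t)"
        by (intro continuous_intros Qc)+
      show "\<alpha> k + \<beta> k * Q t = \<alpha> ?k0 + \<beta> ?k0 * Q t" if "t \<in> {-?k0<..<?k0} - N" for t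
        using N(2) that a_pos by auto
    qed simp
    \<comment> \<open>\<open>Q\<close> vanishes at 0, which isolates the constant term; its nonzero
      value at \<open>a / 4\<close> then determines the other coefficient.\<close>
    have "\<alpha> k = \<alpha> ?k0" using eq[of 0] a_pos Q_zero_iff[of 0] by simp
    moreover have "Q (a / 4) \<noteq> 0" using Q_zero_iff[of "a / 4"] a_pos by simp
    ultimately show ?thesis using eq[of "a / 4"] a_pos by simp
  qed
  define k where "k n = a - ?k0 / (real n + 1)" for n :: nat
  have k: "?k0 \<le> k n" "k n < a" for n
  proof -
    have "?k0 / (real n + 1) \<le> ?k0 / 1" using a_pos by (intro divide_left_mono) auto
    then show "?k0 \<le> k n" by (simp add: k_def)
    show "k n < a" using a_pos by (simp add: k_def)
  qed
  have "AE t in L. \<bar>t\<bar> < k n \<longrightarrow> u t = \<alpha> ?k0 + \<beta> ?k0 * Q t" for n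
  proof -
    have "0 < k n" using k(1)[of n] k0 by linarith
    from ab[OF this k(2)] show ?thesis using same[OF k(1,2)[of n]] by (simp only:)
  qed
  then have "AE t in L. \<forall>n. \<bar>t\<bar> < k n \<longrightarrow> u t = \<alpha> ?k0 + \<beta> ?k0 * Q t"
    by (rule AE_all_countable[THEN iffD2, OF allI])
  then obtain N where N: "negligible N" "\<forall>t\<in>{-a..a} - N. \<forall>n. \<bar>t\<bar> < k n \<longrightarrow> u t = \<alpha> ?k0 + \<beta> ?k0 * Q t"
    by (subst (asm) AE_lebesgue_on_iff_negligible) auto
  have "u t = \<alpha> ?k0 + \<beta> ?k0 * Q t" if t: "t \<in> {-a..a} - (N \<union> {-a, a})" for t
  proof -
    have "\<bar>t\<bar> < a" using t by auto
    obtain n :: nat where "?k0 / (a - \<bar>t\<bar>) < real n" using reals_Archimedean2 by blast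
    then have "?k0 < (a - \<bar>t\<bar>) * real n" using \<open>\<bar>t\<bar> < a\<close> by (simp add: field_simps)
    also have "\<dots> \<le> (a - \<bar>t\<bar>) * (real n + 1)" using \<open>\<bar>t\<bar> < a\<close> by simp
    finally have "?k0 / (real n + 1) < a - \<bar>t\<bar>" by (subst pos_divide_less_eq) auto
    then have "\<bar>t\<bar> < k n" by (simp add: k_def)
    then show ?thesis using N(2) t by blast
  qed
  moreover have "negligible (N \<union> {-a, a})" using N(1) by simp
  ultimately have "\<exists>N. negligible N \<and> (\<forall>t\<in>{-a..a} - N. u t = \<alpha> ?k0 + \<beta> ?k0 * Q t)" by blast
  then have "AE t in L. u t = \<alpha> ?k0 + \<beta> ?k0 * Q t"
    by (subst AE_lebesgue_on_iff_negligible) auto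
  then show ?thesis by (rule that)
qed

text \<open>Against compactly supported \<open>x\<close> Green's formula has no boundary terms, so
  \<open>y - y1\<close> is orthogonal to the range. Adding the resulting kernel element to
  \<open>y1\<close> leaves the image \<open>z\<close> unchanged and produces the representative of
  \<open>y\<close> in the maximal domain.\<close>

lemma adjoint_compact_support:
  assumes y: "y \<in> L2 L" and z: "z \<in> L2 L"
    and adj: "\<And>x. x \<in> D_max a \<Longrightarrow> compact (interval_support a x) \<Longrightarrow>
      L2_inner L (legendre_expr a x) y = L2_inner L x z"
  obtains y0 where "y0 \<in> D_max a" "AE t in L. y t = y0 t" "AE t in L. z t = legendre_expr a y0 t"
proof -
  obtain y1 where y1: "sol y1 (\<lambda>t. - integral {-a..t} z) z" using sol_exists[OF z] by blast
  then have y1D: "y1 \<in> D_max a" using D_max_iff_sol by blast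
  have y1L: "y1 \<in> L2 L" by (rule sol_L2[OF y1])
  define u where "u t = y t - y1 t" for t
  have uL: "u \<in> L2 L" unfolding u_def by (rule L2_diff[OF y y1L])
  obtain \<alpha> \<beta> where ab: "AE t in L. u t = \<alpha> + \<beta> * Q t"
  proof (rule orthogonal_range[OF uL])
    fix x assume x: "x \<in> D_max a" "compact (interval_support a x)"
    then have xL: "x \<in> L2 L" "legendre_expr a x \<in> L2 L" by (auto simp: D_max_def)
    have "L2_inner L (legendre_expr a x) y1 = L2_inner L x (legendre_expr a y1)"
      using green[OF x(1) y1D] unfolding boundary_compact_support[OF x] by simp
    also have "\<dots> = L2_inner L x z"
      by (rule L2_inner_AE_cong[symmetric])
         (use xL z sol_legendre_expr[OF y1] in \<open>auto intro: L2_measurable\<close>)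
    also have "\<dots> = L2_inner L (legendre_expr a x) y" using adj[OF x] by simp
    finally have "L2_inner L (legendre_expr a x) y - L2_inner L (legendre_expr a x) y1 = 0" by simp
    then show "L2_inner L (legendre_expr a x) u = 0"
      using L2_integrable_mult[OF xL(2) y] L2_integrable_mult[OF xL(2) y1L]
      unfolding L2_inner_def u_def by (simp add: right_diff_distrib)
  qed
  have one: "sol (\<lambda>_. 1) (\<lambda>_. 0) (\<lambda>_. 0)"
    unfolding sol_def by (simp add: L2_0)
  define y0 where "y0 t = 1 * y1 t + 1 * (\<alpha> * 1 + \<beta> * Q t)" for t
  have "sol y0 (\<lambda>t. 1 * (- integral {-a..t} z) + 1 * (\<alpha> * 0 + \<beta> * of_real (2 / a))) (\<lambda>t. 1 * z t + 1 * (\<alpha> * 0 + \<beta> * 0))"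
    unfolding y0_def[abs_def] by (rule sol_lin[OF y1 sol_lin[OF one sol_Q]])
  then have s: "sol y0 (\<lambda>t. 1 * (- integral {-a..t} z) + 1 * (\<alpha> * 0 + \<beta> * of_real (2 / a))) z" by simp
  show ?thesis
  proof (rule that)
    show "y0 \<in> D_max a" using s D_max_iff_sol by blast
    show "AE t in L. z t = legendre_expr a y0 t" by (rule sol_legendre_expr[OF s])
    show "AE t in L. y t = y0 t"
      using ab by eventually_elim (simp add: u_def y0_def algebra_simps)
  qed
qed

end

section \<open>Density of functions with vanishing boundary values\<close>

lemma real_polynomial_function_mult:
  "real_polynomial_function f \<Longrightarrow> real_polynomial_function g \<Longrightarrow> real_polynomial_function (\<lambda>t. f t * g t)"
  by (rule real_polynomial_function.intros)

context legendre
begin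

lemma finite_L: "finite_measure L"
  by (rule finite_measure_lebesgue_on) simp

text \<open>Measurability supplies continuous functions converging almost everywhere; retracting
  their values to the disc of radius \<open>B\<close> makes dominated convergence
  applicable.\<close>

lemma bounded_approx_continuous:
  assumes h: "h \<in> borel_measurable L" and B: "B > 0" "\<And>t. t \<in> {-a..a} \<Longrightarrow> cmod (h t) \<le> B" and "\<eta> > 0"
  obtains k where "continuous_on UNIV k" "integrable L (\<lambda>t. (cmod (h t - k t))\<^sup>2)" "(\<integral>t. (cmod (h t - k t))\<^sup>2 \<partial>L) < \<eta>"
proof -
  have "h measurable_on {-a..a}" using h by (simp add: measurable_on_iff_borel_measurable)
  then obtain N k where N: "negligible N" and k: "\<And>n. continuous_on UNIV (k n)"
    and lim: "\<And>x. x \<notin> N \<Longrightarrow> (\<lambda>n. k n x) \<longlonglongrightarrow> (if x \<in> {-a..a} then h x else 0)"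
    unfolding measurable_on_def by blast
  \<comment> \<open>The radial retraction onto the disc of radius \<open>B\<close>; it fixes the
    values of \<open>h\<close> on the interval.\<close>
  define c where "c z = z * complex_of_real (B / max B (cmod z))" for z
  have maxB: "max B r > 0" for r using B(1) by (simp add: max_def)
  have c_cont: "continuous_on UNIV c"
    unfolding c_def using B(1) by (intro continuous_intros) (auto simp: max_def split: if_splits)
  have c_bound: "cmod (c z) \<le> B" for z
  proof -
    have "cmod (c z) = cmod z * (B / max B (cmod z))"
      using B(1) maxB[of "cmod z"] by (simp only: c_def norm_mult norm_of_real) (simp add: abs_of_pos)
    also have "\<dots> \<le> max B (cmod z) * (B / max B (cmod z))"
      using B(1) maxB[of "cmod z"] by (intro mult_right_mono divide_nonneg_nonneg) auto
    also have "\<dots> = B" using maxB[of "cmod z"] by simp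
    finally show ?thesis .
  qed
  have c_id: "c z = z" if "cmod z \<le> B" for z
    using that B(1) by (simp add: c_def max_absorb1)
  have ck: "continuous_on UNIV (\<lambda>t. c (k n t))" for n
    by (rule continuous_on_compose2[OF c_cont k]) auto
  have ckm: "(\<lambda>t. c (k n t)) \<in> borel_measurable L" for n
    by (rule continuous_imp_measurable_on_sets_lebesgue[OF continuous_on_subset[OF ck]]) auto
  have meas: "(\<lambda>t. (cmod (h t - c (k n t)))\<^sup>2) \<in> borel_measurable L" for n
    using h ckm[of n] by measurable
  have bound: "(cmod (h t - c (k n t)))\<^sup>2 \<le> (2 * B)\<^sup>2" if "t \<in> {-a..a}" for t n
  proof (rule power_mono)
    show "cmod (h t - c (k n t)) \<le> 2 * B"
      using norm_triangle_ineq4[of "h t" "c (k n t)"] B(2)[OF that] c_bound[of "k n t"] by linarith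
  qed simp
  have constI: "integrable L (\<lambda>_. (2 * B)\<^sup>2)" by (rule finite_measure.integrable_const[OF finite_L])
  have "(\<lambda>n. \<integral>t. (cmod (h t - c (k n t)))\<^sup>2 \<partial>L) \<longlonglongrightarrow> (\<integral>t. 0 \<partial>L)"
  proof (rule integral_dominated_convergence[OF _ meas constI])
    show "AE t in L. (\<lambda>n. (cmod (h t - c (k n t)))\<^sup>2) \<longlonglongrightarrow> 0"
    proof (subst AE_lebesgue_on_iff_negligible)
      have "(\<lambda>n. (cmod (h t - c (k n t)))\<^sup>2) \<longlonglongrightarrow> 0" if t: "t \<in> {-a..a} - N" for t
      proof -
        have "(\<lambda>n. k n t) \<longlonglongrightarrow> h t" using lim[of t] t by simp
        moreover have "isCont c (h t)" using c_cont by (simp add: continuous_on_eq_continuous_at)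
        ultimately have "(\<lambda>n. c (k n t)) \<longlonglongrightarrow> c (h t)" by (rule isCont_tendsto_compose[rotated])
        then have "(\<lambda>n. c (k n t)) \<longlonglongrightarrow> h t" using c_id B(2) t by simp
        then have "(\<lambda>n. (cmod (h t - c (k n t)))\<^sup>2) \<longlonglongrightarrow> (cmod (h t - h t))\<^sup>2" by (intro tendsto_intros)
        then show ?thesis by simp
      qed
      with N show "\<exists>N. negligible N \<and> (\<forall>t\<in>{-a..a} - N. (\<lambda>n. (cmod (h t - c (k n t)))\<^sup>2) \<longlonglongrightarrow> 0)" by blast
    qed simp
    show "AE t in L. norm ((cmod (h t - c (k n t)))\<^sup>2) \<le> (2 * B)\<^sup>2" for n
      by (rule AE_I2) (use bound in simp)
  qed simp
  then have "eventually (\<lambda>n. (\<integral>t. (cmod (h t - c (k n t)))\<^sup>2 \<partial>L) < \<eta>) sequentially"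
    using \<open>\<eta> > 0\<close> by (intro order_tendstoD(2)) auto
  then obtain n where n: "(\<integral>t. (cmod (h t - c (k n t)))\<^sup>2 \<partial>L) < \<eta>" by (auto simp: eventually_sequentially)
  have "integrable L (\<lambda>t. (cmod (h t - c (k n t)))\<^sup>2)"
    by (rule Bochner_Integration.integrable_bound[OF constI meas])
       (rule AE_I2, use bound in simp)
  with ck n show ?thesis using that by blast
qed

lemma bounded_approx_polynomial:
  assumes h: "h \<in> borel_measurable L" and B: "B > 0" "\<And>t. t \<in> {-a..a} \<Longrightarrow> cmod (h t) \<le> B" and "\<eta> > 0"
  obtains q r :: "real \<Rightarrow> real" where "real_polynomial_function q" "real_polynomial_function r"
    "integrable L (\<lambda>t. (cmod (h t - Complex (q t) (r t)))\<^sup>2)" "(\<integral>t. (cmod (h t - Complex (q t) (r t)))\<^sup>2 \<partial>L) < \<eta>"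
proof -
  have "\<eta> / 4 > 0" using \<open>\<eta> > 0\<close> by simp
  obtain k where k: "continuous_on UNIV k" "integrable L (\<lambda>t. (cmod (h t - k t))\<^sup>2)"
    "(\<integral>t. (cmod (h t - k t))\<^sup>2 \<partial>L) < \<eta> / 4"
    by (rule bounded_approx_continuous[OF h B \<open>\<eta> / 4 > 0\<close>])
  \<comment> \<open>Integrating \<open>4 * \<delta>\<^sup>2\<close> over length \<open>2 * a\<close>
    gives \<eta> / 2; twice the error \<eta> / 4 of \<open>k\<close> is the other half.\<close>
  define \<delta> where "\<delta> = sqrt (\<eta> / (16 * a))"
  have \<delta>: "\<delta> > 0" "\<delta>\<^sup>2 = \<eta> / (16 * a)" using \<open>\<eta> > 0\<close> a_pos by (auto simp: \<delta>_def)
  have kc: "continuous_on {-a..a} (\<lambda>t. Re (k t))" "continuous_on {-a..a} (\<lambda>t. Im (k t))"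
    using continuous_on_subset[OF k(1), of "{-a..a}"] by (auto intro!: continuous_intros)
  obtain q where q: "real_polynomial_function q" "\<And>t. t \<in> {-a..a} \<Longrightarrow> \<bar>Re (k t) - q t\<bar> < \<delta>"
    using Stone_Weierstrass_real_polynomial_function[OF _ kc(1) \<delta>(1)] by blast
  obtain r where r: "real_polynomial_function r" "\<And>t. t \<in> {-a..a} \<Longrightarrow> \<bar>Im (k t) - r t\<bar> < \<delta>"
    using Stone_Weierstrass_real_polynomial_function[OF _ kc(2) \<delta>(1)] by blast
  have qc: "continuous_on UNIV q" "continuous_on UNIV r"
    using q(1) r(1) by (auto intro: continuous_on_polymonial_function simp: real_polynomial_function_eq)
  have pm: "(\<lambda>t. Complex (q t) (r t)) \<in> borel_measurable L"
    by (rule continuous_imp_measurable_on_sets_lebesgue[OF continuous_on_subset[of UNIV]])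
       (auto intro!: continuous_intros qc simp: Complex_eq)
  have le: "(cmod (h t - Complex (q t) (r t)))\<^sup>2 \<le> 2 * (cmod (h t - k t))\<^sup>2 + 4 * \<delta>\<^sup>2" if t: "t \<in> {-a..a}" for t
  proof -
    let ?u = "h t - k t" and ?v = "k t - Complex (q t) (r t)"
    have "(cmod ?v)\<^sup>2 = \<bar>Re (k t) - q t\<bar>\<^sup>2 + \<bar>Im (k t) - r t\<bar>\<^sup>2" by (simp add: cmod_power2)
    also have "\<dots> \<le> \<delta>\<^sup>2 + \<delta>\<^sup>2"
      using q(2)[OF t] r(2)[OF t] by (intro add_mono power_mono) auto
    finally have v: "(cmod ?v)\<^sup>2 \<le> 2 * \<delta>\<^sup>2" by simp
    have "(cmod (?u + ?v))\<^sup>2 \<le> (cmod ?u + cmod ?v)\<^sup>2" by (intro power_mono norm_triangle_ineq) simp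
    also have "\<dots> \<le> (cmod ?u + cmod ?v)\<^sup>2 + (cmod ?u - cmod ?v)\<^sup>2" by simp
    also have "\<dots> = 2 * (cmod ?u)\<^sup>2 + 2 * (cmod ?v)\<^sup>2" by (simp add: power2_eq_square algebra_simps)
    finally show ?thesis using v by simp
  qed
  have constI: "integrable L (\<lambda>_. 4 * \<delta>\<^sup>2)" by (rule finite_measure.integrable_const[OF finite_L])
  have sumI: "integrable L (\<lambda>t. 2 * (cmod (h t - k t))\<^sup>2 + 4 * \<delta>\<^sup>2)"
    by (intro Bochner_Integration.integrable_add integrable_mult_right k(2) constI)
  have polyI: "integrable L (\<lambda>t. (cmod (h t - Complex (q t) (r t)))\<^sup>2)"
  proof (rule Bochner_Integration.integrable_bound[OF sumI])
    show "(\<lambda>t. (cmod (h t - Complex (q t) (r t)))\<^sup>2) \<in> borel_measurable L" using h pm by measurable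
    show "AE t in L. norm ((cmod (h t - Complex (q t) (r t)))\<^sup>2) \<le> norm (2 * (cmod (h t - k t))\<^sup>2 + 4 * \<delta>\<^sup>2)"
      by (rule AE_I2) (use le in \<open>auto intro: order_trans[OF _ abs_ge_self]\<close>)
  qed
  have "(\<integral>t. (cmod (h t - Complex (q t) (r t)))\<^sup>2 \<partial>L) \<le> (\<integral>t. 2 * (cmod (h t - k t))\<^sup>2 + 4 * \<delta>\<^sup>2 \<partial>L)"
    by (rule integral_mono[OF polyI sumI]) (use le in simp)
  also have "\<dots> = 2 * (\<integral>t. (cmod (h t - k t))\<^sup>2 \<partial>L) + 4 * \<delta>\<^sup>2 * (2 * a)"
    using k(2) constI a_pos by (simp add: measure_restrict_space)
  also have "\<dots> < 2 * (\<eta> / 4) + 4 * (\<eta> / (16 * a)) * (2 * a)" using k(3) unfolding \<delta>(2) by simp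
  also have "\<dots> = \<eta>" using a_pos by simp
  finally show ?thesis using that[OF q(1) r(1) polyI] by blast
qed

text \<open>A polynomial that is positive inside the interval and zero at both ends, so that its
  polynomial multiples have zero boundary values.\<close>

definition wgt :: "real \<Rightarrow> real" where "wgt t = (a\<^sup>2 - t\<^sup>2)\<^sup>2"

text \<open>The derivative of a polynomial stays bounded, so the factors \<open>t + a\<close> and
  \<open>(t + a) * ln (a + t)\<close> and their counterparts at \<open>a\<close> annihilate it in
  the limit; only the end point values of \<open>f\<close> remain.\<close>

lemma polynomial_boundary:
  assumes f: "real_polynomial_function f" and "f (-a) = 0" "f a = 0"
  shows "(\<lambda>t. complex_of_real (f t)) \<in> D_max a"
    "b_left a (\<lambda>t. complex_of_real (f t)) = 0" "c_left a (\<lambda>t. complex_of_real (f t)) = 0"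
    "b_right a (\<lambda>t. complex_of_real (f t)) = 0" "c_right a (\<lambda>t. complex_of_real (f t)) = 0"
proof -
  obtain f' where f': "real_polynomial_function f'" "\<And>t. (f has_real_derivative f' t) (at t)"
    using has_real_derivative_polynomial_function[OF f] by blast
  have pp: "real_polynomial_function p"
  proof -
    have "real_polynomial_function (\<lambda>t. 1 + (- 1 / a\<^sup>2) * (t * t))"
      by (intro real_polynomial_function.intros) (rule bounded_linear_ident)+
    moreover have "(\<lambda>t. 1 + (- 1 / a\<^sup>2) * (t * t)) = p" by (rule ext) (simp add: p_def power2_eq_square)
    ultimately show ?thesis by simp
  qed
  have hp: "real_polynomial_function (\<lambda>t. p t * f' t)"
    by (rule real_polynomial_function_mult[OF pp f'(1)])
  obtain h' where h': "real_polynomial_function h'" "\<And>t. ((\<lambda>t. p t * f' t) has_real_derivative h' t) (at t)"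
    using has_real_derivative_polynomial_function[OF hp] by blast
  have cont: "continuous_on S q" if "real_polynomial_function q" for q :: "real \<Rightarrow> real" and S
    using that by (auto intro: continuous_on_polymonial_function simp: real_polynomial_function_eq)
  have "sol (\<lambda>t. of_real (f t)) (\<lambda>t. of_real (p t * f' t)) (\<lambda>t. of_real (- h' t))"
    by (rule sol_real[where f' = f']) (use f' h' cont in \<open>auto intro!: continuous_intros\<close>)
  then show D: "(\<lambda>t. complex_of_real (f t)) \<in> D_max a" using D_max_iff_sol by blast
  note br = boundary_real[of f f', OF D f'(2)]
  have lim: "(q \<longlongrightarrow> q t) (at t within S)" if "real_polynomial_function q" for q :: "real \<Rightarrow> real" and t S
    using cont[OF that, of UNIV] by (auto simp: continuous_on_eq_continuous_at isCont_def intro: tendsto_within_subset)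
  have "((\<lambda>t. (t + a) * f' t) \<longlongrightarrow> (-a + a) * f' (-a)) (at_right (-a))"
    by (intro tendsto_mult tendsto_add tendsto_const tendsto_ident_at lim f'(1))
  then show "b_left a (\<lambda>t. complex_of_real (f t)) = 0" using br(1)[of 0] by simp
  have "((\<lambda>t. (t + a) * ln (a + t) * f' t - f t) \<longlongrightarrow> 0 * f' (-a) - f (-a)) (at_right (-a))"
    by (intro tendsto_mult[OF tendsto_id_ln(1)] tendsto_diff lim f'(1) f)
  then show "c_left a (\<lambda>t. complex_of_real (f t)) = 0" using br(2)[of 0] assms(2) by simp
  have "((\<lambda>t. (t - a) * f' t) \<longlongrightarrow> (a - a) * f' a) (at_left a)"
    by (intro tendsto_mult tendsto_diff tendsto_const tendsto_ident_at lim f'(1))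
  then show "b_right a (\<lambda>t. complex_of_real (f t)) = 0" using br(3)[of 0] by simp
  have "((\<lambda>t. (t - a) * ln (a - t) * f' t - f t) \<longlongrightarrow> 0 * f' a - f a) (at_left a)"
    by (intro tendsto_mult[OF tendsto_id_ln(2)] tendsto_diff lim f'(1) f)
  then show "c_right a (\<lambda>t. complex_of_real (f t)) = 0" using br(4)[of 0] assms(3) by simp
qed

text \<open>\<open>f\<close> is replaced by zero where it is large or the weight is small, so that
  the quotient by \<open>wgt\<close> is bounded. A polynomial close to this quotient, multiplied
  back by \<open>wgt\<close>, is close to \<open>f\<close> and has zero boundary values; such
  functions lie in every \<open>D_U a U\<close>.\<close>

lemma zero_boundary_dense:
  assumes f: "f \<in> L2 L" and "\<epsilon> > 0"
  obtains x where "x \<in> D_max a" "b_left a x = 0" "c_left a x = 0" "b_right a x = 0" "c_right a x = 0"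
    "L2_norm L (\<lambda>t. f t - x t) < \<epsilon>"
proof -
  define \<eta> where "\<eta> = \<epsilon>\<^sup>2"
  have \<eta>: "\<eta> > 0" using \<open>\<epsilon> > 0\<close> by (simp add: \<eta>_def)
  note fm = L2_measurable[OF f]
  have f2: "integrable L (\<lambda>t. (cmod (f t))\<^sup>2)" using f by (simp add: L2_def)
  have wm: "wgt \<in> borel_measurable L"
    unfolding wgt_def[abs_def]
    by (rule continuous_imp_measurable_on_sets_lebesgue) (auto intro!: continuous_intros)
  define F where "F n t = (if cmod (f t) \<le> real n \<and> 1 / (real n + 1) \<le> wgt t then f t else 0)" for n t
  have Fm: "F n \<in> borel_measurable L" for n
    unfolding F_def[abs_def] using fm wm by measurable
  have diff_le: "(cmod (f t - F n t))\<^sup>2 \<le> (cmod (f t))\<^sup>2" for n t by (simp add: F_def)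
  have meas: "(\<lambda>t. (cmod (f t - F n t))\<^sup>2) \<in> borel_measurable L" for n using fm Fm[of n] by measurable
  have "(\<lambda>n. \<integral>t. (cmod (f t - F n t))\<^sup>2 \<partial>L) \<longlonglongrightarrow> (\<integral>t. 0 \<partial>L)"
  proof (rule integral_dominated_convergence[OF _ meas f2])
    show "AE t in L. (\<lambda>n. (cmod (f t - F n t))\<^sup>2) \<longlonglongrightarrow> 0"
    proof (subst AE_lebesgue_on_iff_negligible)
      have "(\<lambda>n. (cmod (f t - F n t))\<^sup>2) \<longlonglongrightarrow> 0" if t: "t \<in> {-a..a} - {-a, a}" for t
      proof -
        have "a\<^sup>2 - t\<^sup>2 = (a - t) * (a + t)" by (simp add: power2_eq_square algebra_simps)
        also have "\<dots> > 0" using t by (intro mult_pos_pos) auto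
        finally have w: "wgt t > 0" by (simp add: wgt_def)
        obtain m :: nat where m: "max (cmod (f t)) (1 / wgt t) \<le> real m" using real_arch_simple by blast
        have "F n t = f t" if "m \<le> n" for n
        proof -
          have n: "cmod (f t) \<le> real n" "1 / wgt t \<le> real n" using m that by (auto intro: order_trans)
          then have "1 \<le> real n * wgt t" using w by (simp add: divide_le_eq)
          also have "\<dots> \<le> (real n + 1) * wgt t" using w by simp
          finally have "1 / (real n + 1) \<le> wgt t" by (simp add: divide_le_eq mult.commute)
          then show ?thesis using n by (simp add: F_def)
        qed
        then have "eventually (\<lambda>n. (cmod (f t - F n t))\<^sup>2 = 0) sequentially"
          by (auto simp: eventually_sequentially intro!: exI[of _ m])
        then show ?thesis by (rule tendsto_eventually)
      qed
      then show "\<exists>N. negligible N \<and> (\<forall>t\<in>{-a..a} - N. (\<lambda>n. (cmod (f t - F n t))\<^sup>2) \<longlonglongrightarrow> 0)"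
        by (intro exI[of _ "{-a, a}"]) auto
    qed simp
    show "AE t in L. norm ((cmod (f t - F n t))\<^sup>2) \<le> (cmod (f t))\<^sup>2" for n
      by (rule AE_I2) (use diff_le in simp)
  qed simp
  then have "eventually (\<lambda>n. (\<integral>t. (cmod (f t - F n t))\<^sup>2 \<partial>L) < \<eta> / 4) sequentially"
    using \<eta> by (intro order_tendstoD(2)) auto
  then obtain n where n: "(\<integral>t. (cmod (f t - F n t))\<^sup>2 \<partial>L) < \<eta> / 4" by (auto simp: eventually_sequentially)
  have FI: "integrable L (\<lambda>t. (cmod (f t - F n t))\<^sup>2)"
    by (rule Bochner_Integration.integrable_bound[OF f2 meas])
       (rule AE_I2, use diff_le in simp)
  define h where "h t = F n t / complex_of_real (wgt t)" for t
  \<comment> \<open>Where \<open>F n\<close> is not cut off, \<open>cmod (f t) \<le> n\<close> and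
    \<open>1 / wgt t \<le> n + 1\<close>; the last summand keeps \<open>B\<close> positive for
    \<open>n = 0\<close>.\<close>
  define B where "B = real n * (real n + 1) + 1"
  have B: "B > 0" by (simp add: B_def add_nonneg_pos)
  have hm: "h \<in> borel_measurable L" unfolding h_def[abs_def] using Fm[of n] wm by measurable
  have hB: "cmod (h t) \<le> B" for t
  proof (cases "cmod (f t) \<le> real n \<and> 1 / (real n + 1) \<le> wgt t")
    case True
    have "0 < 1 / (real n + 1)" by simp
    then have w: "wgt t > 0" using True by linarith
    have "1 / wgt t \<le> real n + 1" using True w by (simp add: divide_le_eq mult.commute)
    have "cmod (h t) = cmod (f t) * (1 / wgt t)" using True w by (simp add: h_def F_def norm_divide)
    also have "\<dots> \<le> real n * (real n + 1)"
      using True w \<open>1 / wgt t \<le> real n + 1\<close> by (intro mult_mono) auto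
    finally show ?thesis by (simp add: B_def)
  next
    case False
    then have "F n t = 0" unfolding F_def by (rule if_not_P)
    then have "h t = 0" by (simp add: h_def)
    then show ?thesis using B by simp
  qed
  have wB: "\<bar>wgt t\<bar> \<le> a ^ 4" if "t \<in> {-a..a}" for t
  proof -
    have "t\<^sup>2 \<le> a\<^sup>2" using that by (intro power2_le_iff_abs_le[THEN iffD2]) auto
    then have "(a\<^sup>2 - t\<^sup>2)\<^sup>2 \<le> (a\<^sup>2)\<^sup>2" by (intro power_mono) auto
    then show ?thesis by (simp add: wgt_def)
  qed
  \<comment> \<open>\<open>(a ^ 4)\<^sup>2\<close> bounds the square of the weight, so after the
    doubling in \<open>le\<close> the polynomial error contributes less than \<eta> / 2.\<close>
  define \<kappa> where "\<kappa> = \<eta> / (4 * (a ^ 4)\<^sup>2)"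
  have a4: "(a ^ 4)\<^sup>2 > 0" using a_pos by simp
  have \<kappa>: "\<kappa> > 0" using \<eta> a4 by (simp add: \<kappa>_def)
  obtain q r where qr: "real_polynomial_function q" "real_polynomial_function r"
    "integrable L (\<lambda>t. (cmod (h t - Complex (q t) (r t)))\<^sup>2)" "(\<integral>t. (cmod (h t - Complex (q t) (r t)))\<^sup>2 \<partial>L) < \<kappa>"
    by (rule bounded_approx_polynomial[OF hm B hB \<kappa>])
  have wp: "real_polynomial_function wgt"
  proof -
    have "real_polynomial_function (\<lambda>t. (a\<^sup>2 + (-1) * (t * t)) * (a\<^sup>2 + (-1) * (t * t)))"
      by (intro real_polynomial_function.intros) (rule bounded_linear_ident)+
    moreover have "(\<lambda>t. (a\<^sup>2 + (-1) * (t * t)) * (a\<^sup>2 + (-1) * (t * t))) = wgt"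
      by (rule ext) (simp add: wgt_def power2_eq_square)
    ultimately show ?thesis by simp
  qed
  let ?X = "\<lambda>t. complex_of_real (wgt t * q t)" and ?Y = "\<lambda>t. complex_of_real (wgt t * r t)"
  have w0: "wgt (-a) * s = 0" "wgt a * s = 0" for s by (simp_all add: wgt_def)
  note X = polynomial_boundary[OF real_polynomial_function_mult[OF wp qr(1)] w0]
  note Y = polynomial_boundary[OF real_polynomial_function_mult[OF wp qr(2)] w0]
  define x where "x t = 1 * ?X t + \<i> * ?Y t" for t
  have x_eq: "x t = complex_of_real (wgt t) * Complex (q t) (r t)" for t
    by (simp add: x_def Complex_eq algebra_simps)
  have le: "(cmod (f t - x t))\<^sup>2 \<le> 2 * (cmod (f t - F n t))\<^sup>2 + 2 * (a ^ 4)\<^sup>2 * (cmod (h t - Complex (q t) (r t)))\<^sup>2"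
    if t: "t \<in> {-a..a}" for t
  proof -
    have Fw: "F n t = complex_of_real (wgt t) * h t"
    proof (cases "wgt t = 0")
      case True
      then have "\<not> 1 / (real n + 1) \<le> wgt t" by simp
      then show ?thesis using True by (simp add: F_def)
    qed (simp add: h_def)
    let ?u = "f t - F n t" and ?v = "F n t - x t"
    have "?v = complex_of_real (wgt t) * (h t - Complex (q t) (r t))"
      unfolding Fw x_eq by (simp add: right_diff_distrib)
    then have "(cmod ?v)\<^sup>2 = \<bar>wgt t\<bar>\<^sup>2 * (cmod (h t - Complex (q t) (r t)))\<^sup>2"
      by (simp only: norm_mult norm_of_real power_mult_distrib)
    also have "\<dots> \<le> (a ^ 4)\<^sup>2 * (cmod (h t - Complex (q t) (r t)))\<^sup>2"
      using wB[OF t] by (intro mult_right_mono power_mono) auto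
    finally have v: "(cmod ?v)\<^sup>2 \<le> (a ^ 4)\<^sup>2 * (cmod (h t - Complex (q t) (r t)))\<^sup>2" .
    have "(cmod (?u + ?v))\<^sup>2 \<le> (cmod ?u + cmod ?v)\<^sup>2" by (intro power_mono norm_triangle_ineq) simp
    also have "\<dots> \<le> (cmod ?u + cmod ?v)\<^sup>2 + (cmod ?u - cmod ?v)\<^sup>2" by simp
    also have "\<dots> = 2 * (cmod ?u)\<^sup>2 + 2 * (cmod ?v)\<^sup>2" by (simp add: power2_eq_square algebra_simps)
    finally show ?thesis using v by simp
  qed
  have xD: "x \<in> D_max a" unfolding x_def[abs_def] by (rule D_max_lin[OF X(1) Y(1)])
  then have "x \<in> L2 L" by (simp add: D_max_def)
  then have fxI: "integrable L (\<lambda>t. (cmod (f t - x t))\<^sup>2)" using L2_diff[OF f] by (simp add: L2_def)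
  have "(\<integral>t. (cmod (f t - x t))\<^sup>2 \<partial>L) \<le>
      (\<integral>t. 2 * (cmod (f t - F n t))\<^sup>2 + 2 * (a ^ 4)\<^sup>2 * (cmod (h t - Complex (q t) (r t)))\<^sup>2 \<partial>L)"
    by (rule integral_mono[OF fxI]) (use le FI qr(3) in auto)
  also have "\<dots> = 2 * (\<integral>t. (cmod (f t - F n t))\<^sup>2 \<partial>L) + 2 * (a ^ 4)\<^sup>2 * (\<integral>t. (cmod (h t - Complex (q t) (r t)))\<^sup>2 \<partial>L)"
    using FI qr(3) by simp
  also have "\<dots> < 2 * (\<eta> / 4) + 2 * (a ^ 4)\<^sup>2 * \<kappa>"
    using n qr(4) a4 by (intro add_strict_mono mult_strict_left_mono) auto
  also have "\<dots> = \<eta>" using a4 by (simp add: \<kappa>_def)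
  finally have "sqrt (\<integral>t. (cmod (f t - x t))\<^sup>2 \<partial>L) < sqrt \<eta>" by simp
  then have "L2_norm L (\<lambda>t. f t - x t) < \<epsilon>" using \<open>\<epsilon> > 0\<close> by (simp add: L2_norm_def \<eta>_def)
  moreover have "b_left a x = 0" "c_left a x = 0" "b_right a x = 0" "c_right a x = 0"
    unfolding x_def[abs_def] boundary_lin[OF X(1) Y(1)] X Y by simp_all
  ultimately show ?thesis using that xD by blast
qed

end

section \<open>Self-adjoint extensions\<close>

lemma L2_norm_zero: "L2_norm M (\<lambda>_. 0) = 0"
  by (simp add: L2_norm_def)

text \<open>Young's inequality with weight \<open>e\<close> takes the place of Cauchy-Schwarz; a
  bound linear in \<open>e\<close> is all that the limit argument below needs.\<close>

lemma L2_inner_small: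
  assumes u: "u \<in> L2 M" and v: "v \<in> L2 M" and "e > 0" "L2_norm M v < e"
  shows "cmod (L2_inner M u v) \<le> e * ((\<integral>t. (cmod (u t))\<^sup>2 \<partial>M) + 1)"
proof -
  have u2: "integrable M (\<lambda>t. (cmod (u t))\<^sup>2)" and v2: "integrable M (\<lambda>t. (cmod (v t))\<^sup>2)"
    using u v by (auto simp: L2_def)
  have nn: "0 \<le> (\<integral>t. (cmod (v t))\<^sup>2 \<partial>M)" "0 \<le> (\<integral>t. (cmod (u t))\<^sup>2 \<partial>M)" by simp_all
  have "(sqrt (\<integral>t. (cmod (v t))\<^sup>2 \<partial>M))\<^sup>2 \<le> e\<^sup>2"
    using assms(4) nn unfolding L2_norm_def by (intro power_mono) auto
  then have v_le: "(\<integral>t. (cmod (v t))\<^sup>2 \<partial>M) \<le> e\<^sup>2" using nn by simp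
  have I: "integrable M (\<lambda>t. e * (cmod (u t))\<^sup>2 + (1 / e) * (cmod (v t))\<^sup>2)"
    by (intro Bochner_Integration.integrable_add integrable_mult_right u2 v2)
  have "cmod (L2_inner M u v) \<le> (\<integral>t. cmod (u t * cnj (v t)) \<partial>M)"
    unfolding L2_inner_def by (rule integral_norm_bound)
  also have "\<dots> \<le> (\<integral>t. e * (cmod (u t))\<^sup>2 + (1 / e) * (cmod (v t))\<^sup>2 \<partial>M)"
  proof (rule integral_mono[OF integrable_norm[OF L2_integrable_mult[OF u v]] I])
    fix t
    have "0 \<le> (e * cmod (u t) - cmod (v t))\<^sup>2 / e" using \<open>e > 0\<close> by simp
    moreover have "(e * cmod (u t) - cmod (v t))\<^sup>2 / e =
        e * (cmod (u t))\<^sup>2 + (1 / e) * (cmod (v t))\<^sup>2 - 2 * (cmod (u t) * cmod (v t))"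
      using \<open>e > 0\<close> by (simp add: power2_eq_square field_simps)
    ultimately have "2 * (cmod (u t) * cmod (v t)) \<le> e * (cmod (u t))\<^sup>2 + (1 / e) * (cmod (v t))\<^sup>2" by simp
    moreover have "0 \<le> cmod (u t) * cmod (v t)" by simp
    ultimately show "cmod (u t * cnj (v t)) \<le> e * (cmod (u t))\<^sup>2 + (1 / e) * (cmod (v t))\<^sup>2"
      by (simp only: norm_mult complex_mod_cnj)
  qed
  also have "\<dots> = e * (\<integral>t. (cmod (u t))\<^sup>2 \<partial>M) + (1 / e) * (\<integral>t. (cmod (v t))\<^sup>2 \<partial>M)"
    using u2 v2 by simp
  also have "\<dots> \<le> e * (\<integral>t. (cmod (u t))\<^sup>2 \<partial>M) + (1 / e) * e\<^sup>2"
    using v_le \<open>e > 0\<close> by (intro add_left_mono mult_left_mono) auto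
  also have "\<dots> = e * ((\<integral>t. (cmod (u t))\<^sup>2 \<partial>M) + 1)"
    using \<open>e > 0\<close> by (simp add: power2_eq_square algebra_simps)
  finally show ?thesis .
qed

lemma L2_inner_diff_right:
  assumes "u \<in> L2 M" "v \<in> L2 M" "w \<in> L2 M"
  shows "L2_inner M u (\<lambda>t. v t - w t) = L2_inner M u v - L2_inner M u w"
  unfolding L2_inner_def using L2_integrable_mult[OF assms(1,2)] L2_integrable_mult[OF assms(1,3)]
  by (simp add: right_diff_distrib)

text \<open>Adjoints are closed, because their defining equation passes to norm limits. It is used
  with \<open>A\<close> equal to \<open>M_U a U\<close>, which is its own adjoint.\<close>

lemma operator_closure_subset_adjoint:
  assumes A: "A \<subseteq> L2 M \<times> L2 M" and G: "G \<subseteq> adjoint_operator M A"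
  shows "operator_closure M G \<subseteq> adjoint_operator M A"
proof (rule subrelI)
  fix f g assume fg: "(f, g) \<in> operator_closure M G"
  then have f: "f \<in> L2 M" and g: "g \<in> L2 M" by (auto simp: operator_closure_def)
  have "L2_inner M w f = L2_inner M x g" if xw: "(x, w) \<in> A" for x w
  proof -
    have xL: "x \<in> L2 M" and wL: "w \<in> L2 M" using A xw by auto
    define C where "C = (\<integral>t. (cmod (w t))\<^sup>2 \<partial>M) + 1 + ((\<integral>t. (cmod (x t))\<^sup>2 \<partial>M) + 1)"
    have C: "C > 0"
    proof -
      have "0 \<le> (\<integral>t. (cmod (w t))\<^sup>2 \<partial>M)" "0 \<le> (\<integral>t. (cmod (x t))\<^sup>2 \<partial>M)" by simp_all
      then show ?thesis unfolding C_def by linarith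
    qed
    have small: "cmod (L2_inner M w f - L2_inner M x g) \<le> e * C" if "e > 0" for e
    proof -
      obtain u v where uv: "(u, v) \<in> G" "L2_norm M (\<lambda>t. f t - u t) < e" "L2_norm M (\<lambda>t. g t - v t) < e"
        using fg \<open>e > 0\<close> unfolding operator_closure_def by blast
      have "(u, v) \<in> adjoint_operator M A" using G uv(1) by blast
      then have uL: "u \<in> L2 M" and vL: "v \<in> L2 M" and eq: "L2_inner M w u = L2_inner M x v"
        using xw by (auto simp: adjoint_operator_def)
      have "L2_inner M w f - L2_inner M x g = L2_inner M w (\<lambda>t. f t - u t) - L2_inner M x (\<lambda>t. g t - v t)"
        using eq by (simp add: L2_inner_diff_right[OF wL f uL] L2_inner_diff_right[OF xL g vL])
      also have "cmod \<dots> \<le> cmod (L2_inner M w (\<lambda>t. f t - u t)) + cmod (L2_inner M x (\<lambda>t. g t - v t))"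
        by (rule norm_triangle_ineq4)
      also have "\<dots> \<le> e * ((\<integral>t. (cmod (w t))\<^sup>2 \<partial>M) + 1) + e * ((\<integral>t. (cmod (x t))\<^sup>2 \<partial>M) + 1)"
        by (intro add_mono L2_inner_small wL xL L2_diff f uL g vL uv \<open>e > 0\<close>)
      also have "\<dots> = e * C" by (simp add: C_def algebra_simps)
      finally show ?thesis .
    qed
    have "cmod (L2_inner M w f - L2_inner M x g) \<le> 0"
    proof (rule field_le_epsilon)
      fix e :: real assume "e > 0"
      then show "cmod (L2_inner M w f - L2_inner M x g) \<le> 0 + e" using small[of "e / C"] C by simp
    qed
    then show ?thesis by simp
  qed
  then show "(f, g) \<in> adjoint_operator M A" using f g by (auto simp: adjoint_operator_def)
qed

section \<open>Unitary matrices and Lagrangian subspaces\<close>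

lemma unitary_matrix_2_iff:
  fixes U :: "complex^2^2"
  shows "unitary_matrix U \<longleftrightarrow>
    cnj (U$1$1) * U$1$1 + cnj (U$2$1) * U$2$1 = 1 \<and> cnj (U$1$1) * U$1$2 + cnj (U$2$1) * U$2$2 = 0 \<and>
    cnj (U$1$2) * U$1$1 + cnj (U$2$2) * U$2$1 = 0 \<and> cnj (U$1$2) * U$1$2 + cnj (U$2$2) * U$2$2 = 1"
proof -
  \<comment> \<open>For square matrices a left inverse is also a right inverse, so the column
    relations characterise unitarity.\<close>
  have "unitary_matrix U \<longleftrightarrow> conj_transpose U ** U = mat 1"
    unfolding unitary_matrix_def using matrix_left_right_inverse[of U "conj_transpose U"] by blast
  also have "\<dots> \<longleftrightarrow> cnj (U$1$1) * U$1$1 + cnj (U$2$1) * U$2$1 = 1 \<and> cnj (U$1$1) * U$1$2 + cnj (U$2$1) * U$2$2 = 0 \<and>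
    cnj (U$1$2) * U$1$1 + cnj (U$2$2) * U$2$1 = 0 \<and> cnj (U$1$2) * U$1$2 + cnj (U$2$2) * U$2$2 = 1"
    by (simp add: vec_eq_iff forall_2 matrix_matrix_mult_def sum_2 mat_def conj_transpose_def)
  finally show ?thesis .
qed

lemma unitary_matrix_2_rows:
  fixes U :: "complex^2^2"
  assumes "unitary_matrix U"
  shows "U$1$1 * cnj (U$1$1) + U$1$2 * cnj (U$1$2) = 1" "U$1$1 * cnj (U$2$1) + U$1$2 * cnj (U$2$2) = 0"
    "U$2$1 * cnj (U$1$1) + U$2$2 * cnj (U$1$2) = 0" "U$2$1 * cnj (U$2$1) + U$2$2 * cnj (U$2$2) = 1"
proof -
  have "U ** conj_transpose U = mat 1" using assms by (simp add: unitary_matrix_def)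
  then show "U$1$1 * cnj (U$1$1) + U$1$2 * cnj (U$1$2) = 1" "U$1$1 * cnj (U$2$1) + U$1$2 * cnj (U$2$2) = 0"
    "U$2$1 * cnj (U$1$1) + U$2$2 * cnj (U$1$2) = 0" "U$2$1 * cnj (U$2$1) + U$2$2 * cnj (U$2$2) = 1"
    by (simp_all add: vec_eq_iff forall_2 matrix_matrix_mult_def sum_2 mat_def conj_transpose_def)
qed

lemma complex_norm_sum_zero:
  assumes "v1 * cnj v1 + v2 * cnj v2 = 0"
  shows "v1 = 0 \<and> v2 = 0"
proof -
  have "v1 * cnj v1 + v2 * cnj v2 = complex_of_real ((cmod v1)\<^sup>2 + (cmod v2)\<^sup>2)"
    unfolding complex_norm_square[symmetric] by simp
  then have "complex_of_real ((cmod v1)\<^sup>2 + (cmod v2)\<^sup>2) = 0" using assms by (simp only:)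
  then have "(cmod v1)\<^sup>2 + (cmod v2)\<^sup>2 = 0" by (simp only: of_real_eq_0_iff)
  then show ?thesis by (simp add: add_nonneg_eq_0_iff)
qed

text \<open>\<open>B\<close> projects onto the first two coordinates because a vector \<open>v\<close> orthogonal to this projection
  gives an element \<open>(v, 0)\<close> of \<open>B\<close>, which must be isotropic.\<close>

lemma lagrangian_unitary_graph:
  fixes B :: "complex \<Rightarrow> complex \<Rightarrow> complex \<Rightarrow> complex \<Rightarrow> bool"
  assumes B: "\<And>v1 v2 w1 w2. B v1 v2 w1 w2 \<longleftrightarrow> (\<forall>v1' v2' w1' w2'. B v1' v2' w1' w2' \<longrightarrow>
      v1' * cnj v1 + v2' * cnj v2 = w1' * cnj w1 + w2' * cnj w2)"
  obtains U :: "complex^2^2" where "unitary_matrix U"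
    "\<And>v1 v2 w1 w2. B v1 v2 w1 w2 \<longleftrightarrow> w1 + U$1$1 * v1 + U$1$2 * v2 = 0 \<and> w2 + U$2$1 * v1 + U$2$2 * v2 = 0"
proof -
  have BD: "v1' * cnj v1 + v2' * cnj v2 = w1' * cnj w1 + w2' * cnj w2"
    if "B v1 v2 w1 w2" "B v1' v2' w1' w2'" for v1 v2 w1 w2 v1' v2' w1' w2'
    by (rule B[THEN iffD1, OF that(1), rule_format, OF that(2)])
  have BI: "B v1 v2 w1 w2"
    if "\<And>v1' v2' w1' w2'. B v1' v2' w1' w2' \<Longrightarrow> v1' * cnj v1 + v2' * cnj v2 = w1' * cnj w1 + w2' * cnj w2"
    for v1 v2 w1 w2
    by (rule B[THEN iffD2]) (intro allI impI that)
  \<comment> \<open>Being the orthogonal complement of itself for the boundary form,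
    \<open>B\<close> is a linear subspace.\<close>
  have lin: "B (c * v1 + d * x1) (c * v2 + d * x2) (c * w1 + d * y1) (c * w2 + d * y2)"
    if "B v1 v2 w1 w2" "B x1 x2 y1 y2" for c d v1 v2 w1 w2 x1 x2 y1 y2
  proof (rule BI)
    fix v1' v2' w1' w2' assume "B v1' v2' w1' w2'"
    from BD[OF that(1) this] BD[OF that(2) this]
    have "cnj c * (v1' * cnj v1 + v2' * cnj v2) + cnj d * (v1' * cnj x1 + v2' * cnj x2) =
        cnj c * (w1' * cnj w1 + w2' * cnj w2) + cnj d * (w1' * cnj y1 + w2' * cnj y2)" by simp
    then show "v1' * cnj (c * v1 + d * x1) + v2' * cnj (c * v2 + d * x2) =
        w1' * cnj (c * w1 + d * y1) + w2' * cnj (c * w2 + d * y2)"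
      by (simp add: algebra_simps)
  qed
  have nondeg: "n1 = 0 \<and> n2 = 0"
    if "\<And>v1 v2 w1 w2. B v1 v2 w1 w2 \<Longrightarrow> v1 * cnj n1 + v2 * cnj n2 = 0" for n1 n2
  proof -
    have n: "B n1 n2 0 0" by (rule BI) (simp add: that)
    from BD[OF n n] have "n1 * cnj n1 + n2 * cnj n2 = 0" by simp
    then show ?thesis by (rule complex_norm_sum_zero)
  qed
  obtain p1 p2 r1 r2 where p: "B p1 p2 r1 r2" "\<not> (p1 = 0 \<and> p2 = 0)"
  proof -
    have "\<exists>p1 p2 r1 r2. B p1 p2 r1 r2 \<and> p1 * cnj 1 + p2 * cnj 0 \<noteq> 0"
      using nondeg[of 1 0] one_neq_zero by blast
    then obtain p1 p2 r1 r2 where "B p1 p2 r1 r2" "p1 * cnj 1 + p2 * cnj 0 \<noteq> 0" by blast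
    moreover from this(2) have "\<not> (p1 = 0 \<and> p2 = 0)" by auto
    ultimately show ?thesis using that by blast
  qed
  \<comment> \<open>The vector \<open>(- cnj p2, cnj p1)\<close> is orthogonal to
    \<open>(p1, p2)\<close>. An element of \<open>B\<close> whose projection is not orthogonal to it
    projects to a vector independent of \<open>(p1, p2)\<close>, with determinant \<Delta>.\<close>
  have "\<not> (- cnj p2 = 0 \<and> cnj p1 = 0)" using p(2) by auto
  then have "\<exists>q1 q2 s1 s2. B q1 q2 s1 s2 \<and> q1 * cnj (- cnj p2) + q2 * cnj (cnj p1) \<noteq> 0"
    using nondeg[of "- cnj p2" "cnj p1"] by blast
  then obtain q1 q2 s1 s2 where q: "B q1 q2 s1 s2" "q1 * cnj (- cnj p2) + q2 * cnj (cnj p1) \<noteq> 0"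
    by blast
  define \<Delta> where "\<Delta> = p1 * q2 - p2 * q1"
  have \<Delta>: "\<Delta> \<noteq> 0" using q(2) by (simp add: \<Delta>_def mult.commute)
  have onto: "\<exists>w1 w2. B v1 v2 w1 w2" for v1 v2
  proof -
    \<comment> \<open>Cramer's rule for the coordinates of \<open>(v1, v2)\<close> in the basis
      \<open>(p1, p2)\<close>, \<open>(q1, q2)\<close>.\<close>
    let ?c = "(v1 * q2 - v2 * q1) / \<Delta>" and ?d = "(p1 * v2 - p2 * v1) / \<Delta>"
    have "?c * p1 + ?d * q1 = (v1 * \<Delta>) / \<Delta>" "?c * p2 + ?d * q2 = (v2 * \<Delta>) / \<Delta>"
      by (simp_all add: \<Delta>_def add_divide_distrib[symmetric] algebra_simps)
    then have "?c * p1 + ?d * q1 = v1" "?c * p2 + ?d * q2 = v2" using \<Delta> by simp_all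
    then have "B v1 v2 (?c * r1 + ?d * s1) (?c * r2 + ?d * s2)"
      using lin[OF p(1) q(1), of ?c ?d] by (simp only:)
    then show ?thesis by blast
  qed
  obtain s1 s2 where s: "B 1 0 s1 s2" using onto by blast
  obtain t1 t2 where t: "B 0 1 t1 t2" using onto by blast
  \<comment> \<open>The columns are the negated images of the basis vectors, to match the sign
    convention \<open>w = - U v\<close>.\<close>
  define U :: "complex^2^2" where "U = vector [vector [- s1, - t1], vector [- s2, - t2]]"
  have U: "U$1$1 = - s1" "U$1$2 = - t1" "U$2$1 = - s2" "U$2$2 = - t2"
    by (simp_all add: U_def)
  have graph: "B v1 v2 w1 w2 \<longleftrightarrow> w1 = v1 * s1 + v2 * t1 \<and> w2 = v1 * s2 + v2 * t2" for v1 v2 w1 w2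
  proof
    have on: "B v1 v2 (v1 * s1 + v2 * t1) (v1 * s2 + v2 * t2)"
      using lin[OF s t, of v1 v2] by simp
    show "B v1 v2 w1 w2" if "w1 = v1 * s1 + v2 * t1 \<and> w2 = v1 * s2 + v2 * t2"
      using on that by simp
    assume "B v1 v2 w1 w2"
    from lin[OF this on, of 1 "-1"]
    have z: "B 0 0 (w1 - (v1 * s1 + v2 * t1)) (w2 - (v1 * s2 + v2 * t2))" by (simp add: algebra_simps)
    \<comment> \<open>An element of \<open>B\<close> over the zero vector is isotropic for a
      definite form, hence zero; so \<open>B\<close> is the graph of a map.\<close>
    have "w1 - (v1 * s1 + v2 * t1) = 0 \<and> w2 - (v1 * s2 + v2 * t2) = 0"
      by (rule complex_norm_sum_zero) (use BD[OF z z] in simp)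
    then show "w1 = v1 * s1 + v2 * t1 \<and> w2 = v1 * s2 + v2 * t2" by simp
  qed
  show ?thesis
  proof (rule that)
    show "unitary_matrix U"
      unfolding unitary_matrix_2_iff U using BD[OF s s] BD[OF s t] BD[OF t s] BD[OF t t]
      by (simp add: mult.commute)
    show "B v1 v2 w1 w2 \<longleftrightarrow> w1 + U$1$1 * v1 + U$1$2 * v2 = 0 \<and> w2 + U$2$1 * v1 + U$2$2 * v2 = 0" for v1 v2 w1 w2
      unfolding graph U by (auto simp: algebra_simps)
  qed
qed

section \<open>Boundary data and adjoints of restrictions\<close>

context legendre
begin

definition v1 where "v1 x = b_left a x + \<i> * c_left a x"
definition v2 where "v2 x = b_right a x + \<i> * c_right a x"
definition w1 where "w1 x = b_left a x - \<i> * c_left a x"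
definition w2 where "w2 x = b_right a x - \<i> * c_right a x"

lemmas data_defs = v1_def v2_def w1_def w2_def

definition lagr :: "(real \<Rightarrow> complex) \<Rightarrow> (real \<Rightarrow> complex) \<Rightarrow> bool" where
  "lagr x y \<longleftrightarrow> v1 x * cnj (v1 y) + v2 x * cnj (v2 y) = w1 x * cnj (w1 y) + w2 x * cnj (w2 y)"

lemma D_U_iff:
  "x \<in> D_U a U \<longleftrightarrow> x \<in> D_max a \<and> w1 x + U$1$1 * v1 x + U$1$2 * v2 x = 0 \<and> w2 x + U$2$1 * v1 x + U$2$2 * v2 x = 0"
proof -
  have "(1 + U$1$1) * b_left a x - \<i> * (1 - U$1$1) * c_left a x + U$1$2 * b_right a x + \<i> * U$1$2 * c_right a x =
      w1 x + U$1$1 * v1 x + U$1$2 * v2 x"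
    "U$2$1 * b_left a x + \<i> * U$2$1 * c_left a x + (1 + U$2$2) * b_right a x - \<i> * (1 - U$2$2) * c_right a x =
      w2 x + U$2$1 * v1 x + U$2$2 * v2 x"
    by (simp_all add: data_defs algebra_simps)
  then show ?thesis unfolding D_U_def mem_Collect_eq by (simp only:)
qed

lemma D_U_subset: "D_U a U \<subseteq> D_max a"
  using D_U_iff by blast

lemma data_lin:
  assumes "x \<in> D_max a" "y \<in> D_max a"
  shows "v1 (\<lambda>t. c * x t + d * y t) = c * v1 x + d * v1 y" "v2 (\<lambda>t. c * x t + d * y t) = c * v2 x + d * v2 y"
    "w1 (\<lambda>t. c * x t + d * y t) = c * w1 x + d * w1 y" "w2 (\<lambda>t. c * x t + d * y t) = c * w2 x + d * w2 y"
  unfolding data_defs boundary_lin[OF assms] by (simp_all add: algebra_simps)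

lemma data_zero:
  assumes "b_left a x = 0" "c_left a x = 0" "b_right a x = 0" "c_right a x = 0"
  shows "v1 x = 0" "v2 x = 0" "w1 x = 0" "w2 x = 0"
  using assms by (simp_all add: data_defs)

text \<open>Inverts the change of coordinates: at each end \<open>b\<close> is half the sum of
  \<open>v\<close> and \<open>w\<close>, and \<open>c\<close> is their difference divided by
  \<open>2 * \<i>\<close>.\<close>

lemma data_surj: "\<exists>x\<in>D_max a. v1 x = p1 \<and> v2 x = p2 \<and> w1 x = r1 \<and> w2 x = r2"
proof -
  have i: "\<i> * (z / (2 * \<i>)) = z / 2" for z by simp
  have h: "(u + r) / 2 + (u - r) / 2 = u" "(u + r) / 2 - (u - r) / 2 = r" for u r :: complex
    by (simp_all add: add_divide_distrib diff_divide_distrib)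
  obtain x where "x \<in> D_max a" "b_left a x = (p1 + r1) / 2" "c_left a x = (p1 - r1) / (2 * \<i>)"
    "b_right a x = (p2 + r2) / 2" "c_right a x = (p2 - r2) / (2 * \<i>)"
    using boundary_surj by blast
  then show ?thesis by (intro bexI[of _ x]) (simp_all only: data_defs i h simp_thms)
qed

lemma green_data:
  assumes "x \<in> D_max a" "y \<in> D_max a"
  shows "L2_inner L (legendre_expr a x) y = L2_inner L x (legendre_expr a y) \<longleftrightarrow> lagr x y"
proof -
  let ?F = "(b_left a x * cnj (c_left a y) - c_left a x * cnj (b_left a y)) +
      (b_right a x * cnj (c_right a y) - c_right a x * cnj (b_right a y))"
  have "- complex_of_real (2 / a) \<noteq> 0" using a_pos by simp
  then have "L2_inner L (legendre_expr a x) y = L2_inner L x (legendre_expr a y) \<longleftrightarrow> ?F = 0"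
    unfolding eq_iff_diff_eq_0[of "L2_inner L (legendre_expr a x) y"] green[OF assms] mult_eq_0_iff by blast
  moreover have "v1 x * cnj (v1 y) + v2 x * cnj (v2 y) - (w1 x * cnj (w1 y) + w2 x * cnj (w2 y)) = - (2 * \<i>) * ?F"
    by (simp add: data_defs algebra_simps)
  then have "lagr x y \<longleftrightarrow> - (2 * \<i>) * ?F = 0"
    unfolding lagr_def eq_iff_diff_eq_0[of "v1 x * cnj (v1 y) + v2 x * cnj (v2 y)"] by (simp only:)
  moreover have "- (2 * \<i>) \<noteq> 0" by simp
  ultimately show ?thesis unfolding mult_eq_0_iff by blast
qed

lemma legendre_restrictI:
  assumes "x \<in> D" "x \<in> D_max a"
  shows "(x, legendre_expr a x) \<in> legendre_restrict a D"
  using assms by (auto simp: legendre_restrict_def D_max_def)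

lemma legendre_restrict_memI:
  assumes "f \<in> L2 L" "g \<in> L2 L" "x \<in> D" "AE t in L. f t = x t" "AE t in L. g t = legendre_expr a x t"
  shows "(f, g) \<in> legendre_restrict a D"
  unfolding legendre_restrict_def using assms by blast

lemma legendre_restrict_mono: "D \<subseteq> E \<Longrightarrow> legendre_restrict a D \<subseteq> legendre_restrict a E"
  unfolding legendre_restrict_def by blast

lemma legendre_restrict_inner:
  assumes D: "x \<in> D_max a" and fg: "f \<in> L2 L" "g \<in> L2 L" "AE t in L. f t = x t" "AE t in L. g t = legendre_expr a x t"
    and uv: "u \<in> L2 L"
  shows "L2_inner L g u = L2_inner L (legendre_expr a x) u" "L2_inner L f u = L2_inner L x u"
    "L2_inner L u g = L2_inner L u (legendre_expr a x)" "L2_inner L u f = L2_inner L u x"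
  using fg uv by (auto intro!: L2_inner_AE_cong L2_measurable)

text \<open>As \<open>D\<close> contains the compactly supported functions, every element of the
  adjoint has a representative in the maximal domain, and Green's formula turns the adjoint
  condition into orthogonality of boundary data. Self-adjointness thereby becomes linear algebra in
  four dimensions.\<close>

lemma adjoint_legendre_restrict:
  assumes D: "D \<subseteq> D_max a" and C: "{x \<in> D_max a. compact (interval_support a x)} \<subseteq> D"
  shows "adjoint_operator L (legendre_restrict a D) = legendre_restrict a {y \<in> D_max a. \<forall>x\<in>D. lagr x y}"
proof (rule set_eqI, rule iffI)
  fix yz assume "yz \<in> adjoint_operator L (legendre_restrict a D)"
  then obtain y z where yz: "yz = (y, z)" "y \<in> L2 L" "z \<in> L2 L"
    and "\<forall>(x, w)\<in>legendre_restrict a D. L2_inner L w y = L2_inner L x z"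
    unfolding adjoint_operator_def by blast
  then have adj: "L2_inner L w y = L2_inner L x z" if "(x, w) \<in> legendre_restrict a D" for x w
    using that by blast
  have adjD: "L2_inner L (legendre_expr a x) y = L2_inner L x z" if "x \<in> D" for x
    using adj[OF legendre_restrictI[OF that]] D that by blast
  obtain y0 where y0: "y0 \<in> D_max a" "AE t in L. y t = y0 t" "AE t in L. z t = legendre_expr a y0 t"
    using adjoint_compact_support[OF yz(2,3)] adjD C by blast
  have "lagr x y0" if "x \<in> D" for x
  proof -
    have xD: "x \<in> D_max a" using D that by blast
    then have xL: "x \<in> L2 L" "legendre_expr a x \<in> L2 L" by (auto simp: D_max_def)
    have "L2_inner L (legendre_expr a x) y0 = L2_inner L x (legendre_expr a y0)"
      using adjD[OF that] legendre_restrict_inner(3)[OF y0(1) yz(2,3) y0(2,3) xL(1)]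
        legendre_restrict_inner(4)[OF y0(1) yz(2,3) y0(2,3) xL(2)] by simp
    then show ?thesis using green_data[OF xD y0(1)] by blast
  qed
  then have "y0 \<in> {y \<in> D_max a. \<forall>x\<in>D. lagr x y}" using y0(1) by blast
  then show "yz \<in> legendre_restrict a {y \<in> D_max a. \<forall>x\<in>D. lagr x y}"
    unfolding yz(1) by (intro legendre_restrict_memI[OF yz(2,3) _ y0(2,3)])
next
  fix yz assume "yz \<in> legendre_restrict a {y \<in> D_max a. \<forall>x\<in>D. lagr x y}"
  then obtain y z y0 where yz: "yz = (y, z)" "y \<in> L2 L" "z \<in> L2 L"
    and y0: "y0 \<in> D_max a" "AE t in L. y t = y0 t" "AE t in L. z t = legendre_expr a y0 t"
    and lag: "\<forall>x\<in>D. lagr x y0"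
    unfolding legendre_restrict_def by blast
  have "L2_inner L w y = L2_inner L x z" if xw: "(x, w) \<in> legendre_restrict a D" for x w
  proof -
    obtain x0 where xw: "x \<in> L2 L" "w \<in> L2 L" and x0: "x0 \<in> D" "AE t in L. x t = x0 t" "AE t in L. w t = legendre_expr a x0 t"
      using xw unfolding legendre_restrict_def by blast
    have x0D: "x0 \<in> D_max a" using D x0(1) by blast
    then have x0L: "x0 \<in> L2 L" "legendre_expr a x0 \<in> L2 L" by (auto simp: D_max_def)
    have "L2_inner L w y = L2_inner L (legendre_expr a x0) y"
      by (rule legendre_restrict_inner(1)[OF x0D xw x0(2,3) yz(2)])
    also have "\<dots> = L2_inner L (legendre_expr a x0) y0"
      by (rule legendre_restrict_inner(4)[OF y0(1) yz(2,3) y0(2,3) x0L(2)])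
    also have "\<dots> = L2_inner L x0 (legendre_expr a y0)" using green_data[OF x0D y0(1)] lag x0(1) by blast
    also have "\<dots> = L2_inner L x0 z"
      by (rule legendre_restrict_inner(3)[OF y0(1) yz(2,3) y0(2,3) x0L(1), symmetric])
    also have "\<dots> = L2_inner L x z"
      by (rule legendre_restrict_inner(2)[OF x0D xw x0(2,3) yz(3), symmetric])
    finally show ?thesis .
  qed
  then show "yz \<in> adjoint_operator L (legendre_restrict a D)" using yz by (auto simp: adjoint_operator_def)
qed

text \<open>Boundary data are defined through one representative; this makes them functions of the
  class.\<close>

lemma data_AE_cong:
  assumes "x \<in> D_max a" "y \<in> D_max a" "AE t in L. x t = y t"
  shows "v1 x = v1 y" "v2 x = v2 y" "w1 x = w1 y" "w2 x = w2 y"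
  unfolding data_defs using boundary_cong(1-4)[OF assms(1,2) D_max_AE_eq[OF assms]] by simp_all

text \<open>Single-valuedness rests on continuity: two elements of the maximal domain in one class
  coincide on the open interval, so their images agree almost everywhere.\<close>

lemma linear_operator_legendre_restrict:
  assumes D: "D \<subseteq> D_max a" and zero: "(\<lambda>_. 0) \<in> D"
    and lin: "\<And>c d x y. x \<in> D \<Longrightarrow> y \<in> D \<Longrightarrow> (\<lambda>t. c * x t + d * y t) \<in> D"
  shows "linear_operator L (legendre_restrict a D)"
proof -
  let ?G = "legendre_restrict a D"
  have comb: "((\<lambda>t. c * f t + d * f' t), (\<lambda>t. c * g t + d * g' t)) \<in> ?G"
    if fg: "(f, g) \<in> ?G" "(f', g') \<in> ?G" for c d f g f' g'
  proof -
    obtain x where x: "f \<in> L2 L" "g \<in> L2 L" "x \<in> D" "AE t in L. f t = x t" "AE t in L. g t = legendre_expr a x t"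
      using fg(1) unfolding legendre_restrict_def by blast
    obtain y where y: "f' \<in> L2 L" "g' \<in> L2 L" "y \<in> D" "AE t in L. f' t = y t" "AE t in L. g' t = legendre_expr a y t"
      using fg(2) unfolding legendre_restrict_def by blast
    have "x \<in> D_max a" "y \<in> D_max a" using D x(3) y(3) by auto
    from legendre_expr_lin[OF this, of c d] x(5) y(5)
    have "AE t in L. c * g t + d * g' t = legendre_expr a (\<lambda>t. c * x t + d * y t) t"
      by eventually_elim simp
    moreover have "AE t in L. c * f t + d * f' t = c * x t + d * y t"
      using x(4) y(4) by eventually_elim simp
    moreover have "(\<lambda>t. c * f t + d * f' t) \<in> L2 L" "(\<lambda>t. c * g t + d * g' t) \<in> L2 L"
      by (intro L2_add L2_cmult x y)+
    ultimately show ?thesis by (intro legendre_restrict_memI[OF _ _ lin[OF x(3) y(3)]])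
  qed
  have sat: "(f', g') \<in> ?G" if fg: "(f, g) \<in> ?G" "f' \<in> L2 L" "g' \<in> L2 L" "AE t in L. f' t = f t" "AE t in L. g' t = g t" for f g f' g'
  proof -
    obtain x where x: "x \<in> D" "AE t in L. f t = x t" "AE t in L. g t = legendre_expr a x t"
      using fg(1) unfolding legendre_restrict_def by blast
    have "AE t in L. f' t = x t" using fg(4) x(2) by eventually_elim simp
    moreover have "AE t in L. g' t = legendre_expr a x t" using fg(5) x(3) by eventually_elim simp
    ultimately show ?thesis by (intro legendre_restrict_memI[OF fg(2,3) x(1)])
  qed
  have single: "AE t in L. g t = g' t" if fg: "(f, g) \<in> ?G" "(f, g') \<in> ?G" for f g g'
  proof -
    obtain x where x: "x \<in> D" "AE t in L. f t = x t" "AE t in L. g t = legendre_expr a x t"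
      using fg(1) unfolding legendre_restrict_def by blast
    obtain y where y: "y \<in> D" "AE t in L. f t = y t" "AE t in L. g' t = legendre_expr a y t"
      using fg(2) unfolding legendre_restrict_def by blast
    have xy: "x \<in> D_max a" "y \<in> D_max a" using D x(1) y(1) by auto
    have ae: "AE t in L. x t = y t" using x(2) y(2) by eventually_elim simp
    have "AE t in L. legendre_expr a x t = legendre_expr a y t"
      by (rule boundary_cong(5)[OF xy]) (rule D_max_AE_eq[OF xy ae])
    with x(3) y(3) show ?thesis by eventually_elim simp
  qed
  have zeroG: "((\<lambda>_. 0), (\<lambda>_. 0)) \<in> ?G"
  proof -
    have "(\<lambda>_. 0) \<in> D_max a" using D zero by blast
    from comb[OF legendre_restrictI[OF zero this] legendre_restrictI[OF zero this], of 0 0] show ?thesis by simp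
  qed
  have sub: "?G \<subseteq> L2 L \<times> L2 L" unfolding legendre_restrict_def by blast
  have add: "((\<lambda>t. f t + f' t), (\<lambda>t. g t + g' t)) \<in> ?G" if "(f, g) \<in> ?G" "(f', g') \<in> ?G" for f g f' g'
    using comb[OF that, of 1 1] by simp
  have scale: "((\<lambda>t. c * f t), (\<lambda>t. c * g t)) \<in> ?G" if "(f, g) \<in> ?G" for c f g
    using comb[OF that that, of c 0] by simp
  show ?thesis
    unfolding linear_operator_def
    by (intro conjI sub zeroG allI ballI impI case_prodI2) (use sat add scale single in blast)+
qed

section \<open>The operators \<open>M_U\<close>: domains, adjoints and inclusions\<close>

lemma zero_D_max: "(\<lambda>_. 0) \<in> D_max a"
  using D_max_lin[OF boundary_one(1) boundary_one(1), of 0 0] by simp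

lemma D_U_lin: "x \<in> D_U a U \<Longrightarrow> y \<in> D_U a U \<Longrightarrow> (\<lambda>t. c * x t + d * y t) \<in> D_U a U"
proof -
  assume x: "x \<in> D_U a U" and y: "y \<in> D_U a U"
  then have xy: "x \<in> D_max a" "y \<in> D_max a" using D_U_iff by blast+
  have "c * w1 x + d * w1 y + U$1$1 * (c * v1 x + d * v1 y) + U$1$2 * (c * v2 x + d * v2 y) =
      c * (w1 x + U$1$1 * v1 x + U$1$2 * v2 x) + d * (w1 y + U$1$1 * v1 y + U$1$2 * v2 y)"
    "c * w2 x + d * w2 y + U$2$1 * (c * v1 x + d * v1 y) + U$2$2 * (c * v2 x + d * v2 y) =
      c * (w2 x + U$2$1 * v1 x + U$2$2 * v2 x) + d * (w2 y + U$2$1 * v1 y + U$2$2 * v2 y)"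
    by (simp_all add: algebra_simps)
  then show ?thesis using x y unfolding D_U_iff data_lin[OF xy] by (simp add: D_max_lin[OF xy])
qed

lemma zero_boundary_D_U:
  assumes "x \<in> D_max a" "b_left a x = 0" "c_left a x = 0" "b_right a x = 0" "c_right a x = 0"
  shows "x \<in> D_U a U"
  using assms data_zero[OF assms(2-5)] by (simp add: D_U_iff)

lemma compact_support_D_U: "{x \<in> D_max a. compact (interval_support a x)} \<subseteq> D_U a U"
  using boundary_compact_support zero_boundary_D_U by blast

text \<open>By the column relations \<open>U\<close> is isometric and its graph isotropic.
  Conversely, orthogonality to the graph says that \<open>v\<close> is minus
  \<open>conj_transpose U\<close> applied to \<open>w\<close>, and the row relations turn this into
  \<open>w = - U v\<close>.\<close>

lemma D_U_lagrangian:
  assumes U: "unitary_matrix U"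
  shows "{y \<in> D_max a. \<forall>x\<in>D_U a U. lagr x y} = D_U a U"
proof (intro equalityI subsetI)
  fix y assume y: "y \<in> D_U a U"
  have rep: "w1 x = - (U$1$1 * v1 x + U$1$2 * v2 x)" "w2 x = - (U$2$1 * v1 x + U$2$2 * v2 x)"
    if "x \<in> D_U a U" for x
    by (rule eq_neg_iff_add_eq_0[THEN iffD2], use that in \<open>simp add: D_U_iff add.assoc\<close>)+
  have yD: "y \<in> D_max a" using y by (simp add: D_U_iff)
  note wy = rep[OF y]
  have "lagr x y" if x: "x \<in> D_U a U" for x
  proof -
    note wx = rep[OF x]
    have "w1 x * cnj (w1 y) + w2 x * cnj (w2 y) =
        (cnj (U$1$1) * U$1$1 + cnj (U$2$1) * U$2$1) * (v1 x * cnj (v1 y)) +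
        (cnj (U$1$1) * U$1$2 + cnj (U$2$1) * U$2$2) * (v2 x * cnj (v1 y)) +
        (cnj (U$1$2) * U$1$1 + cnj (U$2$2) * U$2$1) * (v1 x * cnj (v2 y)) +
        (cnj (U$1$2) * U$1$2 + cnj (U$2$2) * U$2$2) * (v2 x * cnj (v2 y))"
      unfolding wx wy by (simp add: algebra_simps)
    also have "\<dots> = v1 x * cnj (v1 y) + v2 x * cnj (v2 y)"
      using U unfolding unitary_matrix_2_iff by simp
    finally show ?thesis by (simp add: lagr_def)
  qed
  with yD show "y \<in> {y \<in> D_max a. \<forall>x\<in>D_U a U. lagr x y}" by blast
next
  fix y assume "y \<in> {y \<in> D_max a. \<forall>x\<in>D_U a U. lagr x y}"
  then have yD: "y \<in> D_max a" and lag: "\<And>x. x \<in> D_U a U \<Longrightarrow> lagr x y" by auto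
  \<comment> \<open>Test functions with \<open>v\<close> data \<open>(1, 0)\<close> and, further
    down, \<open>(0, 1)\<close>; to lie in the domain their \<open>w\<close> data must be the
    negated columns of \<open>U\<close>.\<close>
  obtain x where x: "x \<in> D_max a" "v1 x = 1" "v2 x = 0" "w1 x = - U$1$1" "w2 x = - U$2$1"
    using data_surj by blast
  then have "x \<in> D_U a U" by (simp add: D_U_iff)
  from lag[OF this] have "cnj (v1 y) = - U$1$1 * cnj (w1 y) - U$2$1 * cnj (w2 y)"
    unfolding lagr_def x by simp
  from arg_cong[OF this, of cnj] have v1: "v1 y = - cnj (U$1$1) * w1 y - cnj (U$2$1) * w2 y" by simp
  obtain x where x: "x \<in> D_max a" "v1 x = 0" "v2 x = 1" "w1 x = - U$1$2" "w2 x = - U$2$2"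
    using data_surj by blast
  then have "x \<in> D_U a U" by (simp add: D_U_iff)
  from lag[OF this] have "cnj (v2 y) = - U$1$2 * cnj (w1 y) - U$2$2 * cnj (w2 y)"
    unfolding lagr_def x by simp
  from arg_cong[OF this, of cnj] have v2: "v2 y = - cnj (U$1$2) * w1 y - cnj (U$2$2) * w2 y" by simp
  have "w1 y + U$1$1 * v1 y + U$1$2 * v2 y = w1 y - ((U$1$1 * cnj (U$1$1) + U$1$2 * cnj (U$1$2)) * w1 y +
      (U$1$1 * cnj (U$2$1) + U$1$2 * cnj (U$2$2)) * w2 y)"
    unfolding v1 v2 by (simp add: algebra_simps)
  moreover have "w2 y + U$2$1 * v1 y + U$2$2 * v2 y = w2 y - ((U$2$1 * cnj (U$1$1) + U$2$2 * cnj (U$1$2)) * w1 y +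
      (U$2$1 * cnj (U$2$1) + U$2$2 * cnj (U$2$2)) * w2 y)"
    unfolding v1 v2 by (simp add: algebra_simps)
  ultimately show "y \<in> D_U a U"
    using yD unfolding unitary_matrix_2_rows[OF U] by (simp add: D_U_iff)
qed

lemma adjoint_M_U: "unitary_matrix U \<Longrightarrow> adjoint_operator L (M_U a U) = M_U a U"
  unfolding M_U_def adjoint_legendre_restrict[OF D_U_subset compact_support_D_U] by (simp add: D_U_lagrangian)

lemma self_adjoint_M_U:
  assumes U: "unitary_matrix U"
  shows "self_adjoint_operator L (M_U a U)"
proof -
  have "(\<lambda>_. 0) \<in> D_U a U"
    using data_lin[OF zero_D_max zero_D_max, of 0 0] zero_D_max by (simp add: D_U_iff)
  then have "linear_operator L (M_U a U)"
    unfolding M_U_def by (rule linear_operator_legendre_restrict[OF D_U_subset _ D_U_lin])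
  moreover have "densely_defined L (M_U a U)"
    unfolding densely_defined_def
  proof (intro ballI allI impI)
    fix f and \<epsilon> :: real assume f: "f \<in> L2 L" "\<epsilon> > 0"
    obtain x where x: "x \<in> D_max a" "b_left a x = 0" "c_left a x = 0" "b_right a x = 0" "c_right a x = 0"
      "L2_norm L (\<lambda>t. f t - x t) < \<epsilon>"
      by (rule zero_boundary_dense[OF f])
    have "(x, legendre_expr a x) \<in> M_U a U"
      unfolding M_U_def by (rule legendre_restrictI[OF zero_boundary_D_U[OF x(1-5)] x(1)])
    with x(6) show "\<exists>(u, v)\<in>M_U a U. L2_norm L (\<lambda>t. f t - u t) < \<epsilon>" by blast
  qed
  ultimately show ?thesis
    unfolding self_adjoint_operator_def using adjoint_M_U[OF U] by blast
qed

text \<open>\<open>M_U a U\<close> is an adjoint, namely its own, and therefore closed; so it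
  contains the closure of the compactly supported operator.\<close>

lemma M_min_subset_M_U:
  assumes U: "unitary_matrix U"
  shows "M_min a \<subseteq> M_U a U"
proof -
  have "M_U a U \<subseteq> L2 L \<times> L2 L" unfolding M_U_def legendre_restrict_def by blast
  moreover have "legendre_restrict a {x \<in> D_max a. compact (interval_support a x)} \<subseteq> adjoint_operator L (M_U a U)"
    unfolding adjoint_M_U[OF U] unfolding M_U_def
    by (rule legendre_restrict_mono[OF compact_support_D_U])
  ultimately have "M_min a \<subseteq> adjoint_operator L (M_U a U)"
    unfolding M_min_def by (rule operator_closure_subset_adjoint)
  then show ?thesis by (simp only: adjoint_M_U[OF U])
qed

lemma M_U_subset_M_max: "M_U a U \<subseteq> M_max a"
  unfolding M_U_def M_max_def by (rule legendre_restrict_mono[OF D_U_subset])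

section \<open>Classification of the self-adjoint extensions\<close>

lemma compact_support_M_min:
  assumes "x \<in> D_max a" "compact (interval_support a x)"
  shows "(x, legendre_expr a x) \<in> M_min a"
proof -
  let ?G = "legendre_restrict a {x \<in> D_max a. compact (interval_support a x)}"
  have G: "(x, legendre_expr a x) \<in> ?G" by (rule legendre_restrictI) (use assms in auto)
  have L2: "x \<in> L2 L" "legendre_expr a x \<in> L2 L" using assms by (auto simp: D_max_def)
  have "\<exists>(u, v)\<in>?G. L2_norm L (\<lambda>t. x t - u t) < \<epsilon> \<and> L2_norm L (\<lambda>t. legendre_expr a x t - v t) < \<epsilon>" if "\<epsilon> > 0" for \<epsilon>
    by (rule bexI[OF _ G]) (use that in \<open>simp add: L2_norm_zero\<close>)
  then show ?thesis using L2 unfolding M_min_def operator_closure_def by blast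
qed

text \<open>\<open>M\<close> is its own adjoint and extends the compactly supported operator, so
  each of its elements has a representative in the maximal domain, and saturation puts the pair of
  that representative and its image back into \<open>M\<close>. Hence \<open>M\<close> is determined
  by the set \<open>D\<close> of these representatives.\<close>

lemma self_adjoint_extension:
  assumes M: "self_adjoint_operator L M" and min: "M_min a \<subseteq> M"
  obtains D where "M = legendre_restrict a D" "D = {y \<in> D_max a. \<forall>x\<in>D. lagr x y}"
proof -
  define D where "D = {x \<in> D_max a. (x, legendre_expr a x) \<in> M}"
  have lin: "linear_operator L M" and adj: "adjoint_operator L M = M"
    using M by (auto simp: self_adjoint_operator_def)
  have sub: "M \<subseteq> L2 L \<times> L2 L" using lin unfolding linear_operator_def by (elim conjE)
  have sat: "(f', g') \<in> M"
    if "(f, g) \<in> M" "f' \<in> L2 L" "g' \<in> L2 L" "AE t in L. f' t = f t" "AE t in L. g' t = g t" for f g f' g'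
  proof -
    have "\<forall>(f, g)\<in>M. \<forall>f'\<in>L2 L. \<forall>g'\<in>L2 L.
        (AE t in L. f' t = f t) \<and> (AE t in L. g' t = g t) \<longrightarrow> (f', g') \<in> M"
      using lin unfolding linear_operator_def by (elim conjE)
    from bspec[OF this that(1)] show ?thesis using that(2-5) by simp
  qed
  have C: "{x \<in> D_max a. compact (interval_support a x)} \<subseteq> D"
    unfolding D_def using compact_support_M_min min by blast
  have D_sub: "D \<subseteq> D_max a" by (auto simp: D_def)
  have M_eq: "M = legendre_restrict a D"
  proof (rule set_eqI, rule iffI)
    fix yz assume yzM: "yz \<in> M"
    obtain y z where yz: "yz = (y, z)" "y \<in> L2 L" "z \<in> L2 L" using sub yzM by blast
    have "(y, z) \<in> adjoint_operator L M" using yzM yz adj by simp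
    then have adj': "\<forall>(x, w)\<in>M. L2_inner L w y = L2_inner L x z"
      unfolding adjoint_operator_def by simp
    have *: "L2_inner L (legendre_expr a x) y = L2_inner L x z"
      if "x \<in> D_max a" "compact (interval_support a x)" for x
    proof -
      have "(x, legendre_expr a x) \<in> M" using C that unfolding D_def by blast
      from bspec[OF adj' this] show ?thesis by simp
    qed
    obtain y0 where y0: "y0 \<in> D_max a" "AE t in L. y t = y0 t" "AE t in L. z t = legendre_expr a y0 t"
      by (rule adjoint_compact_support[OF yz(2,3) *])
    have "(y0, legendre_expr a y0) \<in> M"
      using sat[OF yzM[unfolded yz(1)] _ _ AE_symmetric[OF y0(2)] AE_symmetric[OF y0(3)]] y0(1)
      by (simp add: D_max_def)
    then have "y0 \<in> D" using y0(1) by (simp add: D_def)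
    then show "yz \<in> legendre_restrict a D"
      unfolding yz(1) by (intro legendre_restrict_memI[OF yz(2,3) _ y0(2,3)])
  next
    fix yz assume "yz \<in> legendre_restrict a D"
    then obtain y z x where yz: "yz = (y, z)" "y \<in> L2 L" "z \<in> L2 L" "(x, legendre_expr a x) \<in> M"
      "AE t in L. y t = x t" "AE t in L. z t = legendre_expr a x t"
      unfolding legendre_restrict_def D_def by blast
    then show "yz \<in> M" using sat[OF yz(4,2,3,5,6)] by simp
  qed
  let ?D' = "{y \<in> D_max a. \<forall>x\<in>D. lagr x y}"
  have M_eq': "M = legendre_restrict a ?D'"
    using adj adjoint_legendre_restrict[OF D_sub C] M_eq by simp
  \<comment> \<open>Equality of the graphs gives equality of the domains as sets of functions,
    because boundary data depend on the class only.\<close>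
  have "D = ?D'"
  proof (intro equalityI subsetI)
    fix y assume y: "y \<in> ?D'"
    have "(y, legendre_expr a y) \<in> legendre_restrict a ?D'" by (rule legendre_restrictI[OF y]) (use y in simp)
    then have "(y, legendre_expr a y) \<in> M" unfolding M_eq' .
    then show "y \<in> D" using y unfolding D_def by blast
  next
    fix y assume y: "y \<in> D"
    then have yD: "y \<in> D_max a" and "(y, legendre_expr a y) \<in> M" unfolding D_def by blast+
    then have "(y, legendre_expr a y) \<in> legendre_restrict a ?D'" unfolding M_eq' by blast
    then obtain y' where y': "y' \<in> ?D'" "AE t in L. y t = y' t"
      unfolding legendre_restrict_def by blast
    then have "y' \<in> D_max a" by simp
    note eq = data_AE_cong[OF yD this y'(2)]
    have "\<forall>x\<in>D. lagr x y'" using y'(1) by blast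
    then have "\<forall>x\<in>D. lagr x y" unfolding lagr_def eq .
    then show "y \<in> ?D'" using yD by blast
  qed
  with M_eq show ?thesis by (rule that)
qed

text \<open>\<open>B\<close> is the set of boundary data of \<open>D\<close>. Every data vector is
  realised in the maximal domain, by \<open>data_surj\<close>, so that \<open>D\<close> being its
  own complement becomes the hypothesis of \<open>lagrangian_unitary_graph\<close>.\<close>

lemma self_adjoint_extension_M_U:
  assumes M: "self_adjoint_operator L M" and min: "M_min a \<subseteq> M"
  obtains U :: "complex^2^2" where "unitary_matrix U" "M = M_U a U"
proof -
  obtain D where D: "M = legendre_restrict a D" "D = {y \<in> D_max a. \<forall>x\<in>D. lagr x y}"
    by (rule self_adjoint_extension[OF M min])
  define B where "B p1 p2 r1 r2 \<longleftrightarrow> (\<exists>x\<in>D. v1 x = p1 \<and> v2 x = p2 \<and> w1 x = r1 \<and> w2 x = r2)" for p1 p2 r1 r2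
  have D_iff: "y \<in> D \<longleftrightarrow> y \<in> D_max a \<and> (\<forall>x\<in>D. lagr x y)" for y
    using D(2) by blast
  \<comment> \<open>Membership in \<open>D\<close> depends on a function of the maximal domain only
    through its boundary data, because \<open>lagr\<close> does.\<close>
  have D_B: "y \<in> D \<longleftrightarrow> y \<in> D_max a \<and> B (v1 y) (v2 y) (w1 y) (w2 y)" for y
  proof
    show "y \<in> D_max a \<and> B (v1 y) (v2 y) (w1 y) (w2 y)" if "y \<in> D"
      using that D_iff[of y] unfolding B_def by blast
    assume y: "y \<in> D_max a \<and> B (v1 y) (v2 y) (w1 y) (w2 y)"
    then obtain y' where y': "y' \<in> D" "v1 y' = v1 y" "v2 y' = v2 y" "w1 y' = w1 y" "w2 y' = w2 y"
      unfolding B_def by blast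
    then have "\<forall>x\<in>D. lagr x y'" using D_iff by blast
    then have "\<forall>x\<in>D. lagr x y" unfolding lagr_def y' .
    then show "y \<in> D" using y D_iff by blast
  qed
  have B_iff: "B p1 p2 r1 r2 \<longleftrightarrow> (\<forall>p1' p2' r1' r2'. B p1' p2' r1' r2' \<longrightarrow>
      p1' * cnj p1 + p2' * cnj p2 = r1' * cnj r1 + r2' * cnj r2)" for p1 p2 r1 r2
  proof -
    obtain y where y: "y \<in> D_max a" "v1 y = p1" "v2 y = p2" "w1 y = r1" "w2 y = r2"
      using data_surj by blast
    have "B p1 p2 r1 r2 \<longleftrightarrow> y \<in> D" using D_B[of y] y by simp
    also have "\<dots> \<longleftrightarrow> (\<forall>x\<in>D. lagr x y)" using D_iff[of y] y(1) by blast
    also have "\<dots> \<longleftrightarrow> (\<forall>p1' p2' r1' r2'. B p1' p2' r1' r2' \<longrightarrow>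
      p1' * cnj p1 + p2' * cnj p2 = r1' * cnj r1 + r2' * cnj r2)"
      unfolding B_def lagr_def y by blast
    finally show ?thesis .
  qed
  obtain U :: "complex^2^2" where U: "unitary_matrix U"
    "\<And>p1 p2 r1 r2. B p1 p2 r1 r2 \<longleftrightarrow> r1 + U$1$1 * p1 + U$1$2 * p2 = 0 \<and> r2 + U$2$1 * p1 + U$2$2 * p2 = 0"
    by (rule lagrangian_unitary_graph[OF B_iff]) (rule that)
  have "D = D_U a U"
    by (rule set_eqI) (simp only: D_B U(2) D_U_iff)
  then have "M = M_U a U" using D(1) by (simp add: M_U_def)
  with U(1) show ?thesis by (rule that)
qed

text \<open>The domain determines the matrix: an element with \<open>v\<close> data
  \<open>(1, 0)\<close> must have the negated first column as \<open>w\<close> data, and one with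
  \<open>(0, 1)\<close> the negated second column.\<close>

lemma M_U_eq_imp:
  assumes eq: "M_U a U = M_U a U'"
  shows "U = U'"
proof -
  have D: "x \<in> D_U a U'" if x: "x \<in> D_U a U" for x
  proof -
    have xD: "x \<in> D_max a" using x D_U_subset by blast
    have "(x, legendre_expr a x) \<in> legendre_restrict a (D_U a U')"
      using legendre_restrictI[OF x xD] eq by (simp add: M_U_def)
    then obtain y where y: "y \<in> D_U a U'" "AE t in L. x t = y t"
      unfolding legendre_restrict_def by blast
    then have "y \<in> D_max a" using D_U_subset by blast
    from data_AE_cong[OF xD this y(2)] y(1) xD show ?thesis by (simp add: D_U_iff)
  qed
  obtain x where x: "x \<in> D_max a" "v1 x = 1" "v2 x = 0" "w1 x = - U$1$1" "w2 x = - U$2$1"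
    using data_surj by blast
  then have "x \<in> D_U a U" by (simp add: D_U_iff)
  from D[OF this] have 1: "U$1$1 = U'$1$1" "U$2$1 = U'$2$1" unfolding D_U_iff x by simp_all
  obtain x where x: "x \<in> D_max a" "v1 x = 0" "v2 x = 1" "w1 x = - U$1$2" "w2 x = - U$2$2"
    using data_surj by blast
  then have "x \<in> D_U a U" by (simp add: D_U_iff)
  from D[OF this] have 2: "U$1$2 = U'$1$2" "U$2$2 = U'$2$2" unfolding D_U_iff x by simp_all
  show ?thesis using 1 2 by (simp add: vec_eq_iff forall_2)
qed

end

theorem theorem8p8:
  fixes a :: real
  assumes "a > 0"
  shows
    "(\<forall>U :: complex^2^2. unitary_matrix U \<longrightarrow>
        self_adjoint_operator (lebesgue_interval a) (M_U a U) \<and>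
        M_min a \<subseteq> M_U a U \<and> M_U a U \<subseteq> M_max a) \<and>
     (\<forall>M :: real L2_graph.
        self_adjoint_operator (lebesgue_interval a) M \<and> M_min a \<subseteq> M \<longrightarrow>
        M \<subseteq> M_max a \<and> (\<exists>U :: complex^2^2. unitary_matrix U \<and> M = M_U a U)) \<and>
     (\<forall>U\<^sub>1 U\<^sub>2 :: complex^2^2. unitary_matrix U\<^sub>1 \<and> unitary_matrix U\<^sub>2 \<longrightarrow>
        (U\<^sub>1 = U\<^sub>2 \<longleftrightarrow> M_U a U\<^sub>1 = M_U a U\<^sub>2))"
proof -
  interpret legendre a by unfold_locales (rule assms)
  show ?thesis
  proof (intro conjI allI impI)
    fix U :: "complex^2^2" assume "unitary_matrix U"
    then show "self_adjoint_operator (lebesgue_interval a) (M_U a U)" "M_min a \<subseteq> M_U a U"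
      by (rule self_adjoint_M_U, rule M_min_subset_M_U)
    show "M_U a U \<subseteq> M_max a" by (rule M_U_subset_M_max)
  next
    fix M assume "self_adjoint_operator (lebesgue_interval a) M \<and> M_min a \<subseteq> M"
    then obtain U :: "complex^2^2" where U: "unitary_matrix U" "M = M_U a U"
      using self_adjoint_extension_M_U[of M] by blast
    then show "M \<subseteq> M_max a" using M_U_subset_M_max by simp
    show "\<exists>U :: complex^2^2. unitary_matrix U \<and> M = M_U a U" using U by blast
  next
    fix U\<^sub>1 U\<^sub>2 :: "complex^2^2"
    show "U\<^sub>1 = U\<^sub>2 \<longleftrightarrow> M_U a U\<^sub>1 = M_U a U\<^sub>2" using M_U_eq_imp by blast
  qed
qed

end
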